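(* Let $d\geq 1$, $\kappa\in[0,\infty)$ and $\gamma\in(0,\infty)$, let $\xi$ be a dynamic random environment on $\mathbb{Z}^d$ satisfying the standing assumptions (A) and (B) of the context, and let $u$ be the solution of the parabolic Anderson equation driven by $\xi$ with initial condition $u(\cdot,0)=\delta_0(\cdot)$. Then the limit $$\lambda_0=\lim_{t\to\infty}\frac1t\log u(0,t)$$ exists $\mathbb{P}$-a.s. and in $\mathbb{P}$-mean (i.e. in $L^1(\mathbb{P})$), and is finite.
   Context: Environment: $\xi=\{\xi(x,t)\colon x\in\mathbb{Z}^d,\,t\geq 0\}$ is an $\mathbb{R}$-valued random field on a probability space with law $\mathbb{P}$ (expectation $\mathbb{E}$), regular enough in $t$ for the time integrals below to make sense. Parabolic Anderson equation: $\frac{\partial}{\partial t}u(x,t)=\kappa\Delta u(x,t)+\gamma\xi(x,t)u(x,t)$, $x\in\mathbb{Z}^d$, $t\geq 0$, with $u(x,0)=\delta_0(x)$ (equal to $1$ if $x=0$ and $0$ otherwise), where $\Delta u(x,t)=\sum_{y\in\mathbb{Z}^d,\,\|y-x\|=1}[u(y,t)-u(x,t)]$ and $\|\cdot\|$ is the Euclidean norm. The solution is given by the Feynman-Kac formula; in particular $$u(0,t)=\mathrm{E}_0\Big(\exp\Big[\gamma\int_0^t\xi(X^\kappa(s),s)\,ds\Big]\,\delta_0(X^\kappa(t))\Big),$$ where $X^\kappa$ is simple random walk on $\mathbb{Z}^d$ in continuous time, independent of $\xi$, stepping at rate $2d\kappa$, and $\mathrm{E}_0$ is expectation over $X^\kappa$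 (only) with $X^\kappa(0)=0$. Standing assumptions: (A) $\xi$ is stationary and ergodic under translations in space and time (its law is invariant under space-time shifts, and is ergodic under the group of spatial shifts and under time shifts), $\xi$ is not constant, and $\rho=\mathbb{E}(\xi(0,0))\in\mathbb{R}$. (B) For all $\kappa,\gamma\in[0,\infty)$ there is a $c=c(\kappa,\gamma)<\infty$ such that $\mathbb{E}(\log u(0,t))\leq ct$ for all $t\geq 0$. *)

theory Defs
  imports "HOL-Probability.Probability"
begin

section \<open>The lattice and simple random walk in continuous time\<close>

text \<open>The lattice \<open>\<int>\<^sup>d\<close> is the type \<open>int ^ 'd\<close> with \<open>d = CARD('d) \<ge> 1\<close>.\<close>

definition lattice_norm :: "int ^ 'd \<Rightarrow> real" where
  "lattice_norm x = norm (\<chi> i. real_of_int (x $ i))"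

definition unit_steps :: "(int ^ 'd) set" where
  "unit_steps = {e. lattice_norm e = 1}"

lemma unit_steps_eq:
  "(unit_steps :: (int ^ 'd) set) = (\<lambda>i. axis i 1) ` UNIV \<union> (\<lambda>i. axis i (-1)) ` UNIV"
proof (intro equalityI subsetI)
  fix e :: "int ^ 'd" assume "e \<in> unit_steps"
  then have "(\<Sum>i\<in>UNIV. (real_of_int (e $ i))\<^sup>2) = 1"
    by (simp add: unit_steps_def lattice_norm_def norm_vec_def L2_set_def)
  then have "real_of_int (\<Sum>i\<in>UNIV. (e $ i)\<^sup>2) = real_of_int 1" by simp
  then have s: "(\<Sum>i\<in>UNIV. (e $ i)\<^sup>2) = 1" by (simp only: of_int_eq_iff)
  then obtain i where i: "e $ i \<noteq> 0"
    by (metis (mono_tags, lifting) power_zero_numeral sum.neutral zero_neq_one)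
  have split: "(\<Sum>j\<in>UNIV. (e $ j)\<^sup>2) = (e $ i)\<^sup>2 + (\<Sum>j\<in>UNIV - {i}. (e $ j)\<^sup>2)"
    by (rule sum.remove) auto
  have nn: "(\<Sum>j\<in>UNIV - {i}. (e $ j)\<^sup>2) \<ge> 0" by (simp add: sum_nonneg)
  have "(e $ i)\<^sup>2 > 0" using i by simp
  with split s nn have sq: "(e $ i)\<^sup>2 = 1" and rest: "(\<Sum>j\<in>UNIV - {i}. (e $ j)\<^sup>2) = 0"
    by linarith+
  from rest have z: "e $ j = 0" if "j \<noteq> i" for j
    using that by (subst (asm) sum_nonneg_eq_0_iff) auto
  from sq have "e $ i = 1 \<or> e $ i = -1" by (simp add: power2_eq_1_iff)
  with z have "e = axis i 1 \<or> e = axis i (-1)" by (auto simp: vec_eq_iff axis_def)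
  then show "e \<in> (\<lambda>i. axis i 1) ` UNIV \<union> (\<lambda>i. axis i (-1)) ` UNIV" by auto
next
  fix e :: "int ^ 'd"
  have *: "(\<Sum>j\<in>UNIV. (real_of_int (axis i c $ j))\<^sup>2) = (real_of_int c)\<^sup>2" for i :: 'd and c
  proof -
    have "(real_of_int (axis i c $ j))\<^sup>2 = (if j = i then (real_of_int c)\<^sup>2 else 0)" for j
      by (simp add: axis_def)
    then show ?thesis by simp
  qed
  assume "e \<in> (\<lambda>i. axis i 1) ` UNIV \<union> (\<lambda>i. axis i (-1)) ` UNIV"
  then show "e \<in> unit_steps"
    by (auto simp: unit_steps_def lattice_norm_def norm_vec_def L2_set_def *)
qed

lemma finite_unit_steps: "finite (unit_steps :: (int ^ 'd) set)"
  by (simp add: unit_steps_eq)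

lemma card_unit_steps: "card (unit_steps :: (int ^ 'd) set) = 2 * CARD('d)"
proof -
  have inj: "inj (\<lambda>i. axis i c :: int ^ 'd)" if "c \<noteq> 0" for c :: int
    using that by (auto simp: inj_def axis_eq_axis)
  have "card (unit_steps :: (int ^ 'd) set)
      = card (range (\<lambda>i. axis i 1 :: int ^ 'd)) + card (range (\<lambda>i. axis i (-1) :: int ^ 'd))"
    unfolding unit_steps_eq by (rule card_Un_disjoint) (auto simp: axis_eq_axis)
  then show ?thesis by (simp add: card_image inj)
qed

text \<open>A sample point is the sequence of pairs (holding time, step): the holding times are
  exponential with parameter 1, the steps uniform on the \<open>2d\<close> nearest neighbours of the origin,
  all of them independent.\<close>

definition walk_space :: "(nat \<Rightarrow> real \<times> (int ^ 'd)) measure" where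
  "walk_space = PiM UNIV (\<lambda>_. density lborel (\<lambda>r. ennreal (exponential_density 1 r))
                              \<Otimes>\<^sub>M measure_pmf (pmf_of_set unit_steps))"

text \<open>The number of jumps up to time \<open>s\<close> is a unit rate Poisson process at time \<open>2d\<kappa>s\<close>, i.e. the
  walk jumps at rate \<open>2d\<kappa>\<close>. This also covers \<open>\<kappa> = 0\<close>, where the walk almost surely never jumps.
  The set of jump indices is almost surely a finite initial segment of the naturals.\<close>

definition num_jumps :: "real \<Rightarrow> (nat \<Rightarrow> real \<times> (int ^ 'd)) \<Rightarrow> real \<Rightarrow> nat" where
  "num_jumps \<kappa> w s = card {n. (\<Sum>j\<le>n. fst (w j)) \<le> 2 * real CARD('d) * \<kappa> * s}"

definition walk :: "real \<Rightarrow> (nat \<Rightarrow> real \<times> (int ^ 'd)) \<Rightarrow> real \<Rightarrow> int ^ 'd" where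
  "walk \<kappa> w s = (\<Sum>i<num_jumps \<kappa> w s. snd (w i))"


section \<open>The solution of the parabolic Anderson equation\<close>

text \<open>
  The solution of \<open>\<partial>u/\<partial>t = \<kappa>\<Delta>u + \<gamma>\<xi>u\<close>, \<open>u(\<cdot>,0) = \<delta>\<^sub>0\<close>, is given by the Feynman-Kac formula
  \<open>u(x,t) = E\<^sub>x(exp[\<gamma> \<integral>\<^sub>0\<^sup>t \<xi>(X(s),t-s) ds] \<delta>\<^sub>0(X(t)))\<close>. Reversing time turns this into
  \<open>u(x,t) = E\<^sub>0(exp[\<gamma> \<integral>\<^sub>0\<^sup>t \<xi>(X(s),s) ds] \<delta>\<^sub>x(X(t)))\<close>, which is the form used here.
  The environment is a family of random variables \<open>\<xi> x t\<close>, of which only those with \<open>t \<ge> 0\<close>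
  matter; the expectation is over the walk only, for fixed \<open>\<omega>\<close>, and may be infinite.\<close>

definition pam_solution ::
  "real \<Rightarrow> real \<Rightarrow> (int ^ 'd \<Rightarrow> real \<Rightarrow> 'w \<Rightarrow> real) \<Rightarrow> int ^ 'd \<Rightarrow> real \<Rightarrow> 'w \<Rightarrow> ennreal" where
  "pam_solution \<kappa> \<gamma> \<xi> x t \<omega> =
     (\<integral>\<^sup>+ w. ennreal (exp (\<gamma> * (LBINT s:{0..t}. \<xi> (walk \<kappa> w s) s \<omega>)))
            * (if walk \<kappa> w t = x then 1 else 0) \<partial>walk_space)"

definition ln_ennreal :: "ennreal \<Rightarrow> ereal" where
  "ln_ennreal u = (if u = 0 then -\<infinity> else if u = \<infinity> then \<infinity> else ereal (ln (enn2real u)))"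


section \<open>Assumptions on the environment\<close>

definition regular_environment ::
  "'w measure \<Rightarrow> (int ^ 'd \<Rightarrow> real \<Rightarrow> 'w \<Rightarrow> real) \<Rightarrow> bool" where
  "regular_environment M \<xi> \<longleftrightarrow>
     (\<forall>x. (\<lambda>(\<omega>, t). \<xi> x t \<omega>) \<in> borel_measurable (M \<Otimes>\<^sub>M restrict_space borel {0..})) \<and>
     (AE \<omega> in M. \<forall>x. \<forall>t\<ge>0. set_integrable lborel {0..t} (\<lambda>s. \<xi> x s \<omega>))"

definition env_space :: "(((int ^ 'd) \<times> real) \<Rightarrow> real) measure" where
  "env_space = PiM (UNIV \<times> {0..}) (\<lambda>_. borel)"

definition env_law ::
  "'w measure \<Rightarrow> (int ^ 'd \<Rightarrow> real \<Rightarrow> 'w \<Rightarrow> real) \<Rightarrow> (((int ^ 'd) \<times> real) \<Rightarrow> real) measure" where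
  "env_law M \<xi> = distr M env_space (\<lambda>\<omega>. \<lambda>p\<in>UNIV \<times> {0..}. \<xi> (fst p) (snd p) \<omega>)"

definition env_shift ::
  "int ^ 'd \<Rightarrow> real \<Rightarrow> (((int ^ 'd) \<times> real) \<Rightarrow> real) \<Rightarrow> (((int ^ 'd) \<times> real) \<Rightarrow> real)" where
  "env_shift y s f = (\<lambda>p\<in>UNIV \<times> {0..}. f (fst p + y, snd p + s))"

definition stationary_law :: "(((int ^ 'd) \<times> real) \<Rightarrow> real) measure \<Rightarrow> bool" where
  "stationary_law L \<longleftrightarrow> (\<forall>y. \<forall>s\<ge>0. distr L env_space (env_shift y s) = L)"

text \<open>Invariance of events has to be understood modulo null sets: an event in the product
  \<open>\<sigma>\<close>-algebra depends on countably many times only, so the only events that are strictly invariant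
  under all time shifts are the empty set and the whole space.\<close>

definition ergodic_under :: "'a measure \<Rightarrow> ('a \<Rightarrow> 'a) set \<Rightarrow> bool" where
  "ergodic_under L \<Theta> \<longleftrightarrow>
     (\<forall>A\<in>sets L. (\<forall>\<theta>\<in>\<Theta>. AE f in L. \<theta> f \<in> A \<longleftrightarrow> f \<in> A) \<longrightarrow> measure L A = 0 \<or> measure L A = 1)"

definition assumption_A ::
  "'w measure \<Rightarrow> (int ^ 'd \<Rightarrow> real \<Rightarrow> 'w \<Rightarrow> real) \<Rightarrow> bool" where
  "assumption_A M \<xi> \<longleftrightarrow>
     stationary_law (env_law M \<xi>) \<and>
     ergodic_under (env_law M \<xi>) {env_shift y 0 | y. True} \<and>
     ergodic_under (env_law M \<xi>) {env_shift 0 s | s. s \<ge> 0} \<and>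
     \<not> (\<exists>c. AE \<omega> in M. \<forall>x. \<forall>t\<ge>0. \<xi> x t \<omega> = c) \<and>
     integrable M (\<xi> 0 0)"

text \<open>The expectation of an extended real random variable, as the difference of the expectations of
  its positive and negative parts. It is meaningful unless both are infinite; in that case its value
  is \<open>\<infinity>\<close> (\<open>\<infinity> - \<infinity> = \<infinity>\<close> for \<open>ereal\<close>), so that no finite upper bound holds.\<close>

definition ereal_expectation :: "'w measure \<Rightarrow> ('w \<Rightarrow> ereal) \<Rightarrow> ereal" where
  "ereal_expectation M Y =
     enn2ereal (\<integral>\<^sup>+ \<omega>. e2ennreal (Y \<omega>) \<partial>M) - enn2ereal (\<integral>\<^sup>+ \<omega>. e2ennreal (- Y \<omega>) \<partial>M)"

definition assumption_B ::
  "'w measure \<Rightarrow> (int ^ 'd \<Rightarrow> real \<Rightarrow> 'w \<Rightarrow> real) \<Rightarrow> bool" where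
  "assumption_B M \<xi> \<longleftrightarrow>
     (\<forall>\<kappa>\<ge>0. \<forall>\<gamma>\<ge>0. \<exists>c::real. \<forall>t\<ge>0.
        ereal_expectation M (\<lambda>\<omega>. ln_ennreal (pam_solution \<kappa> \<gamma> \<xi> 0 t \<omega>)) \<le> ereal (c * t))"

end

(* Subtracting from log u(0,t) the contribution of the walks that never jump leaves a nonnegative
   process that is superadditive along time shifts (Markov property of the walk at a time where it
   is back at the origin). Being nonnegative, it is also nondecreasing in t, so integer times
   control all times and no maximal inequality is needed. Kingman's theorem, proved by Steele's
   covering argument, gives a limit at integer times; ergodicity under real time shifts makes it
   constant, because the upper limit can only decrease under a shift. The subtracted part is an
   additive functional, whose positive and negative parts are handled by the same theorem.

   There is no time shift on the probability space itself, and time integrals of the field are not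
   measurable for the product sigma-algebra on path space. Both obstacles disappear by showing that
   the functionals in question agree almost surely with a path-measurable F evaluated at the shifted
   path (predicate is_factor). *)
theory Submission
  imports Defs
begin

text \<open>The two halves of Kingman's theorem have one source. The covering argument bounds the
  mean of the limsup by any linear growth rate of the means; applied to \<open>K - h\<close> for a
  bounded \<open>h\<close> it becomes a lower bound for ergodic averages, and block sums carry that
  bound to the liminf. Nothing is assumed integrable beforehand: values lie in
  \<open>ennreal\<close>, and truncation at an integer makes each subtraction legitimate. Two kinds
  of null sets must be kept apart. Superadditivity is a pathwise fact about a locally integrable
  field, so one null set serves all real times; agreement with a path functional holds for each
  shift separately. Inequalities between shifts are therefore derived on the probability space and
  only then carried to path space. Mean convergence is Scheffe's argument, because the means at
  integer times never exceed the limit times \<open>n\<close>. Assumption (B) enters only through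
  the linear bound on the mean of the nonnegative process.\<close>

section \<open>Kingman's theorem for nonnegative superadditive processes\<close>

text \<open>After truncation at \<open>k\<close> both integrals are finite, and equal because the
  laws agree, so the nonnegative difference vanishes almost everywhere; countably many
  \<open>k\<close> recover \<open>f\<close> and \<open>g\<close>. This turns a one-sided comparison
  under a measure-preserving shift into invariance.\<close>

lemma AE_eq_if_le_same_distr:
  fixes f g :: "'a \<Rightarrow> ennreal"
  assumes "finite_measure M" and [measurable]: "f \<in> borel_measurable M" "g \<in> borel_measurable M"
    and le: "AE x in M. f x \<le> g x" and eq: "distr M borel f = distr M borel g"
  shows "AE x in M. f x = g x"
proof -
  interpret finite_measure M by fact
  have "AE x in M. min (f x) (of_nat k) = min (g x) (of_nat k)" for k :: nat
  proof -
    have "(\<integral>\<^sup>+x. min (f x) (of_nat k) \<partial>M) = (\<integral>\<^sup>+y. min y (of_nat k) \<partial>distr M borel f)"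
      by (simp add: nn_integral_distr)
    also have "\<dots> = (\<integral>\<^sup>+x. min (g x) (of_nat k) \<partial>M)"
      by (simp add: eq nn_integral_distr)
    finally have int_eq: "(\<integral>\<^sup>+x. min (f x) (of_nat k) \<partial>M) = (\<integral>\<^sup>+x. min (g x) (of_nat k) \<partial>M)" .
    have "(\<integral>\<^sup>+x. min (f x) (of_nat k) \<partial>M) \<le> (\<integral>\<^sup>+x. of_nat k \<partial>M)"
      by (intro nn_integral_mono) simp
    also have "\<dots> < \<infinity>" by (simp add: emeasure_eq_measure ennreal_of_nat_eq_real_of_nat ennreal_mult[symmetric])
    finally have fin: "(\<integral>\<^sup>+x. min (f x) (of_nat k) \<partial>M) \<noteq> \<infinity>" by simp
    have "(\<integral>\<^sup>+x. min (g x) (of_nat k) - min (f x) (of_nat k) \<partial>M) = 0"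
      using le int_eq fin by (subst nn_integral_diff) (auto elim!: eventually_mono intro: min.coboundedI1)
    then have "AE x in M. min (g x) (of_nat k) - min (f x) (of_nat k) = 0"
      by (subst (asm) nn_integral_0_iff_AE) auto
    with le show ?thesis
    proof eventually_elim
      case (elim x)
      have "min (f x) (of_nat k) \<noteq> top" by (auto simp: min_def top_unique)
      with elim have "min (g x) (of_nat k) \<le> min (f x) (of_nat k)"
        by (simp add: diff_eq_0_iff_ennreal)
      moreover have "min (f x) (of_nat k) \<le> min (g x) (of_nat k)"
        using elim by (intro min.mono) auto
      ultimately show ?case by (rule antisym[rotated])
    qed
  qed
  then have "AE x in M. \<forall>k::nat. min (f x) (of_nat k) = min (g x) (of_nat k)"
    by (simp add: AE_all_countable)
  then show ?thesis
  proof eventually_elim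
    case (elim x)
    have le_if: "a \<le> b" if "\<And>k::nat. min a (of_nat k) = min b (of_nat k)" for a b :: ennreal
    proof (cases b)
      case (real r)
      obtain k :: nat where k: "r < real k" using reals_Archimedean2 by blast
      have "b < of_nat k" using real k by (simp add: ennreal_of_nat_eq_real_of_nat ennreal_less_iff)
      with that[of k] show ?thesis by (auto simp: min_def split: if_splits)
    qed simp
    have "f x \<le> g x" by (rule le_if) (rule elim[rule_format])
    moreover have "g x \<le> f x" by (rule le_if) (rule elim[rule_format, symmetric])
    ultimately show ?case by (rule antisym)
  qed
qed

lemma le_mult_if_divide_less_ennreal:
  assumes "a / of_nat k < ennreal r" "k > 0"
  shows "a \<le> ennreal (r * real k)"
proof (cases a)
  case (real s)
  with assms have "ennreal (s / real k) < ennreal r"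
    by (simp add: ennreal_of_nat_eq_real_of_nat divide_ennreal)
  then have "s / real k < r" using real by (subst (asm) ennreal_less_iff) auto
  with assms show ?thesis using real by (auto simp: field_simps intro!: ennreal_leI)
next
  case top
  with assms show ?thesis by (simp add: ennreal_top_divide)
qed

text \<open>A bound \<open>r * (n + k)\<close> divided by \<open>n\<close> costs the factor
  \<open>1 + k / n\<close>, which tends to 1.\<close>

lemma limsup_divide_le_shift:
  fixes a b :: "nat \<Rightarrow> ennreal"
  assumes le: "\<And>n. a n \<le> b (n + k)"
  shows "limsup (\<lambda>n. a n / of_nat n) \<le> limsup (\<lambda>n. b n / of_nat n)"
proof (rule dense_ge)
  fix c assume "limsup (\<lambda>n. b n / of_nat n) < c"
  then have "eventually (\<lambda>n. b n / of_nat n < c) sequentially"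
    by (rule Limsup_lessD)
  then have ev: "eventually (\<lambda>n. b (n + k) / of_nat (n + k) < c) sequentially"
    by (rule sequentially_offset)
  show "limsup (\<lambda>n. a n / of_nat n) \<le> c"
  proof (cases c)
    case top then show ?thesis by simp
  next
    case (real r)
    have ev2: "eventually (\<lambda>n. a n / of_nat n \<le> ennreal (r * (1 + real k / real n))) sequentially"
      using ev eventually_gt_at_top[of 0]
    proof eventually_elim
      case (elim n)
      have "a n \<le> b (n + k)" by (rule le)
      also have "\<dots> \<le> ennreal (r * real (n + k))"
        using elim real by (intro le_mult_if_divide_less_ennreal) auto
      finally have "a n / of_nat n \<le> ennreal (r * real (n + k)) / of_nat n"
        by (rule divide_right_mono_ennreal)
      also have "\<dots> = ennreal (r * real (n + k) / real n)"
        using elim real by (simp add: ennreal_of_nat_eq_real_of_nat divide_ennreal del: of_nat_add)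
      also have "r * real (n + k) / real n = r * (1 + real k / real n)"
        using elim by (simp add: field_simps)
      finally show ?case .
    qed
    have "(\<lambda>n. ennreal (r * (1 + real k / real n))) \<longlonglongrightarrow> ennreal (r * (1 + 0))"
      by (intro tendsto_ennrealI tendsto_intros lim_const_over_n)
    then have "limsup (\<lambda>n. ennreal (r * (1 + real k / real n))) = ennreal r"
      by (intro lim_imp_Limsup) auto
    with Limsup_mono[OF ev2] show ?thesis using real by simp
  qed
qed

lemma SUP_min_of_nat_ennreal: "(SUP j::nat. min a (of_nat j)) = (a :: ennreal)"
proof (rule antisym)
  show "a \<le> (SUP j::nat. min a (of_nat j))"
  proof (cases a)
    case (real r)
    obtain k :: nat where k: "r < real k" using reals_Archimedean2 by blast
    then have "a \<le> of_nat k" using real by (simp add: ennreal_of_nat_eq_real_of_nat ennreal_leI)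
    then show ?thesis by (intro SUP_upper2[of k]) auto
  next
    case top
    then show ?thesis by (simp add: ennreal_SUP_of_nat_eq_top)
  qed
qed (auto intro: SUP_least)

lemma nn_integral_SUP_min:
  fixes f :: "'a \<Rightarrow> ennreal"
  assumes [measurable]: "f \<in> borel_measurable M"
  shows "(\<integral>\<^sup>+x. f x \<partial>M) = (SUP j::nat. \<integral>\<^sup>+x. min (f x) (of_nat j) \<partial>M)"
proof -
  have "(\<integral>\<^sup>+x. f x \<partial>M) = (\<integral>\<^sup>+x. (SUP j::nat. min (f x) (of_nat j)) \<partial>M)"
    by (simp add: SUP_min_of_nat_ennreal)
  also have "\<dots> = (SUP j::nat. \<integral>\<^sup>+x. min (f x) (of_nat j) \<partial>M)"
    by (rule nn_integral_monotone_convergence_SUP)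
       (auto simp: incseq_def le_fun_def intro: min.coboundedI2)
  finally show ?thesis .
qed

section \<open>Iterates of a measure-preserving map\<close>

locale measure_preserving = prob_space +
  fixes T :: "'a \<Rightarrow> 'a"
  assumes T_measurable[measurable]: "T \<in> measurable M M"
    and distr_T: "distr M M T = M"
begin

lemma iter_measurable[measurable]: "T ^^ k \<in> measurable M M"
  by (rule measurable_compose_n) measurable

lemma distr_iter: "distr M M (T ^^ k) = M"
proof (induction k)
  case 0
  show ?case by (simp add: distr_id[unfolded id_def] id_def)
next
  case (Suc k)
  have "distr M M (T ^^ Suc k) = distr (distr M M (T ^^ k)) M T"
    by (subst distr_distr) (auto simp: comp_def)
  then show ?case by (simp only: Suc distr_T)
qed

lemma measure_preserving_iter: "measure_preserving M (T ^^ k)"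
  by unfold_locales (auto simp: distr_iter)

lemma AE_iter:
  assumes "AE x in M. P x"
  shows "AE x in M. \<forall>k. P ((T ^^ k) x)"
  unfolding AE_all_countable
proof
  fix k
  show "AE x in M. P ((T ^^ k) x)"
    by (rule AE_distrD[OF iter_measurable], subst distr_iter, rule assms)
qed

lemma nn_integral_iter:
  assumes [measurable]: "f \<in> borel_measurable M"
  shows "(\<integral>\<^sup>+x. f ((T ^^ k) x) \<partial>M) = (\<integral>\<^sup>+x. f x \<partial>M)"
proof -
  have "(\<integral>\<^sup>+x. f x \<partial>M) = (\<integral>\<^sup>+x. f x \<partial>distr M M (T ^^ k))" by (simp add: distr_iter)
  also have "\<dots> = (\<integral>\<^sup>+x. f ((T ^^ k) x) \<partial>M)" by (rule nn_integral_distr) auto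
  finally show ?thesis by simp
qed

text \<open>\<open>g\<close> and its composition with \<open>T\<close> have the same law, so
  domination is already equality.\<close>

lemma AE_eq_if_shift_le:
  fixes g :: "'a \<Rightarrow> ennreal"
  assumes [measurable]: "g \<in> borel_measurable M" and le: "AE x in M. g (T x) \<le> g x"
  shows "AE x in M. \<forall>k. g ((T ^^ k) x) = g x"
proof -
  have "AE x in M. g (T x) = g x"
  proof (rule AE_eq_if_le_same_distr[OF _ _ _ le])
    have "distr M borel (\<lambda>x. g (T x)) = distr (distr M M T) borel g"
      by (subst distr_distr) (auto simp: comp_def)
    then show "distr M borel (\<lambda>x. g (T x)) = distr M borel g" by (simp add: distr_T)
  qed (auto simp: finite_measure_axioms)
  then have "AE x in M. \<forall>k. g (T ((T ^^ k) x)) = g ((T ^^ k) x)" by (rule AE_iter)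
  then show ?thesis
  proof eventually_elim
    case (elim x)
    show ?case
    proof
      fix k show "g ((T ^^ k) x) = g x" by (induction k) (auto simp: elim)
    qed
  qed
qed

end

section \<open>Superadditive processes: upper bound for the limsup by covering\<close>

locale superadditive_process = measure_preserving +
  fixes Y :: "nat \<Rightarrow> 'a \<Rightarrow> ennreal"
  assumes Y_measurable[measurable]: "\<And>n. Y n \<in> borel_measurable M"
    and superadditive: "\<And>m n. AE x in M. Y m x + Y n ((T ^^ m) x) \<le> Y (m + n) x"
begin

text \<open>Countably many inequalities, each preserved along the orbit, leave one null set off
  which an entire orbit can be treated pathwise, as the covering argument requires.\<close>

lemma AE_superadditive:
  "AE x in M. \<forall>k m n. Y m ((T ^^ k) x) + Y n ((T ^^ (k + m)) x) \<le> Y (m + n) ((T ^^ k) x)"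
proof -
  have "AE x in M. \<forall>m n. Y m x + Y n ((T ^^ m) x) \<le> Y (m + n) x"
    using superadditive by (auto simp: AE_all_countable)
  from AE_iter[OF this] show ?thesis
  proof eventually_elim
    case (elim x)
    have "(T ^^ (k + m)) x = (T ^^ m) ((T ^^ k) x)" for k m
      by (simp add: funpow_add[symmetric] add.commute flip: comp_apply[of "T ^^ m"])
    with elim show ?case by simp
  qed
qed

text \<open>Discarding the nonnegative \<open>Y 1 x\<close> leaves
  \<open>Y n (T x) \<le> Y (n + 1) x\<close>.\<close>

lemma limsup_shift_le:
  "AE x in M. limsup (\<lambda>n. Y n (T x) / of_nat n) \<le> limsup (\<lambda>n. Y n x / of_nat n)"
  using AE_superadditive
proof eventually_elim
  case (elim x)
  have le: "Y n (T x) \<le> Y (n + 1) x" for n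
  proof -
    have "Y n (T x) \<le> Y 1 x + Y n (T x)" by (simp add: add_increasing)
    also have "\<dots> \<le> Y (n + 1) x" using elim[rule_format, of 1 0 n] by simp
    finally show ?thesis .
  qed
  then show ?case by (rule limsup_divide_le_shift)
qed

text \<open>Greedy covering of the orbit from time \<open>k\<close> on. At a point of
  \<open>A\<close> a block of length \<open>l \<le> N\<close> is used up, on which \<open>Y\<close>
  gains at least \<open>l * h\<close>; at any other point one moves on by one step at no loss, since
  \<open>Y 1\<close> is nonnegative. Once at most \<open>N\<close> steps remain, the term
  \<open>N * h\<close> pays for all points left over.\<close>

lemma covering:
  fixes h :: ennreal
  assumes sup: "\<forall>k m n. Y m ((T ^^ k) x) + Y n ((T ^^ (k + m)) x) \<le> Y (m + n) ((T ^^ k) x)"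
    and A: "\<And>k. (T ^^ k) x \<in> A \<Longrightarrow> \<exists>l\<in>{1..N}. of_nat l * h \<le> Y l ((T ^^ k) x)"
  shows "h * (\<Sum>i<n. indicator A ((T ^^ (k + i)) x)) \<le> Y n ((T ^^ k) x) + of_nat N * h"
proof (induction n arbitrary: k rule: less_induct)
  case (less n)
  have ind_le: "(\<Sum>i<m. indicator A ((T ^^ (j + i)) x)) \<le> (of_nat m :: ennreal)" for m j
  proof -
    have "(\<Sum>i<m. indicator A ((T ^^ (j + i)) x)) \<le> (\<Sum>i<m. 1 :: ennreal)"
      by (intro sum_mono) (auto simp: indicator_def)
    then show ?thesis by simp
  qed
  have split: "(\<Sum>i<n. indicator A ((T ^^ (k + i)) x)) =
      (\<Sum>i<l. indicator A ((T ^^ (k + i)) x)) + (\<Sum>i<n-l. (indicator A ((T ^^ (k + l + i)) x) :: ennreal))"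
    if "l \<le> n" for l
  proof -
    have "(\<Sum>i<n. f i) = (\<Sum>i<l. f i) + (\<Sum>i<n-l. f (l + i))" for f :: "nat \<Rightarrow> ennreal"
    proof -
      have "(\<Sum>i<l+d. f i) = (\<Sum>i<l. f i) + (\<Sum>i<d. f (l + i))" for d
        by (induction d) (auto simp: add.assoc)
      from this[of "n - l"] that show ?thesis by simp
    qed
    then show ?thesis by (simp add: add.assoc)
  qed
  consider "n \<le> N" | "n > N" "(T ^^ k) x \<in> A" | "n > N" "(T ^^ k) x \<notin> A" by linarith
  then show ?case
  proof cases
    case 1
    have "h * (\<Sum>i<n. indicator A ((T ^^ (k + i)) x)) \<le> h * of_nat n"
      by (intro mult_left_mono ind_le) auto
    also have "\<dots> \<le> h * of_nat N" using 1 by (intro mult_left_mono) auto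
    also have "\<dots> \<le> Y n ((T ^^ k) x) + of_nat N * h" by (simp add: mult.commute add_increasing)
    finally show ?thesis .
  next
    case 2
    from A[OF 2(2)] obtain l where l: "1 \<le> l" "l \<le> N" "of_nat l * h \<le> Y l ((T ^^ k) x)" by auto
    have "h * (\<Sum>i<n. indicator A ((T ^^ (k + i)) x)) =
        h * (\<Sum>i<l. indicator A ((T ^^ (k + i)) x)) + h * (\<Sum>i<n-l. indicator A ((T ^^ (k + l + i)) x))"
      using l 2 by (subst split[of l]) (auto simp: distrib_left)
    also have "\<dots> \<le> Y l ((T ^^ k) x) + (Y (n - l) ((T ^^ (k + l)) x) + of_nat N * h)"
    proof (intro add_mono)
      have "h * (\<Sum>i<l. indicator A ((T ^^ (k + i)) x)) \<le> h * of_nat l"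
        by (intro mult_left_mono ind_le) auto
      also have "\<dots> \<le> Y l ((T ^^ k) x)" using l by (simp add: mult.commute)
      finally show "h * (\<Sum>i<l. indicator A ((T ^^ (k + i)) x)) \<le> Y l ((T ^^ k) x)" .
      show "h * (\<Sum>i<n-l. indicator A ((T ^^ (k + l + i)) x)) \<le> Y (n - l) ((T ^^ (k + l)) x) + of_nat N * h"
        using l 2 by (intro less.IH) auto
    qed
    also have "\<dots> \<le> Y n ((T ^^ k) x) + of_nat N * h"
      using sup[rule_format, of l k "n - l"] l 2
      by (simp add: add.assoc[symmetric] add_right_mono)
    finally show ?thesis .
  next
    case 3
    have "h * (\<Sum>i<n. indicator A ((T ^^ (k + i)) x)) = h * (\<Sum>i<n-1. indicator A ((T ^^ (k + 1 + i)) x))"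
      using 3 by (subst split[of 1]) auto
    also have "\<dots> \<le> Y (n - 1) ((T ^^ (k + 1)) x) + of_nat N * h"
      using 3 by (intro less.IH) auto
    also have "\<dots> \<le> (Y 1 ((T ^^ k) x) + Y (n - 1) ((T ^^ (k + 1)) x)) + of_nat N * h"
      by (intro add_right_mono) (simp add: add_increasing)
    also have "\<dots> \<le> Y n ((T ^^ k) x) + of_nat N * h"
      using sup[rule_format, of 1 k "n - 1"] 3 by (intro add_right_mono) simp
    finally show ?thesis .
  qed
qed

text \<open>Invariance keeps \<open>h\<close> constant along an orbit, so \<open>covering\<close>
  applies with a fixed level. \<open>A N\<close> is the set where the level is reached within
  \<open>N\<close> steps. Integration and division by \<open>n\<close> make the boundary term
  \<open>N * K\<close> disappear as \<open>n\<close> grows with \<open>N\<close> fixed; then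
  \<open>N\<close> tends to infinity.\<close>

lemma nn_integral_le_if_invariant:
  fixes h :: "'a \<Rightarrow> ennreal" and K :: nat and C :: ennreal
  assumes [measurable]: "h \<in> borel_measurable M"
    and hK: "\<And>x. h x \<le> of_nat K"
    and inv: "AE x in M. \<forall>k. h ((T ^^ k) x) = h x"
    and less: "\<And>x. h x = 0 \<or> h x < limsup (\<lambda>n. Y n x / of_nat n)"
    and C: "\<And>n. n > 0 \<Longrightarrow> (\<integral>\<^sup>+x. Y n x \<partial>M) \<le> C * of_nat n"
  shows "(\<integral>\<^sup>+x. h x \<partial>M) \<le> C"
proof -
  define A where "A N = {x\<in>space M. \<exists>l\<in>{1..N}. of_nat l * h x \<le> Y l x}" for N
  have A_meas[measurable]: "A N \<in> sets M" for N
    unfolding A_def by measurable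
  have bound: "of_nat n * (\<integral>\<^sup>+x. h x * indicator (A N) x \<partial>M) \<le> C * of_nat n + of_nat N * of_nat K"
    if "n > 0" for n N
  proof -
    have "AE x in M. (\<Sum>i<n. h ((T ^^ i) x) * indicator (A N) ((T ^^ i) x)) \<le> Y n x + of_nat N * of_nat K"
      using AE_superadditive inv
    proof eventually_elim
      case (elim x)
      have "(\<Sum>i<n. h ((T ^^ i) x) * indicator (A N) ((T ^^ i) x)) = h x * (\<Sum>i<n. indicator (A N) ((T ^^ (0 + i)) x))"
        using elim(2) by (simp add: sum_distrib_left)
      also have "\<dots> \<le> Y n ((T ^^ 0) x) + of_nat N * h x"
      proof (rule covering[OF elim(1)])
        fix k assume "(T ^^ k) x \<in> A N"
        then show "\<exists>l\<in>{1..N}. of_nat l * h x \<le> Y l ((T ^^ k) x)"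
          using elim(2) by (auto simp: A_def)
      qed
      also have "\<dots> \<le> Y n x + of_nat N * of_nat K"
        by (auto intro!: add_left_mono mult_left_mono hK)
      finally show ?case .
    qed
    then have "(\<integral>\<^sup>+x. (\<Sum>i<n. h ((T ^^ i) x) * indicator (A N) ((T ^^ i) x)) \<partial>M)
        \<le> (\<integral>\<^sup>+x. Y n x + of_nat N * of_nat K \<partial>M)"
      by (rule nn_integral_mono_AE)
    also have "\<dots> = (\<integral>\<^sup>+x. Y n x \<partial>M) + of_nat N * of_nat K"
      by (subst nn_integral_add) (auto simp: emeasure_space_1)
    also have "\<dots> \<le> C * of_nat n + of_nat N * of_nat K" by (intro add_right_mono C that)
    also have "(\<integral>\<^sup>+x. (\<Sum>i<n. h ((T ^^ i) x) * indicator (A N) ((T ^^ i) x)) \<partial>M)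
        = (\<Sum>i<n. \<integral>\<^sup>+x. h ((T ^^ i) x) * indicator (A N) ((T ^^ i) x) \<partial>M)"
      by (rule nn_integral_sum) measurable
    also have "\<dots> = of_nat n * (\<integral>\<^sup>+x. h x * indicator (A N) x \<partial>M)"
      using nn_integral_iter[of "\<lambda>x. h x * indicator (A N) x"] by simp
    finally show ?thesis .
  qed
  have I_le: "(\<integral>\<^sup>+x. h x * indicator (A N) x \<partial>M) \<le> C" for N
  proof (cases C)
    case (real c)
    have "(\<integral>\<^sup>+x. h x * indicator (A N) x \<partial>M) \<le> (\<integral>\<^sup>+x. of_nat K \<partial>M)"
      by (intro nn_integral_mono) (auto simp: indicator_def hK)
    also have "\<dots> < \<infinity>" by (simp add: emeasure_space_1 of_nat_less_top)
    finally obtain I where I: "(\<integral>\<^sup>+x. h x * indicator (A N) x \<partial>M) = ennreal I" "I \<ge> 0"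
      by (cases "\<integral>\<^sup>+x. h x * indicator (A N) x \<partial>M") auto
    have "I \<le> c + real N * real K / real n" if "n > 0" for n
    proof -
      have "ennreal (real n * I) \<le> ennreal (c * real n + real N * real K)"
        using bound[OF that, of N] real I by (simp add: ennreal_of_nat_eq_real_of_nat flip: ennreal_mult ennreal_plus)
      then have "real n * I \<le> c * real n + real N * real K"
        using real by (subst (asm) ennreal_le_iff) auto
      then show ?thesis using that by (simp add: field_simps)
    qed
    moreover have "(\<lambda>n. c + real N * real K / real n) \<longlonglongrightarrow> c + 0"
      by (intro tendsto_intros lim_const_over_n)
    ultimately have "I \<le> c"
      by (intro tendsto_lowerbound[of _ c sequentially]) (auto intro: eventually_mono[OF eventually_gt_at_top[of 0]])
    then show ?thesis using real I by (simp add: ennreal_leI)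
  qed simp
  have "(\<integral>\<^sup>+x. h x \<partial>M) \<le> (\<integral>\<^sup>+x. (SUP N. h x * indicator (A N) x) \<partial>M)"
  proof (rule nn_integral_mono)
    fix x assume x: "x \<in> space M"
    show "h x \<le> (SUP N. h x * indicator (A N) x)"
    proof (cases "h x = 0")
      case False
      with less have *: "h x < limsup (\<lambda>n. Y n x / of_nat n)" by blast
      \<comment> \<open>The strict inequality is used here: if no ratio reached \<open>h x\<close>,
        the limsup could not exceed it. Hence the sets \<open>A N\<close> exhaust the points with
        \<open>h x\<close> nonzero.\<close>
      have "\<exists>l\<ge>1. h x \<le> Y l x / of_nat l"
      proof (rule ccontr)
        assume neg: "\<not> ?thesis"
        have "eventually (\<lambda>l. Y l x / of_nat l \<le> h x) sequentially"
          using eventually_ge_at_top[of "1 :: nat"]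
        proof eventually_elim
          case (elim l)
          with neg show ?case by (meson linear)
        qed
        then have "limsup (\<lambda>n. Y n x / of_nat n) \<le> h x" by (rule Limsup_bounded)
        with * show False by simp
      qed
      then obtain l where l: "l \<ge> 1" "h x \<le> Y l x / of_nat l" by auto
      have "of_nat l * h x \<le> of_nat l * (Y l x / of_nat l)" by (intro mult_left_mono l) auto
      also have "\<dots> = Y l x * of_nat l / of_nat l" by (simp add: ennreal_times_divide mult.commute)
      also have "\<dots> = Y l x" using l by (intro mult_divide_eq_ennreal) auto
      finally have "x \<in> A l" using l x by (auto simp: A_def)
      then show ?thesis by (intro SUP_upper2[of l]) auto
    qed simp
  qed
  also have "\<dots> = (SUP N. \<integral>\<^sup>+x. h x * indicator (A N) x \<partial>M)"
  proof (rule nn_integral_monotone_convergence_SUP)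
    show "incseq (\<lambda>N x. h x * indicator (A N) x)"
      by (intro incseq_SucI le_funI mult_left_mono) (auto simp: A_def indicator_def)
  qed measurable
  also have "\<dots> \<le> C" by (intro SUP_least I_le)
  finally show ?thesis .
qed

text \<open>The limsup may be infinite and is not strictly below itself, so the previous lemma does
  not apply to it directly. Truncation at \<open>j\<close> makes it bounded, and the loss of
  \<open>e\<close> (subtraction in \<open>ennreal\<close> stops at 0) makes it strictly smaller
  wherever it remains nonzero; both changes are undone at the end.\<close>

lemma nn_integral_limsup_le:
  assumes C: "\<And>n. n > 0 \<Longrightarrow> (\<integral>\<^sup>+x. Y n x \<partial>M) \<le> C * of_nat n"
  shows "(\<integral>\<^sup>+x. limsup (\<lambda>n. Y n x / of_nat n) \<partial>M) \<le> C"
proof -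
  define G where "G x = limsup (\<lambda>n. Y n x / of_nat n)" for x
  have [measurable]: "G \<in> borel_measurable M" unfolding G_def by measurable
  have inv: "AE x in M. \<forall>k. G ((T ^^ k) x) = G x"
    by (rule AE_eq_if_shift_le) (use limsup_shift_le in \<open>auto simp: G_def\<close>)
  have min_le: "(\<integral>\<^sup>+x. min (G x) (of_nat j) \<partial>M) \<le> C" for j :: nat
  proof (rule ennreal_le_epsilon)
    fix e :: real assume e: "e > 0"
    have "(\<integral>\<^sup>+x. min (G x) (of_nat j) \<partial>M) \<le> (\<integral>\<^sup>+x. (min (G x) (of_nat j) - ennreal e) + ennreal e \<partial>M)"
      by (intro nn_integral_mono) (metis add.commute add_diff_self_ennreal le_cases order.refl diff_eq_0_ennreal add_increasing2 zero_le)
    also have "\<dots> = (\<integral>\<^sup>+x. min (G x) (of_nat j) - ennreal e \<partial>M) + ennreal e"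
      by (subst nn_integral_add) (auto simp: emeasure_space_1)
    also have "(\<integral>\<^sup>+x. min (G x) (of_nat j) - ennreal e \<partial>M) \<le> C"
    proof (rule nn_integral_le_if_invariant[where K=j])
      show "min (G x) (of_nat j) - ennreal e \<le> of_nat j" for x
        by (metis diff_le_self_ennreal min.cobounded2 order_trans)
      show "AE x in M. \<forall>k. min (G ((T ^^ k) x)) (of_nat j) - ennreal e = min (G x) (of_nat j) - ennreal e"
        using inv by eventually_elim simp
      fix x
      obtain r where r: "min (G x) (of_nat j) = ennreal r" "r \<ge> 0"
        by (cases "min (G x) (of_nat j)") (auto simp: min_def top_unique split: if_splits)
      have "ennreal r - ennreal e = ennreal (r - e)" using e by (simp add: ennreal_minus)
      then have "min (G x) (of_nat j) - ennreal e = 0 \<or> min (G x) (of_nat j) - ennreal e < min (G x) (of_nat j)"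
        unfolding r using e r(2) by (cases "r \<le> e") (auto simp: ennreal_less_iff ennreal_neg)
      then show "min (G x) (of_nat j) - ennreal e = 0 \<or> min (G x) (of_nat j) - ennreal e < limsup (\<lambda>n. Y n x / of_nat n)"
        unfolding G_def[symmetric] by (auto simp: min_def split: if_splits)
    qed (auto intro: C)
    finally show "(\<integral>\<^sup>+x. min (G x) (of_nat j) \<partial>M) \<le> C + ennreal e" by (simp add: add_right_mono)
  qed
  have "(\<integral>\<^sup>+x. G x \<partial>M) \<le> C"
    unfolding nn_integral_SUP_min[OF \<open>G \<in> borel_measurable M\<close>] by (intro SUP_least min_le)
  then show ?thesis by (simp add: G_def)
qed

section \<open>Lower bound for the liminf by block sums\<close>

lemma sum_iter_le:
  assumes sup: "\<forall>k m n. Y m ((T ^^ k) x) + Y n ((T ^^ (k + m)) x) \<le> Y (m + n) ((T ^^ k) x)"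
    and "k > 0"
  shows "(\<Sum>j<k. Y m ((T ^^ (m * j)) x)) \<le> Y (m * k) x"
  using \<open>k > 0\<close>
proof (induction k rule: nat_induct_non_zero)
  case (Suc k)
  have "(\<Sum>j<Suc k. Y m ((T ^^ (m * j)) x)) \<le> Y (m * k) x + Y m ((T ^^ (m * k)) x)"
    using Suc by (simp add: add_right_mono)
  also have "\<dots> \<le> Y (m * Suc k) x"
    using sup[rule_format, of "m * k" 0 m] by (simp add: add.commute)
  finally show ?case .
qed simp

text \<open>Cut \<open>n\<close> into \<open>n div m\<close> blocks of length \<open>m\<close> and
  drop the nonnegative rest. Averages over the blocks then bound the ratios along all
  \<open>n\<close>, up to the factor \<open>m\<close>.\<close>

lemma liminf_average_le:
  assumes sup: "\<forall>k m n. Y m ((T ^^ k) x) + Y n ((T ^^ (k + m)) x) \<le> Y (m + n) ((T ^^ k) x)"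
    and "m > 0"
  shows "liminf (\<lambda>k. (\<Sum>j<k. Y m ((T ^^ (m * j)) x)) / of_nat k) \<le> of_nat m * liminf (\<lambda>n. Y n x / of_nat n)"
proof (rule dense_le)
  fix c assume "c < liminf (\<lambda>k. (\<Sum>j<k. Y m ((T ^^ (m * j)) x)) / of_nat k)"
  then have "eventually (\<lambda>k. c < (\<Sum>j<k. Y m ((T ^^ (m * j)) x)) / of_nat k) sequentially"
    by (rule less_LiminfD)
  moreover have "filterlim (\<lambda>n. n div m) sequentially sequentially"
    using \<open>m > 0\<close> by (intro filterlim_at_top_div_const_nat)
  ultimately have ev: "eventually (\<lambda>n. c < (\<Sum>j<n div m. Y m ((T ^^ (m * j)) x)) / of_nat (n div m)) sequentially"
    by (rule eventually_compose_filterlim)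
  obtain r where r: "c = ennreal r" "r \<ge> 0"
    using \<open>c < _\<close> by (cases c) auto
  \<comment> \<open>With \<open>k = n div m\<close> one has \<open>n < m * k + m\<close>, so
    \<open>k / n\<close> is at least \<open>1 / m - 1 / n\<close>; this explicit bound has a limit,
    while the rounding in \<open>n div m\<close> is gone.\<close>
  have "eventually (\<lambda>n. ennreal (r * (1 / real m - 1 / real n)) \<le> Y n x / of_nat n) sequentially"
    using ev eventually_ge_at_top[of m]
  proof eventually_elim
    case (elim n)
    define k where "k = n div m"
    have k: "k > 0" "n > 0" using elim \<open>m > 0\<close> by (auto simp: k_def div_greater_zero_iff)
    have n: "m * k \<le> n" "n < m * k + m"
      using dividend_less_times_div[OF \<open>m > 0\<close>, of n] unfolding k_def by auto
    have "ennreal (r * real k) = ennreal r * of_nat k"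
      using r by (simp add: ennreal_mult ennreal_of_nat_eq_real_of_nat)
    also have "\<dots> \<le> (\<Sum>j<k. Y m ((T ^^ (m * j)) x)) / of_nat k * of_nat k"
      using elim r unfolding k_def by (intro mult_right_mono) auto
    also have "\<dots> = (\<Sum>j<k. Y m ((T ^^ (m * j)) x))"
      using k by (simp add: ennreal_divide_times ennreal_divide_self of_nat_less_top)
    also have "\<dots> \<le> Y (m * k) x" using sup k(1) by (rule sum_iter_le)
    also have "\<dots> \<le> Y (m * k) x + Y (n - m * k) ((T ^^ (m * k)) x)" by (simp add: add_increasing2)
    also have "\<dots> \<le> Y n x" using sup[rule_format, of "m * k" 0 "n - m * k"] n by simp
    finally have *: "ennreal (r * real k) / of_nat n \<le> Y n x / of_nat n"
      by (rule divide_right_mono_ennreal)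
    have "real n \<le> real m * real k + real m"
      using n by (metis less_imp_le of_nat_add of_nat_le_iff of_nat_mult)
    then have "1 / real m - 1 / real n \<le> real k / real n"
    proof -
      have "1 / real m - 1 / real n = (real n - real m) / (real m * real n)"
        using k \<open>m > 0\<close> by (simp add: field_simps)
      also have "\<dots> \<le> (real m * real k) / (real m * real n)"
        using \<open>real n \<le> real m * real k + real m\<close> by (intro divide_right_mono) auto
      also have "\<dots> = real k / real n" using \<open>m > 0\<close> by simp
      finally show ?thesis .
    qed
    then have "r * (1 / real m - 1 / real n) \<le> r * (real k / real n)"
      using r by (intro mult_left_mono)
    then have "ennreal (r * (1 / real m - 1 / real n)) \<le> ennreal (r * real k / real n)"
      by (intro ennreal_leI) simp
    also have "\<dots> = ennreal (r * real k) / of_nat n"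
      using k r by (simp add: ennreal_of_nat_eq_real_of_nat divide_ennreal)
    finally show ?case using * by simp
  qed
  then have "liminf (\<lambda>n. ennreal (r * (1 / real m - 1 / real n))) \<le> liminf (\<lambda>n. Y n x / of_nat n)"
    by (rule Liminf_mono)
  moreover have "(\<lambda>n. ennreal (r * (1 / real m - 1 / real n))) \<longlonglongrightarrow> ennreal (r * (1 / real m - 0))"
    by (intro tendsto_ennrealI tendsto_intros lim_1_over_n)
  then have "liminf (\<lambda>n. ennreal (r * (1 / real m - 1 / real n))) = ennreal (r / real m)"
    by (intro lim_imp_Liminf) auto
  ultimately have "of_nat m * ennreal (r / real m) \<le> of_nat m * liminf (\<lambda>n. Y n x / of_nat n)"
    by (intro mult_left_mono) auto
  moreover have "of_nat m * ennreal (r / real m) = c"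
    using r \<open>m > 0\<close> by (simp add: ennreal_of_nat_eq_real_of_nat flip: ennreal_mult)
  ultimately show "c \<le> of_nat m * liminf (\<lambda>n. Y n x / of_nat n)" by simp
qed

end

text \<open>Half of the ergodic theorem for bounded functions. The sums \<open>S\<close> of the
  nonnegative function \<open>K - h\<close> are additive along the orbit, so the limsup bound
  applies to them with rate \<open>K\<close> minus the mean of \<open>h\<close>; complements in
  \<open>K\<close> turn it into a liminf bound for \<open>h\<close>.\<close>

lemma (in measure_preserving) nn_integral_liminf_average_ge:
  fixes h :: "'a \<Rightarrow> ennreal" and K :: nat
  assumes [measurable]: "h \<in> borel_measurable M" and hK: "\<And>x. h x \<le> of_nat K"
  shows "(\<integral>\<^sup>+x. h x \<partial>M) \<le> (\<integral>\<^sup>+x. liminf (\<lambda>k. (\<Sum>j<k. h ((T ^^ j) x)) / of_nat k) \<partial>M)"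
proof -
  define S where "S k x = (\<Sum>j<k. of_nat K - h ((T ^^ j) x))" for k x
  have [measurable]: "S k \<in> borel_measurable M" for k unfolding S_def by measurable
  have sum_split: "(\<Sum>i<l+d. f i) = (\<Sum>i<l. f i) + (\<Sum>i<d. f (l + i))" for f :: "nat \<Rightarrow> ennreal" and l d
    by (induction d) (auto simp: add.assoc)
  interpret S: superadditive_process M T S
  proof
    show "AE x in M. S m x + S n ((T ^^ m) x) \<le> S (m + n) x" for m n
    proof (intro AE_I2)
      fix x
      have "(T ^^ i) ((T ^^ m) x) = (T ^^ (m + i)) x" for i
        by (subst add.commute) (simp add: funpow_add)
      then show "S m x + S n ((T ^^ m) x) \<le> S (m + n) x"
        unfolding S_def sum_split by simp
    qed
  qed measurable
  have h_fin: "(\<integral>\<^sup>+x. h x \<partial>M) \<le> of_nat K"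
  proof -
    have "(\<integral>\<^sup>+x. h x \<partial>M) \<le> (\<integral>\<^sup>+x. of_nat K \<partial>M)" by (intro nn_integral_mono hK)
    then show ?thesis by (simp add: emeasure_space_1)
  qed
  have h_ne: "(\<integral>\<^sup>+x. h x \<partial>M) \<noteq> \<infinity>" using h_fin by (auto simp: top_unique)
  have int_S: "(\<integral>\<^sup>+x. S n x \<partial>M) \<le> (of_nat K - (\<integral>\<^sup>+x. h x \<partial>M)) * of_nat n" for n
  proof -
    have "(\<integral>\<^sup>+x. S n x \<partial>M) = (\<Sum>j<n. \<integral>\<^sup>+x. of_nat K - h ((T ^^ j) x) \<partial>M)"
      unfolding S_def by (rule nn_integral_sum) measurable
    also have "\<dots> = (\<Sum>j<n. \<integral>\<^sup>+x. of_nat K - h x \<partial>M)"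
      using nn_integral_iter[of "\<lambda>x. of_nat K - h x"] by simp
    also have "(\<integral>\<^sup>+x. of_nat K - h x \<partial>M) = of_nat K - (\<integral>\<^sup>+x. h x \<partial>M)"
      using h_ne hK by (subst nn_integral_diff) (auto simp: emeasure_space_1)
    finally show ?thesis by (simp add: mult.commute)
  qed
  have S_le: "S k x / of_nat k \<le> of_nat K" for k x
  proof (cases "k = 0")
    case False
    have "S k x \<le> (\<Sum>j<k. of_nat K)" unfolding S_def by (intro sum_mono) simp
    then have "S k x / of_nat k \<le> of_nat K * of_nat k / of_nat k"
      by (intro divide_right_mono_ennreal) (simp add: mult.commute)
    also have "\<dots> = of_nat K" using False by (intro mult_divide_eq_ennreal) auto
    finally show ?thesis .
  qed (simp add: S_def)
  have avg: "(\<Sum>j<k. h ((T ^^ j) x)) / of_nat k = of_nat K - S k x / of_nat k" if "k > 0" for k x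
  proof -
    have "(\<Sum>j<k. h ((T ^^ j) x)) + S k x = (\<Sum>j<k. h ((T ^^ j) x) + (of_nat K - h ((T ^^ j) x)))"
      by (simp add: S_def sum.distrib)
    also have "\<dots> = of_nat K * of_nat k" by (simp add: add_diff_self_ennreal hK mult.commute)
    finally have "(\<Sum>j<k. h ((T ^^ j) x)) / of_nat k + S k x / of_nat k = of_nat K * of_nat k / of_nat k"
      by (simp add: divide_ennreal_def flip: distrib_right)
    also have "\<dots> = of_nat K" using that by (intro mult_divide_eq_ennreal) auto
    finally have sum: "(\<Sum>j<k. h ((T ^^ j) x)) / of_nat k + S k x / of_nat k = of_nat K" .
    have "S k x / of_nat k \<noteq> \<top>" using S_le[of k x] by (auto simp: top_unique)
    then show ?thesis unfolding sum[symmetric] by simp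
  qed
  \<comment> \<open>Complements in \<open>K\<close> can be undone without truncation because every
    quantity involved is at most the finite \<open>K\<close>.\<close>
  have "(\<integral>\<^sup>+x. h x \<partial>M) = of_nat K - (of_nat K - (\<integral>\<^sup>+x. h x \<partial>M))"
    using h_fin by (subst diff_diff_ennreal) auto
  also have "\<dots> \<le> of_nat K - (\<integral>\<^sup>+x. limsup (\<lambda>k. S k x / of_nat k) \<partial>M)"
    by (intro ennreal_mono_minus S.nn_integral_limsup_le int_S)
  also have "\<dots> = (\<integral>\<^sup>+x. of_nat K - limsup (\<lambda>k. S k x / of_nat k) \<partial>M)"
  proof (subst nn_integral_diff)
    have le: "limsup (\<lambda>k. S k x / of_nat k) \<le> of_nat K" for x
      by (intro Limsup_bounded always_eventually allI S_le)
    then show "AE x in M. limsup (\<lambda>k. S k x / of_nat k) \<le> of_nat K" by simp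
    have "(\<integral>\<^sup>+x. limsup (\<lambda>k. S k x / of_nat k) \<partial>M) \<le> (\<integral>\<^sup>+x. of_nat K \<partial>M)"
      by (intro nn_integral_mono le)
    then show "(\<integral>\<^sup>+x. limsup (\<lambda>k. S k x / of_nat k) \<partial>M) \<noteq> \<infinity>"
      by (auto simp: emeasure_space_1 top_unique)
  qed (auto simp: emeasure_space_1)
  also have "\<dots> = (\<integral>\<^sup>+x. liminf (\<lambda>k. (\<Sum>j<k. h ((T ^^ j) x)) / of_nat k) \<partial>M)"
  proof (rule nn_integral_cong)
    fix x
    have "of_nat K - limsup (\<lambda>k. S k x / of_nat k) = liminf (\<lambda>k. of_nat K - S k x / of_nat k)"
      by (rule ennreal_liminf_minus[symmetric]) (rule S_le)
    also have "\<dots> = liminf (\<lambda>k. (\<Sum>j<k. h ((T ^^ j) x)) / of_nat k)"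
      by (intro Liminf_eq eventually_mono[OF eventually_gt_at_top[of 0]]) (simp add: avg)
    finally show "of_nat K - limsup (\<lambda>k. S k x / of_nat k) = liminf (\<lambda>k. (\<Sum>j<k. h ((T ^^ j) x)) / of_nat k)" .
  qed
  finally show ?thesis .
qed

context superadditive_process
begin

text \<open>The averaging bound is applied to \<open>Y m\<close>, truncated at \<open>K\<close>,
  under the map \<open>T ^^ m\<close>; \<open>liminf_average_le\<close> compares these averages with
  the process itself. The supremum over \<open>K\<close> lifts the truncation.\<close>

lemma nn_integral_liminf_ge:
  assumes "m > 0"
  shows "(\<integral>\<^sup>+x. Y m x \<partial>M) \<le> of_nat m * (\<integral>\<^sup>+x. liminf (\<lambda>n. Y n x / of_nat n) \<partial>M)"
  unfolding nn_integral_SUP_min[OF Y_measurable]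
proof (rule SUP_least)
  fix K :: nat
  interpret Tm: measure_preserving M "T ^^ m" by (rule measure_preserving_iter)
  have "(\<integral>\<^sup>+x. min (Y m x) (of_nat K) \<partial>M)
      \<le> (\<integral>\<^sup>+x. liminf (\<lambda>k. (\<Sum>j<k. min (Y m (((T ^^ m) ^^ j) x)) (of_nat K)) / of_nat k) \<partial>M)"
    by (rule Tm.nn_integral_liminf_average_ge[of _ K]) auto
  also have "\<dots> \<le> (\<integral>\<^sup>+x. of_nat m * liminf (\<lambda>n. Y n x / of_nat n) \<partial>M)"
  proof (rule nn_integral_mono_AE)
    show "AE x in M. liminf (\<lambda>k. (\<Sum>j<k. min (Y m (((T ^^ m) ^^ j) x)) (of_nat K)) / of_nat k)
        \<le> of_nat m * liminf (\<lambda>n. Y n x / of_nat n)"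
      using AE_superadditive
    proof eventually_elim
      case (elim x)
      have "liminf (\<lambda>k. (\<Sum>j<k. min (Y m (((T ^^ m) ^^ j) x)) (of_nat K)) / of_nat k)
          \<le> liminf (\<lambda>k. (\<Sum>j<k. Y m ((T ^^ (m * j)) x)) / of_nat k)"
        by (intro Liminf_mono always_eventually allI divide_right_mono_ennreal sum_mono) (simp add: funpow_mult mult.commute)
      also have "\<dots> \<le> of_nat m * liminf (\<lambda>n. Y n x / of_nat n)"
        by (rule liminf_average_le[OF elim assms])
      finally show ?case .
    qed
  qed
  also have "\<dots> = of_nat m * (\<integral>\<^sup>+x. liminf (\<lambda>n. Y n x / of_nat n) \<partial>M)"
    by (rule nn_integral_cmult) measurable
  finally show "(\<integral>\<^sup>+x. min (Y m x) (of_nat K) \<partial>M) \<le> of_nat m * (\<integral>\<^sup>+x. liminf (\<lambda>n. Y n x / of_nat n) \<partial>M)" .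
qed

text \<open>By \<open>nn_integral_liminf_ge\<close> the mean \<open>I\<close> of the liminf is
  itself a linear rate for the means, hence it also bounds the mean of the limsup. The finite rate
  \<open>C\<close> makes both means finite, so their difference can be formed and the two limits
  agree almost everywhere.\<close>

theorem kingman:
  fixes C :: real
  assumes C: "\<And>n. n > 0 \<Longrightarrow> (\<integral>\<^sup>+x. Y n x \<partial>M) \<le> ennreal C * of_nat n"
  shows "AE x in M. liminf (\<lambda>n. Y n x / of_nat n) = limsup (\<lambda>n. Y n x / of_nat n)"
    and "n > 0 \<Longrightarrow> (\<integral>\<^sup>+x. Y n x \<partial>M) \<le> of_nat n * (\<integral>\<^sup>+x. liminf (\<lambda>n. Y n x / of_nat n) \<partial>M)"
    and "(\<integral>\<^sup>+x. limsup (\<lambda>n. Y n x / of_nat n) \<partial>M) \<le> ennreal C"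
proof -
  define I where "I = (\<integral>\<^sup>+x. liminf (\<lambda>n. Y n x / of_nat n) \<partial>M)"
  have I: "(\<integral>\<^sup>+x. limsup (\<lambda>n. Y n x / of_nat n) \<partial>M) \<le> I"
    using nn_integral_liminf_ge unfolding I_def by (intro nn_integral_limsup_le) (simp add: mult.commute)
  show "(\<integral>\<^sup>+x. limsup (\<lambda>n. Y n x / of_nat n) \<partial>M) \<le> ennreal C"
    by (rule nn_integral_limsup_le) (rule C)
  with I have fin: "(\<integral>\<^sup>+x. limsup (\<lambda>n. Y n x / of_nat n) \<partial>M) \<noteq> \<infinity>"
    by (auto simp: top_unique)
  have le: "liminf (\<lambda>n. Y n x / of_nat n) \<le> limsup (\<lambda>n. Y n x / of_nat n)" for x
    by (rule Liminf_le_Limsup) simp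
  have "I \<le> (\<integral>\<^sup>+x. limsup (\<lambda>n. Y n x / of_nat n) \<partial>M)"
    unfolding I_def by (intro nn_integral_mono le)
  then have fin': "I \<noteq> \<infinity>" using fin by (auto simp: top_unique)
  have "(\<integral>\<^sup>+x. limsup (\<lambda>n. Y n x / of_nat n) - liminf (\<lambda>n. Y n x / of_nat n) \<partial>M) = 0"
    using I fin fin' le unfolding I_def by (subst nn_integral_diff) (auto simp: diff_eq_0_iff_ennreal top.not_eq_extremum)
  then have "AE x in M. limsup (\<lambda>n. Y n x / of_nat n) - liminf (\<lambda>n. Y n x / of_nat n) = 0"
    by (subst (asm) nn_integral_0_iff_AE) auto
  then show "AE x in M. liminf (\<lambda>n. Y n x / of_nat n) = limsup (\<lambda>n. Y n x / of_nat n)"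
    by eventually_elim (intro antisym le, simp add: diff_eq_0_iff_ennreal)
  show "n > 0 \<Longrightarrow> (\<integral>\<^sup>+x. Y n x \<partial>M) \<le> of_nat n * (\<integral>\<^sup>+x. liminf (\<lambda>n. Y n x / of_nat n) \<partial>M)"
    by (rule nn_integral_liminf_ge)
qed

end

section \<open>Stationary fields and factors of the path\<close>

text \<open>The difference of \<open>a\<close> and \<open>b\<close> has square integral zero. The
  square is written as \<open>a * a + b * b - 2 * (a * b)\<close>, where the truncated subtraction
  is exact because \<open>2 * (a * b)\<close> never exceeds \<open>a * a + b * b\<close>.\<close>

lemma AE_eq_if_square_integrals_eq:
  fixes a b :: "'a \<Rightarrow> ennreal"
  assumes [measurable]: "a \<in> borel_measurable M" "b \<in> borel_measurable M"
    and ab: "(\<integral>\<^sup>+x. a x * a x \<partial>M) = (\<integral>\<^sup>+x. a x * b x \<partial>M)"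
    and bb: "(\<integral>\<^sup>+x. a x * b x \<partial>M) = (\<integral>\<^sup>+x. b x * b x \<partial>M)"
    and fin: "(\<integral>\<^sup>+x. a x * a x \<partial>M) \<noteq> \<infinity>"
  shows "AE x in M. a x = b x"
proof -
  have "AE x in M. a x * a x \<noteq> \<infinity>" using fin by (intro nn_integral_noteq_infinite) auto
  then have a_fin: "AE x in M. a x \<noteq> \<top>" by eventually_elim (auto simp: ennreal_mult_eq_top_iff)
  have "AE x in M. b x * b x \<noteq> \<infinity>" using fin ab bb by (intro nn_integral_noteq_infinite) auto
  then have b_fin: "AE x in M. b x \<noteq> \<top>" by eventually_elim (auto simp: ennreal_mult_eq_top_iff)
  have le: "AE x in M. 2 * (a x * b x) \<le> a x * a x + b x * b x"
    using a_fin b_fin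
  proof eventually_elim
    case (elim x)
    obtain r s where "a x = ennreal r" "b x = ennreal s" "r \<ge> 0" "s \<ge> 0"
      using elim by (cases "a x"; cases "b x") auto
    then show ?case
      using sum_squares_bound[of r s]
      by (simp add: power2_eq_square ennreal_leI mult.assoc flip: ennreal_mult ennreal_plus ennreal_numeral)
  qed
  have "(\<integral>\<^sup>+x. (a x * a x + b x * b x) - 2 * (a x * b x) \<partial>M) = 0"
  proof (subst nn_integral_diff[OF _ _ _ le])
    show "(\<integral>\<^sup>+x. 2 * (a x * b x) \<partial>M) \<noteq> \<infinity>"
      using fin ab by (simp add: nn_integral_cmult ennreal_mult_eq_top_iff)
    show "(\<integral>\<^sup>+x. a x * a x + b x * b x \<partial>M) - (\<integral>\<^sup>+x. 2 * (a x * b x) \<partial>M) = 0"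
    proof -
      have "(\<integral>\<^sup>+x. a x * a x + b x * b x \<partial>M) = (\<integral>\<^sup>+x. a x * b x \<partial>M) + (\<integral>\<^sup>+x. a x * b x \<partial>M)"
        by (subst nn_integral_add) (auto simp only: ab bb, measurable)
      moreover have "(\<integral>\<^sup>+x. 2 * (a x * b x) \<partial>M) = (\<integral>\<^sup>+x. a x * b x \<partial>M) + (\<integral>\<^sup>+x. a x * b x \<partial>M)"
        by (subst nn_integral_cmult) (auto simp: mult_2)
      ultimately show ?thesis using fin ab by simp
    qed
  qed auto
  then have "AE x in M. (a x * a x + b x * b x) - 2 * (a x * b x) = 0"
    by (subst (asm) nn_integral_0_iff_AE) auto
  with a_fin b_fin show ?thesis
  proof eventually_elim
    case (elim x)
    obtain r s where rs: "a x = ennreal r" "b x = ennreal s" "r \<ge> 0" "s \<ge> 0"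
      using elim by (cases "a x"; cases "b x") auto
    have "ennreal (r * r + s * s) - ennreal (2 * (r * s)) = 0"
      using elim(3) rs by (simp flip: ennreal_mult ennreal_plus ennreal_numeral)
    then have "ennreal (r * r + s * s - 2 * (r * s)) = 0"
      using rs by (subst ennreal_minus[symmetric]) auto
    then have "r * r + s * s \<le> 2 * (r * s)"
      by (simp add: ennreal_eq_0_iff)
    then have "(r - s)\<^sup>2 \<le> 0" by (simp add: power2_eq_square algebra_simps)
    then show ?case using rs by simp
  qed
qed

section \<open>The field along shifted paths\<close>

locale stationary_field = prob_space M
  for M :: "'w measure" +
  fixes \<xi> :: "int ^ 'd \<Rightarrow> real \<Rightarrow> 'w \<Rightarrow> real"
  assumes field_measurable: "\<And>x. (\<lambda>(\<omega>, t). \<xi> x t \<omega>) \<in> borel_measurable (M \<Otimes>\<^sub>M restrict_space borel {0..})"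
    and stationary: "stationary_law (env_law M \<xi>)"
begin

text \<open>\<open>max 0\<close> turns the one-sided time parameter into an arbitrary real.\<close>

lemma measurable_field_compose:
  assumes f: "f \<in> measurable N M" and g: "g \<in> measurable N (count_space UNIV)"
    and h: "h \<in> borel_measurable N"
  shows "(\<lambda>n. \<xi> (g n) (max 0 (h n)) (f n)) \<in> borel_measurable N"
proof (rule measurable_compose_countable[OF _ g])
  fix x
  have "(\<lambda>n. (f n, max 0 (h n))) \<in> measurable N (M \<Otimes>\<^sub>M restrict_space borel {0..})"
    using f h by (intro measurable_Pair measurable_restrict_space2) auto
  from measurable_compose[OF this field_measurable[of x]]
  show "(\<lambda>n. \<xi> x (max 0 (h n)) (f n)) \<in> borel_measurable N" by simp
qed

lemma field_measurable1: "t \<ge> 0 \<Longrightarrow> \<xi> x t \<in> borel_measurable M"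
  using measurable_field_compose[of "\<lambda>\<omega>. \<omega>" M "\<lambda>_. x" "\<lambda>_. t"] by (simp add: max_absorb2)

definition env_path :: "real \<Rightarrow> 'w \<Rightarrow> (int ^ 'd) \<times> real \<Rightarrow> real" where
  "env_path s \<omega> = (\<lambda>p\<in>UNIV \<times> {0..}. \<xi> (fst p) (s + snd p) \<omega>)"

lemma env_path_measurable: "s \<ge> 0 \<Longrightarrow> env_path s \<in> measurable M env_space"
  unfolding env_path_def env_space_def
  by (rule measurable_restrict) (auto intro: field_measurable1)

lemma env_shift_measurable: "s \<ge> 0 \<Longrightarrow> env_shift y s \<in> measurable env_space env_space"
  unfolding env_shift_def env_space_def
  by (rule measurable_restrict) (auto intro!: measurable_component_singleton)

lemma env_shift_path: "s \<ge> 0 \<Longrightarrow> env_shift 0 s (env_path r \<omega>) = env_path (r + s) \<omega>"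
  by (auto simp: env_shift_def env_path_def fun_eq_iff restrict_def add_ac)

lemma env_law_eq: "env_law M \<xi> = distr M env_space (env_path 0)"
  by (simp add: env_law_def env_path_def[abs_def])

lemma sets_env_law[simp, measurable_cong]: "sets (env_law M \<xi>) = sets env_space"
  by (simp add: env_law_eq)

lemma space_env_law[simp]: "space (env_law M \<xi>) = space env_space"
  by (simp add: env_law_eq)

lemma prob_space_env_law: "prob_space (env_law M \<xi>)"
  unfolding env_law_eq by (rule prob_space_distr) (simp add: env_path_measurable)

lemma distr_path: "s \<ge> 0 \<Longrightarrow> distr M env_space (env_path s) = env_law M \<xi>"
proof -
  assume s: "s \<ge> 0"
  have "env_law M \<xi> = distr (env_law M \<xi>) env_space (env_shift 0 s)"
    using stationary s by (simp add: stationary_law_def)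
  also have "\<dots> = distr M env_space (\<lambda>\<omega>. env_shift 0 s (env_path 0 \<omega>))"
    unfolding env_law_eq using s
    by (subst distr_distr) (auto simp: comp_def env_path_measurable env_shift_measurable)
  finally show ?thesis using s by (simp add: env_shift_path)
qed

lemma nn_integral_path:
  assumes "s \<ge> 0" "h \<in> borel_measurable env_space"
  shows "(\<integral>\<^sup>+\<omega>. h (env_path s \<omega>) \<partial>M) = (\<integral>\<^sup>+f. h f \<partial>env_law M \<xi>)"
  using assms by (subst distr_path[symmetric, of s]) (auto simp: nn_integral_distr env_path_measurable)

lemma AE_path_iff:
  assumes "s \<ge> 0" "{f \<in> space env_space. P f} \<in> sets env_space"
  shows "(AE \<omega> in M. P (env_path s \<omega>)) \<longleftrightarrow> (AE f in env_law M \<xi>. P f)"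
  using assms by (subst distr_path[symmetric, of s]) (auto simp: AE_distr_iff env_path_measurable)

lemma AE_path:
  assumes "s \<ge> 0" "AE f in env_law M \<xi>. P f"
  shows "AE \<omega> in M. P (env_path s \<omega>)"
  by (rule AE_distrD[OF env_path_measurable[OF assms(1)]]) (simp only: distr_path[OF assms(1)] assms(2))

text \<open>A single \<open>F\<close> has to serve all \<open>s\<close>, so that the
  \<open>Z s\<close> are shifts of one path functional and inherit stationarity. The null set may
  depend on \<open>s\<close>; this leaves room for time integrals, which are functions of the path
  only almost surely.\<close>

definition is_factor :: "(real \<Rightarrow> 'w \<Rightarrow> 'b::topological_space) \<Rightarrow> bool" where
  "is_factor Z \<longleftrightarrow> (\<exists>F\<in>borel_measurable env_space. \<forall>s\<ge>0. AE \<omega> in M. Z s \<omega> = F (env_path s \<omega>))"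

lemma is_factorI:
  assumes "F \<in> borel_measurable env_space" "\<And>s. s \<ge> 0 \<Longrightarrow> AE \<omega> in M. Z s \<omega> = F (env_path s \<omega>)"
  shows "is_factor Z"
  unfolding is_factor_def by (intro bexI[OF _ assms(1)] allI impI assms(2))

lemma is_factorE:
  assumes "is_factor Z"
  obtains F where "F \<in> borel_measurable env_space" "\<And>s. s \<ge> 0 \<Longrightarrow> AE \<omega> in M. Z s \<omega> = F (env_path s \<omega>)"
  using assms unfolding is_factor_def by blast

lemma is_factor_cong_AE:
  assumes "is_factor Z" "\<And>s. s \<ge> 0 \<Longrightarrow> AE \<omega> in M. Z' s \<omega> = Z s \<omega>"
  shows "is_factor Z'"
proof -
  from assms(1) obtain F where [measurable]: "F \<in> borel_measurable env_space"
    and F: "\<And>s. s \<ge> 0 \<Longrightarrow> AE \<omega> in M. Z s \<omega> = F (env_path s \<omega>)" by (rule is_factorE) blast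
  have "AE \<omega> in M. Z' s \<omega> = F (env_path s \<omega>)" if "s \<ge> 0" for s
    using F[OF that] assms(2)[OF that] by eventually_elim simp
  then show ?thesis by (rule is_factorI[rotated]) measurable
qed

lemma is_factor_field: "r \<ge> 0 \<Longrightarrow> is_factor (\<lambda>s. \<xi> x (s + r))"
  by (rule is_factorI[of "\<lambda>f. f (x, r)"])
     (auto simp: env_path_def env_space_def intro!: measurable_component_singleton)

lemma is_factor_compose:
  assumes "is_factor Z" "g \<in> borel_measurable borel"
  shows "is_factor (\<lambda>s \<omega>. g (Z s \<omega>))"
proof -
  from assms(1) obtain F where F[measurable]: "F \<in> borel_measurable env_space"
    and Z: "\<And>s. s \<ge> 0 \<Longrightarrow> AE \<omega> in M. Z s \<omega> = F (env_path s \<omega>)" by (rule is_factorE) blast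
  have "AE \<omega> in M. g (Z s \<omega>) = g (F (env_path s \<omega>))" if "s \<ge> 0" for s
    using Z[OF that] by eventually_elim simp
  with measurable_compose[OF F assms(2)] show ?thesis by (rule is_factorI)
qed

lemma is_factor_Pair:
  fixes Z1 :: "real \<Rightarrow> 'w \<Rightarrow> 'b::second_countable_topology"
    and Z2 :: "real \<Rightarrow> 'w \<Rightarrow> 'c::second_countable_topology"
  assumes "is_factor Z1" "is_factor Z2"
  shows "is_factor (\<lambda>s \<omega>. (Z1 s \<omega>, Z2 s \<omega>))"
proof -
  from assms(1) obtain F1 where [measurable]: "F1 \<in> borel_measurable env_space"
    and Z1: "\<And>s. s \<ge> 0 \<Longrightarrow> AE \<omega> in M. Z1 s \<omega> = F1 (env_path s \<omega>)" by (rule is_factorE) blast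
  from assms(2) obtain F2 where [measurable]: "F2 \<in> borel_measurable env_space"
    and Z2: "\<And>s. s \<ge> 0 \<Longrightarrow> AE \<omega> in M. Z2 s \<omega> = F2 (env_path s \<omega>)" by (rule is_factorE) blast
  have "AE \<omega> in M. (Z1 s \<omega>, Z2 s \<omega>) = (F1 (env_path s \<omega>), F2 (env_path s \<omega>))" if "s \<ge> 0" for s
    using Z1[OF that] Z2[OF that] by eventually_elim simp
  then show ?thesis by (rule is_factorI[rotated]) measurable
qed

lemma is_factor_SUP:
  fixes Z :: "nat \<Rightarrow> real \<Rightarrow> 'w \<Rightarrow> ennreal"
  assumes "\<And>k. is_factor (Z k)"
  shows "is_factor (\<lambda>s \<omega>. SUP k. Z k s \<omega>)"
proof -
  have "\<forall>k. \<exists>F. F \<in> borel_measurable env_space \<and> (\<forall>s\<ge>0. AE \<omega> in M. Z k s \<omega> = F (env_path s \<omega>))"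
    using assms unfolding is_factor_def by blast
  then obtain F where [measurable]: "\<And>k. F k \<in> borel_measurable env_space"
    and F: "\<And>k s. s \<ge> 0 \<Longrightarrow> AE \<omega> in M. Z k s \<omega> = F k (env_path s \<omega>)"
    by metis
  have "AE \<omega> in M. (SUP k. Z k s \<omega>) = (SUP k. F k (env_path s \<omega>))" if "s \<ge> 0" for s
  proof -
    have "AE \<omega> in M. \<forall>k. Z k s \<omega> = F k (env_path s \<omega>)"
      unfolding AE_all_countable by (intro allI F that)
    then show ?thesis by eventually_elim simp
  qed
  then show ?thesis by (rule is_factorI[rotated]) measurable
qed

text \<open>An integral of factors of the path need not be measurable with respect to the product
  \<open>\<sigma>\<close>-algebra on env_path space. It agrees almost surely with its projection \<open>F\<close> onto the
  path-measurable variables because \<open>E[J F] = E[J\<^sup>2] = E[F\<^sup>2]\<close> by Tonelli, and stationarity makes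
  the same \<open>F\<close> work for all shifts.\<close>

lemma is_factor_nn_integral_bounded:
  fixes Z :: "'p \<Rightarrow> real \<Rightarrow> 'w \<Rightarrow> ennreal" and K :: nat
  assumes "finite_measure \<mu>"
    and Z_measurable: "\<And>s. s \<ge> 0 \<Longrightarrow> (\<lambda>(p, \<omega>). Z p s \<omega>) \<in> borel_measurable (\<mu> \<Otimes>\<^sub>M M)"
    and ZK: "\<And>p s \<omega>. Z p s \<omega> \<le> of_nat K"
    and factor: "AE p in \<mu>. is_factor (Z p)"
  shows "is_factor (\<lambda>s \<omega>. \<integral>\<^sup>+p. Z p s \<omega> \<partial>\<mu>)"
proof -
  interpret \<mu>: finite_measure \<mu> by fact
  interpret pair_sigma_finite \<mu> M ..
  interpret L: prob_space "env_law M \<xi>" by (rule prob_space_env_law)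
  define J where "J s \<omega> = (\<integral>\<^sup>+p. Z p s \<omega> \<partial>\<mu>)" for s \<omega>
  have Z2: "(\<lambda>(\<omega>, p). Z p s \<omega>) \<in> borel_measurable (M \<Otimes>\<^sub>M \<mu>)" if "s \<ge> 0" for s
    using measurable_pair_swap[OF Z_measurable[OF that]] by simp
  have J_meas: "J s \<in> borel_measurable M" if "s \<ge> 0" for s
    unfolding J_def using Z2[OF that] by (rule \<mu>.borel_measurable_nn_integral)
  have Z1: "Z p s \<in> borel_measurable M" if "s \<ge> 0" "p \<in> space \<mu>" for p s
    using measurable_Pair2[OF Z_measurable[OF that(1)] that(2)] by simp
  have tonelli: "(\<integral>\<^sup>+\<omega>. J s \<omega> * V \<omega> \<partial>M) = (\<integral>\<^sup>+p. (\<integral>\<^sup>+\<omega>. Z p s \<omega> * V \<omega> \<partial>M) \<partial>\<mu>)"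
    if s: "s \<ge> 0" and V[measurable]: "V \<in> borel_measurable M" for s V
  proof -
    note [measurable] = Z_measurable[OF s]
    have "(\<integral>\<^sup>+\<omega>. J s \<omega> * V \<omega> \<partial>M) = (\<integral>\<^sup>+\<omega>. (\<integral>\<^sup>+p. Z p s \<omega> * V \<omega> \<partial>\<mu>) \<partial>M)"
      unfolding J_def
      by (intro nn_integral_cong nn_integral_multc[symmetric]) (use measurable_Pair2[OF Z2[OF s]] in simp)
    also have "\<dots> = (\<integral>\<^sup>+p. (\<integral>\<^sup>+\<omega>. Z p s \<omega> * V \<omega> \<partial>M) \<partial>\<mu>)"
      by (rule Fubini') measurable
    finally show ?thesis .
  qed
  \<comment> \<open>The density of \<open>\<nu>\<close> with respect to the law of the path is the
    conditional expectation of \<open>J 0\<close> given the path; Radon-Nikodym supplies it as a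
    path-measurable \<open>F\<close>.\<close>
  define \<nu> where "\<nu> = distr (density M (J 0)) env_space (env_path 0)"
  note [measurable] = env_path_measurable[of 0, simplified] J_meas[of 0, simplified]
  have int_\<nu>: "(\<integral>\<^sup>+f. h f \<partial>\<nu>) = (\<integral>\<^sup>+\<omega>. J 0 \<omega> * h (env_path 0 \<omega>) \<partial>M)"
    if [measurable]: "h \<in> borel_measurable env_space" for h
    unfolding \<nu>_def by (simp add: nn_integral_distr nn_integral_density)
  have "absolutely_continuous (env_law M \<xi>) \<nu>"
    unfolding absolutely_continuous_def
  proof
    fix A assume A: "A \<in> null_sets (env_law M \<xi>)"
    then have [measurable]: "A \<in> sets env_space" by auto
    have "AE f in env_law M \<xi>. f \<notin> A" using A by (rule AE_not_in)
    then have "AE \<omega> in M. env_path 0 \<omega> \<notin> A" by (rule AE_path[rotated]) simp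
    then have "(\<integral>\<^sup>+\<omega>. J 0 \<omega> * indicator A (env_path 0 \<omega>) \<partial>M) = (\<integral>\<^sup>+\<omega>. 0 \<partial>M)"
      by (intro nn_integral_cong_AE) (auto elim!: eventually_mono)
    then have "(\<integral>\<^sup>+f. indicator A f \<partial>\<nu>) = 0" by (simp add: int_\<nu>)
    then show "A \<in> null_sets \<nu>" by (auto simp: null_sets_def \<nu>_def)
  qed
  moreover have "sets \<nu> = sets (env_law M \<xi>)" by (simp add: \<nu>_def)
  ultimately obtain F where F[measurable]: "F \<in> borel_measurable (env_law M \<xi>)"
    and dens: "density (env_law M \<xi>) F = \<nu>"
    using L.Radon_Nikodym by blast
  have F': "F \<in> borel_measurable env_space" using F by simp
  note [measurable] = F'
  have proj0: "(\<integral>\<^sup>+\<omega>. J 0 \<omega> * h (env_path 0 \<omega>) \<partial>M) = (\<integral>\<^sup>+f. F f * h f \<partial>env_law M \<xi>)"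
    if [measurable]: "h \<in> borel_measurable env_space" for h
    unfolding int_\<nu>[OF that, symmetric] dens[symmetric] by (simp add: nn_integral_density)
  \<comment> \<open>The projection found at shift 0 also works at shift \<open>s\<close>: for almost
    every \<open>p\<close> the inner mean depends only on the law of the path, which is the same at
    every shift, and Tonelli carries this to \<open>J\<close>.\<close>
  have proj: "(\<integral>\<^sup>+\<omega>. J s \<omega> * h (env_path s \<omega>) \<partial>M) = (\<integral>\<^sup>+f. F f * h f \<partial>env_law M \<xi>)"
    if s: "s \<ge> 0" and [measurable]: "h \<in> borel_measurable env_space" for h s
  proof -
    note [measurable] = env_path_measurable[OF s]
    have "(\<integral>\<^sup>+\<omega>. J s \<omega> * h (env_path s \<omega>) \<partial>M) = (\<integral>\<^sup>+p. (\<integral>\<^sup>+\<omega>. Z p s \<omega> * h (env_path s \<omega>) \<partial>M) \<partial>\<mu>)"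
      by (rule tonelli[OF s]) measurable
    also have "\<dots> = (\<integral>\<^sup>+p. (\<integral>\<^sup>+\<omega>. Z p 0 \<omega> * h (env_path 0 \<omega>) \<partial>M) \<partial>\<mu>)"
    proof (rule nn_integral_cong_AE)
      show "AE p in \<mu>. (\<integral>\<^sup>+\<omega>. Z p s \<omega> * h (env_path s \<omega>) \<partial>M) = (\<integral>\<^sup>+\<omega>. Z p 0 \<omega> * h (env_path 0 \<omega>) \<partial>M)"
        using factor
      proof eventually_elim
        case (elim p)
        then obtain G where [measurable]: "G \<in> borel_measurable env_space"
          and G: "\<And>s. s \<ge> 0 \<Longrightarrow> AE \<omega> in M. Z p s \<omega> = G (env_path s \<omega>)" by (rule is_factorE) blast
        have *: "(\<integral>\<^sup>+\<omega>. Z p s \<omega> * h (env_path s \<omega>) \<partial>M) = (\<integral>\<^sup>+f. G f * h f \<partial>env_law M \<xi>)" if "s \<ge> 0" for s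
        proof -
          have "(\<integral>\<^sup>+\<omega>. Z p s \<omega> * h (env_path s \<omega>) \<partial>M) = (\<integral>\<^sup>+\<omega>. G (env_path s \<omega>) * h (env_path s \<omega>) \<partial>M)"
            using G[OF that] by (intro nn_integral_cong_AE) (auto elim!: eventually_mono)
          then show ?thesis by (simp add: nn_integral_path[OF that, of "\<lambda>f. G f * h f"])
        qed
        show ?case using *[OF s] *[of 0] by simp
      qed
    qed
    also have "\<dots> = (\<integral>\<^sup>+\<omega>. J 0 \<omega> * h (env_path 0 \<omega>) \<partial>M)"
      by (rule tonelli[symmetric]) auto
    also have "\<dots> = (\<integral>\<^sup>+f. F f * h f \<partial>env_law M \<xi>)" by (rule proj0) measurable
    finally show ?thesis .
  qed
  have "AE \<omega> in M. J s \<omega> = F (env_path s \<omega>)" if s: "s \<ge> 0" for s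
  proof (rule AE_eq_if_square_integrals_eq)
    note [measurable] = env_path_measurable[OF s] J_meas[OF s]
    show "(\<integral>\<^sup>+\<omega>. J s \<omega> * F (env_path s \<omega>) \<partial>M) = (\<integral>\<^sup>+\<omega>. F (env_path s \<omega>) * F (env_path s \<omega>) \<partial>M)"
      using proj[OF s F'] by (simp add: nn_integral_path[OF s, of "\<lambda>f. F f * F f"])
    \<comment> \<open>One factor \<open>J s\<close> is expanded over \<open>p\<close>. Each
      \<open>Z p s\<close> is a function of the path, and against such a function the other factor
      may be replaced by its projection.\<close>
    have "(\<integral>\<^sup>+\<omega>. J s \<omega> * J s \<omega> \<partial>M) = (\<integral>\<^sup>+p. (\<integral>\<^sup>+\<omega>. Z p s \<omega> * J s \<omega> \<partial>M) \<partial>\<mu>)"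
      by (rule tonelli[OF s]) measurable
    also have "\<dots> = (\<integral>\<^sup>+p. (\<integral>\<^sup>+\<omega>. Z p s \<omega> * F (env_path s \<omega>) \<partial>M) \<partial>\<mu>)"
    proof (rule nn_integral_cong_AE)
      show "AE p in \<mu>. (\<integral>\<^sup>+\<omega>. Z p s \<omega> * J s \<omega> \<partial>M) = (\<integral>\<^sup>+\<omega>. Z p s \<omega> * F (env_path s \<omega>) \<partial>M)"
        using factor
      proof eventually_elim
        case (elim p)
        then obtain G where [measurable]: "G \<in> borel_measurable env_space"
          and G: "\<And>s. s \<ge> 0 \<Longrightarrow> AE \<omega> in M. Z p s \<omega> = G (env_path s \<omega>)" by (rule is_factorE) blast
        have "(\<integral>\<^sup>+\<omega>. Z p s \<omega> * J s \<omega> \<partial>M) = (\<integral>\<^sup>+\<omega>. J s \<omega> * G (env_path s \<omega>) \<partial>M)"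
          using G[OF s] by (intro nn_integral_cong_AE) (auto elim!: eventually_mono simp: mult.commute)
        also have "\<dots> = (\<integral>\<^sup>+f. F f * G f \<partial>env_law M \<xi>)" by (rule proj[OF s]) measurable
        also have "\<dots> = (\<integral>\<^sup>+\<omega>. F (env_path s \<omega>) * G (env_path s \<omega>) \<partial>M)"
          by (subst nn_integral_path[OF s, of "\<lambda>f. F f * G f"]) auto
        also have "\<dots> = (\<integral>\<^sup>+\<omega>. Z p s \<omega> * F (env_path s \<omega>) \<partial>M)"
          using G[OF s] by (intro nn_integral_cong_AE) (auto elim!: eventually_mono simp: mult.commute)
        finally show ?case .
      qed
    qed
    also have "\<dots> = (\<integral>\<^sup>+\<omega>. J s \<omega> * F (env_path s \<omega>) \<partial>M)"
      by (rule tonelli[OF s, symmetric]) measurable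
    finally show "(\<integral>\<^sup>+\<omega>. J s \<omega> * J s \<omega> \<partial>M) = (\<integral>\<^sup>+\<omega>. J s \<omega> * F (env_path s \<omega>) \<partial>M)" .
    \<comment> \<open>Boundedness of \<open>Z\<close> gives \<open>J\<close> the finite second
      moment that the comparison of squares requires.\<close>
    have J_le: "J s \<omega> \<le> of_nat K * emeasure \<mu> (space \<mu>)" for \<omega>
    proof -
      have "J s \<omega> \<le> (\<integral>\<^sup>+p. of_nat K \<partial>\<mu>)" unfolding J_def by (intro nn_integral_mono ZK)
      then show ?thesis by simp
    qed
    have "(\<integral>\<^sup>+\<omega>. J s \<omega> * J s \<omega> \<partial>M)
        \<le> (\<integral>\<^sup>+\<omega>. (of_nat K * emeasure \<mu> (space \<mu>)) * (of_nat K * emeasure \<mu> (space \<mu>)) \<partial>M)"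
      by (intro nn_integral_mono mult_mono J_le) auto
    also have "\<dots> < \<infinity>"
      by (simp add: emeasure_space_1 \<mu>.emeasure_eq_measure ennreal_mult_less_top of_nat_less_top)
    finally show "(\<integral>\<^sup>+\<omega>. J s \<omega> * J s \<omega> \<partial>M) \<noteq> \<infinity>" by simp
  qed (use F' env_path_measurable[OF s] J_meas[OF s] in measurable)
  then show ?thesis unfolding J_def by (rule is_factorI[OF F'])
qed

text \<open>Truncation at \<open>k\<close> reduces to the bounded case, where second moments are
  finite; the supremum over \<open>k\<close> is again a factor.\<close>

lemma is_factor_nn_integral:
  fixes Z :: "'p \<Rightarrow> real \<Rightarrow> 'w \<Rightarrow> ennreal"
  assumes "finite_measure \<mu>"
    and Z_measurable: "\<And>s. s \<ge> 0 \<Longrightarrow> (\<lambda>(p, \<omega>). Z p s \<omega>) \<in> borel_measurable (\<mu> \<Otimes>\<^sub>M M)"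
    and factor: "AE p in \<mu>. is_factor (Z p)"
  shows "is_factor (\<lambda>s \<omega>. \<integral>\<^sup>+p. Z p s \<omega> \<partial>\<mu>)"
proof (rule is_factor_cong_AE)
  show "is_factor (\<lambda>s \<omega>. SUP k::nat. \<integral>\<^sup>+p. min (Z p s \<omega>) (of_nat k) \<partial>\<mu>)"
  proof (intro is_factor_SUP)
    fix k :: nat
    show "is_factor (\<lambda>s \<omega>. \<integral>\<^sup>+p. min (Z p s \<omega>) (of_nat k) \<partial>\<mu>)"
    proof (rule is_factor_nn_integral_bounded[OF assms(1), where K=k])
    show "AE p in \<mu>. is_factor (\<lambda>s \<omega>. min (Z p s \<omega>) (of_nat k))"
      using factor by eventually_elim (rule is_factor_compose[of _ "\<lambda>z. min z (of_nat k)"], auto)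
    fix s :: real assume "s \<ge> 0"
    note [measurable] = Z_measurable[OF this]
    show "(\<lambda>(p, \<omega>). min (Z p s \<omega>) (of_nat k)) \<in> borel_measurable (\<mu> \<Otimes>\<^sub>M M)" by measurable
    qed simp
  qed
  fix s :: real assume s: "s \<ge> 0"
  show "AE \<omega> in M. (\<integral>\<^sup>+p. Z p s \<omega> \<partial>\<mu>) = (SUP k::nat. \<integral>\<^sup>+p. min (Z p s \<omega>) (of_nat k) \<partial>\<mu>)"
  proof (rule AE_I2)
    fix \<omega> assume "\<omega> \<in> space M"
    then have "(\<lambda>p. Z p s \<omega>) \<in> borel_measurable \<mu>"
      using measurable_Pair1[OF Z_measurable[OF s]] by simp
    then show "(\<integral>\<^sup>+p. Z p s \<omega> \<partial>\<mu>) = (SUP k::nat. \<integral>\<^sup>+p. min (Z p s \<omega>) (of_nat k) \<partial>\<mu>)"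
      by (rule nn_integral_SUP_min)
  qed
qed

end

section \<open>Superadditive functionals of an ergodic field\<close>

context prob_space begin

text \<open>One level set is enough if its level is the mean: a variable almost surely at most its
  mean equals it, and a variable cannot almost surely exceed its mean, so the second case ends in a
  contradiction.\<close>

lemma AE_eq_const_if_trivial:
  fixes g :: "'a \<Rightarrow> ennreal"
  assumes [measurable]: "g \<in> borel_measurable M" and int: "(\<integral>\<^sup>+x. g x \<partial>M) = c" and c: "c \<noteq> \<infinity>"
    and triv: "prob {x\<in>space M. g x \<le> c} = 0 \<or> prob {x\<in>space M. g x \<le> c} = 1"
  shows "AE x in M. g x = c"
  using triv
proof
  assume "prob {x\<in>space M. g x \<le> c} = 1"
  then have le: "AE x in M. g x \<le> c" by (subst (asm) prob_Collect_eq_1) auto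
  have "(\<integral>\<^sup>+x. c - g x \<partial>M) = c - (\<integral>\<^sup>+x. g x \<partial>M)"
    using le c int by (subst nn_integral_diff) (auto simp: emeasure_space_1)
  also have "\<dots> = 0" using int c by simp
  finally have "AE x in M. c - g x = 0" by (subst (asm) nn_integral_0_iff_AE) auto
  with le show ?thesis by eventually_elim (simp add: diff_eq_0_iff_ennreal antisym)
next
  assume "prob {x\<in>space M. g x \<le> c} = 0"
  then have gt: "AE x in M. \<not> g x \<le> c" by (subst (asm) prob_Collect_eq_0) auto
  then have "(\<integral>\<^sup>+x. g x - c \<partial>M) = (\<integral>\<^sup>+x. g x \<partial>M) - c"
    using c by (subst nn_integral_diff) (auto simp: emeasure_space_1 elim!: eventually_mono)
  also have "\<dots> = 0" using int c by simp
  finally have "AE x in M. g x - c = 0" by (subst (asm) nn_integral_0_iff_AE) auto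
  with gt show ?thesis by eventually_elim (simp add: diff_eq_0_iff_ennreal)
qed

text \<open>Scheffe's argument. Since \<open>ennreal\<close> sends negative numbers to 0,
  \<open>ennreal (l - a n x)\<close> is the positive part of the deficit; it is dominated by
  \<open>l\<close> and so tends to 0 in mean. As the mean of \<open>a n\<close> does not exceed
  \<open>l\<close>, the total deviation is at most twice the deficit.\<close>

lemma nn_integral_abs_diff_tendsto_0:
  fixes a :: "nat \<Rightarrow> 'a \<Rightarrow> real"
  assumes [measurable]: "\<And>n. a n \<in> borel_measurable M" and nonneg: "\<And>n x. a n x \<ge> 0" "l \<ge> 0"
    and lim: "AE x in M. (\<lambda>n. a n x) \<longlonglongrightarrow> l"
    and le: "eventually (\<lambda>n. (\<integral>\<^sup>+x. ennreal (a n x) \<partial>M) \<le> ennreal l) sequentially"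
  shows "(\<lambda>n. \<integral>\<^sup>+x. ennreal \<bar>a n x - l\<bar> \<partial>M) \<longlonglongrightarrow> 0"
proof -
  have "(\<lambda>n. \<integral>\<^sup>+x. ennreal (l - a n x) \<partial>M) \<longlonglongrightarrow> (\<integral>\<^sup>+x. 0 \<partial>M)"
  proof (rule nn_integral_dominated_convergence[where w="\<lambda>_. ennreal l"])
    show "AE x in M. (\<lambda>n. ennreal (l - a n x)) \<longlonglongrightarrow> 0"
      using lim
    proof eventually_elim
      case (elim x)
      have "(\<lambda>n. ennreal (l - a n x)) \<longlonglongrightarrow> ennreal (l - l)"
        by (intro tendsto_ennrealI tendsto_intros elim)
      then show ?case by simp
    qed
  qed (use nonneg in \<open>auto simp: emeasure_space_1 intro!: ennreal_leI\<close>)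
  then have lim2: "(\<lambda>n. 2 * (\<integral>\<^sup>+x. ennreal (l - a n x) \<partial>M)) \<longlonglongrightarrow> 2 * 0"
    by (intro tendsto_mult_ennreal) auto
  show ?thesis
  proof (rule tendsto_sandwich[OF _ _ tendsto_const])
    show "(\<lambda>n. 2 * (\<integral>\<^sup>+x. ennreal (l - a n x) \<partial>M)) \<longlonglongrightarrow> 0" using lim2 by simp
    show "eventually (\<lambda>n. (\<integral>\<^sup>+x. ennreal \<bar>a n x - l\<bar> \<partial>M) \<le> 2 * (\<integral>\<^sup>+x. ennreal (l - a n x) \<partial>M)) sequentially"
      using le
    proof eventually_elim
      case (elim n)
      have eq: "ennreal \<bar>a n x - l\<bar> + ennreal l = ennreal (a n x) + 2 * ennreal (l - a n x)" for x
      proof (cases "a n x \<le> l")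
        case True
        then have "ennreal \<bar>a n x - l\<bar> + ennreal l = ennreal (2 * l - a n x)"
          using nonneg by (simp flip: ennreal_plus)
        also have "\<dots> = ennreal (a n x + 2 * (l - a n x))" by (simp add: algebra_simps)
        also have "\<dots> = ennreal (a n x) + 2 * ennreal (l - a n x)"
        proof -
          have "ennreal (2 * (l - a n x)) = 2 * ennreal (l - a n x)" by (subst ennreal_mult) (use True in auto)
          then show ?thesis using nonneg True by (subst ennreal_plus) (auto simp only: mult_nonneg_nonneg diff_ge_0_iff_ge zero_le_numeral)
        qed
        finally show ?thesis .
      next
        case False
        then show ?thesis using nonneg by (simp add: ennreal_neg flip: ennreal_plus)
      qed
      have "(\<integral>\<^sup>+x. ennreal \<bar>a n x - l\<bar> \<partial>M) + ennreal l = (\<integral>\<^sup>+x. ennreal \<bar>a n x - l\<bar> + ennreal l \<partial>M)"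
        by (subst nn_integral_add) (auto simp: emeasure_space_1)
      also have "\<dots> = (\<integral>\<^sup>+x. ennreal (a n x) \<partial>M) + 2 * (\<integral>\<^sup>+x. ennreal (l - a n x) \<partial>M)"
        unfolding eq by (simp add: nn_integral_add nn_integral_cmult)
      also have "\<dots> \<le> ennreal l + 2 * (\<integral>\<^sup>+x. ennreal (l - a n x) \<partial>M)"
        using elim by (rule add_right_mono)
      finally show ?case by (simp add: add.commute[of _ "ennreal l"] ennreal_add_left_cancel_le)
    qed
  qed simp
qed

end

lemma filterlim_nat_floor: "filterlim (\<lambda>t::real. nat \<lfloor>t\<rfloor>) sequentially at_top"
  unfolding filterlim_at_top
proof
  fix k :: nat
  show "eventually (\<lambda>t::real. k \<le> nat \<lfloor>t\<rfloor>) at_top"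
    using eventually_ge_at_top[of "real k"] by eventually_elim linarith
qed

text \<open>Monotonicity encloses \<open>w t\<close> between its values at \<open>k\<close> and
  \<open>Suc k\<close>. The factor 2 bounds \<open>Suc k / k\<close>, and \<open>l / k\<close> pays
  for moving \<open>t * l\<close> by at most one unit of time.\<close>

lemma abs_diff_le_integer_times:
  fixes w :: "real \<Rightarrow> real"
  assumes mono: "\<And>s t. 0 \<le> s \<Longrightarrow> s \<le> t \<Longrightarrow> w s \<le> w t" and t: "t \<ge> 1" and l: "l \<ge> 0"
  defines "k \<equiv> nat \<lfloor>t\<rfloor>"
  shows "\<bar>w t / t - l\<bar> \<le> \<bar>w (real k) / real k - l\<bar> + 2 * \<bar>w (real (Suc k)) / real (Suc k) - l\<bar> + l / real k"
proof -
  have k: "real k \<le> t" "t \<le> real (Suc k)" "k \<ge> 1" using t unfolding k_def by linarith+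
  define A where "A = \<bar>w (real k) - real k * l\<bar>"
  define B where "B = \<bar>w (real (Suc k)) - real (Suc k) * l\<bar>"
  have "w (real k) \<le> w t" "w t \<le> w (real (Suc k))" using k by (auto intro!: mono)
  moreover have "real k * l \<le> t * l" "t * l \<le> real (Suc k) * l"
    using k l by (auto intro!: mult_right_mono)
  moreover have "real (Suc k) * l = real k * l + l" by (simp add: algebra_simps)
  ultimately have "\<bar>w t - t * l\<bar> \<le> A + B + l" using l unfolding A_def B_def by linarith
  then have "\<bar>w t - t * l\<bar> / t \<le> (A + B + l) / t"
    using t by (intro divide_right_mono) auto
  also have "\<dots> \<le> (A + B + l) / real k"
    using k t l by (intro divide_left_mono) (auto simp: A_def B_def)
  also have "\<dots> = A / real k + B / real k + l / real k" by (simp add: add_divide_distrib)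
  also have "B / real k \<le> 2 * (B / real (Suc k))"
  proof -
    have "B * (1 + real k) \<le> B * (2 * real k)" using k by (intro mult_left_mono) (auto simp: B_def)
    then show ?thesis using k by (simp add: field_simps)
  qed
  also have "A / real k = \<bar>w (real k) / real k - l\<bar>"
  proof -
    have "w (real k) / real k - l = (w (real k) - real k * l) / real k" using k by (simp add: field_simps)
    then show ?thesis by (simp add: A_def)
  qed
  also have "B / real (Suc k) = \<bar>w (real (Suc k)) / real (Suc k) - l\<bar>"
  proof -
    have "w (real (Suc k)) / real (Suc k) - l = (w (real (Suc k)) - real (Suc k) * l) / real (Suc k)"
      by (simp add: diff_divide_distrib del: of_nat_Suc)
    then show ?thesis by (simp add: B_def)
  qed
  also have "\<bar>w t - t * l\<bar> / t = \<bar>w t / t - l\<bar>"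
  proof -
    have "w t / t - l = (w t - t * l) / t" using t by (simp add: field_simps)
    then show ?thesis using t by (simp add: abs_divide)
  qed
  finally show ?thesis by simp
qed

locale ergodic_field = stationary_field M \<xi>
  for M :: "'w measure" and \<xi> :: "int ^ 'd \<Rightarrow> real \<Rightarrow> 'w \<Rightarrow> real" +
  assumes ergodic: "ergodic_under (env_law M \<xi>) {env_shift 0 s | s. s \<ge> 0}"
begin

text \<open>Domination together with equality in law gives invariance modulo null sets under every
  real shift; ergodicity then makes the level set at the mean \<open>c\<close> trivial.\<close>

lemma AE_eq_const_if_shift_le:
  fixes g :: "((int ^ 'd) \<times> real \<Rightarrow> real) \<Rightarrow> ennreal"
  assumes g[measurable]: "g \<in> borel_measurable env_space"
    and shift: "\<And>s. s \<ge> 0 \<Longrightarrow> AE \<omega> in M. g (env_path s \<omega>) \<le> g (env_path 0 \<omega>)"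
    and int: "(\<integral>\<^sup>+f. g f \<partial>env_law M \<xi>) = c" and c: "c \<noteq> \<infinity>"
  shows "AE \<omega> in M. g (env_path 0 \<omega>) = c"
proof -
  interpret L: prob_space "env_law M \<xi>" by (rule prob_space_env_law)
  have inv: "AE f in env_law M \<xi>. g (env_shift 0 s f) = g f" if s: "s \<ge> 0" for s
  proof -
    note [measurable] = env_path_measurable[OF s] env_path_measurable[of 0, simplified] env_shift_measurable[OF s]
    have "AE \<omega> in M. g (env_path s \<omega>) = g (env_path 0 \<omega>)"
    proof (rule AE_eq_if_le_same_distr[OF _ _ _ shift[OF s]])
      have "distr M borel (\<lambda>\<omega>. g (env_path r \<omega>)) = distr (env_law M \<xi>) borel g" if "r \<ge> 0" for r
        unfolding distr_path[OF that, symmetric]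
        by (subst distr_distr) (auto simp: comp_def env_path_measurable that)
      then show "distr M borel (\<lambda>\<omega>. g (env_path s \<omega>)) = distr M borel (\<lambda>\<omega>. g (env_path 0 \<omega>))"
        using s by simp
    qed (auto simp: finite_measure_axioms)
    then have "AE \<omega> in M. g (env_shift 0 s (env_path 0 \<omega>)) = g (env_path 0 \<omega>)"
      using s by (simp add: env_shift_path)
    moreover have "{f \<in> space env_space. g (env_shift 0 s f) = g f} \<in> sets env_space" by measurable
    ultimately show ?thesis by (subst (asm) AE_path_iff) auto
  qed
  have "AE f in env_law M \<xi>. g f = c"
  proof (rule L.AE_eq_const_if_trivial[OF _ int c])
    have "{f \<in> space (env_law M \<xi>). g f \<le> c} \<in> sets (env_law M \<xi>)" by measurable
    moreover have "AE f in env_law M \<xi>. env_shift 0 s f \<in> {f \<in> space (env_law M \<xi>). g f \<le> c}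
        \<longleftrightarrow> f \<in> {f \<in> space (env_law M \<xi>). g f \<le> c}" if s: "s \<ge> 0" for s
      using inv[OF s] AE_space
    proof eventually_elim
      case (elim f)
      then show ?case using measurable_space[OF env_shift_measurable[OF s]] by auto
    qed
    ultimately show "L.prob {f \<in> space (env_law M \<xi>). g f \<le> c} = 0 \<or> L.prob {f \<in> space (env_law M \<xi>). g f \<le> c} = 1"
      using ergodic unfolding ergodic_under_def by blast
  qed simp
  then show ?thesis by (intro AE_path) auto
qed

text \<open>Kingman's theorem for the unit shift on path space gives a limit that might still depend
  on the path, since the unit shift alone need not be ergodic. Its constancy comes from comparing
  \<open>W\<close> at arbitrary real shifts, which is why superadditivity is required for all real
  times off one null set.\<close>

theorem superadditive_limit_discrete:
  fixes W :: "real \<Rightarrow> real \<Rightarrow> 'w \<Rightarrow> ennreal" and C :: real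
  assumes super: "AE \<omega> in M. \<forall>s\<ge>0. \<forall>a\<ge>0. \<forall>b\<ge>0. W s a \<omega> + W (s + a) b \<omega> \<le> W s (a + b) \<omega>"
    and factor: "\<And>n::nat. is_factor (\<lambda>s. W s (real n))"
    and C: "\<And>n::nat. (\<integral>\<^sup>+\<omega>. W 0 (real n) \<omega> \<partial>M) \<le> ennreal C * of_nat n"
  shows "\<exists>l\<ge>0. (AE \<omega> in M. (\<lambda>n. W 0 (real n) \<omega> / of_nat n) \<longlonglongrightarrow> ennreal l) \<and>
    (\<forall>n>0. (\<integral>\<^sup>+\<omega>. W 0 (real n) \<omega> \<partial>M) \<le> of_nat n * ennreal l)"
proof -
  interpret L: prob_space "env_law M \<xi>" by (rule prob_space_env_law)
  have "\<forall>n::nat. \<exists>F. F \<in> borel_measurable env_space \<and> (\<forall>s\<ge>0. AE \<omega> in M. W s (real n) \<omega> = F (env_path s \<omega>))"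
    using factor unfolding is_factor_def by blast
  then obtain F where F_meas[measurable]: "\<And>n. F n \<in> borel_measurable env_space"
    and F: "\<And>n s. s \<ge> 0 \<Longrightarrow> AE \<omega> in M. W s (real n) \<omega> = F n (env_path s \<omega>)"
    by metis
  have F_all: "AE \<omega> in M. \<forall>n. W s (real n) \<omega> = F n (env_path s \<omega>)" if "s \<ge> 0" for s
    unfolding AE_all_countable by (intro allI F that)
  let ?T = "env_shift 0 1 :: ((int ^ 'd) \<times> real \<Rightarrow> real) \<Rightarrow> _"
  note [measurable] = env_shift_measurable[of 1 0, simplified]
  have T_iter: "(?T ^^ m) (env_path s \<omega>) = env_path (s + real m) \<omega>" for m s \<omega>
    by (induction m) (simp_all add: env_shift_path add_ac)
  interpret L: superadditive_process "env_law M \<xi>" ?T F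
  proof
    show "?T \<in> env_law M \<xi> \<rightarrow>\<^sub>M env_law M \<xi>" by simp
    have "distr (env_law M \<xi>) env_space ?T = env_law M \<xi>"
      using stationary by (simp add: stationary_law_def)
    then show "distr (env_law M \<xi>) (env_law M \<xi>) ?T = env_law M \<xi>"
      by (subst distr_cong[OF refl sets_env_law refl]) simp
    show "F n \<in> borel_measurable (env_law M \<xi>)" for n by simp
    fix m n
    have Tm[measurable]: "?T ^^ m \<in> measurable env_space env_space"
      by (rule measurable_compose_n) simp
    \<comment> \<open>Superadditivity of \<open>F\<close> is read off from \<open>W\<close> on the
      probability space, where iterating the shift means passing to \<open>env_path\<close> at time
      \<open>m\<close>.\<close>
    have "AE \<omega> in M. F m (env_path 0 \<omega>) + F n ((?T ^^ m) (env_path 0 \<omega>)) \<le> F (m + n) (env_path 0 \<omega>)"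
      using super F_all[OF order.refl] F_all[OF of_nat_0_le_iff[of m]]
    proof eventually_elim
      case (elim \<omega>)
      have "W 0 (real m) \<omega> + W (0 + real m) (real n) \<omega> \<le> W 0 (real m + real n) \<omega>"
        using elim(1)[rule_format, of 0 "real m" "real n"] by simp
      then show ?case using elim(2,3) by (simp add: T_iter flip: of_nat_add)
    qed
    then show "AE f in env_law M \<xi>. F m f + F n ((?T ^^ m) f) \<le> F (m + n) f"
      by (subst (asm) AE_path_iff) (simp, measurable)
  qed
  have int_F: "(\<integral>\<^sup>+f. F n f \<partial>env_law M \<xi>) = (\<integral>\<^sup>+\<omega>. W 0 (real n) \<omega> \<partial>M)" for n
    unfolding nn_integral_path[of 0, simplified, OF F_meas, symmetric]
    using F[OF order.refl, of n] by (intro nn_integral_cong_AE) (auto elim!: eventually_mono)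
  define g where "g f = limsup (\<lambda>n. F n f / of_nat n)" for f
  have [measurable]: "g \<in> borel_measurable env_space" unfolding g_def by measurable
  have king: "AE f in env_law M \<xi>. liminf (\<lambda>n. F n f / of_nat n) = limsup (\<lambda>n. F n f / of_nat n)"
    "\<And>n. n > 0 \<Longrightarrow> (\<integral>\<^sup>+f. F n f \<partial>env_law M \<xi>) \<le> of_nat n * (\<integral>\<^sup>+f. liminf (\<lambda>n. F n f / of_nat n) \<partial>env_law M \<xi>)"
    "(\<integral>\<^sup>+f. limsup (\<lambda>n. F n f / of_nat n) \<partial>env_law M \<xi>) \<le> ennreal C"
    using L.kingman[of C] C by (auto simp: int_F)
  define c where "c = (\<integral>\<^sup>+f. g f \<partial>env_law M \<xi>)"
  have "c \<le> ennreal C" using king(3) by (simp add: c_def g_def)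
  then obtain l where l: "c = ennreal l" "l \<ge> 0" by (cases c) (auto simp: top_unique)
  have g_const: "AE \<omega> in M. g (env_path 0 \<omega>) = c"
  proof (rule AE_eq_const_if_shift_le)
    fix s :: real assume s: "s \<ge> 0"
    show "AE \<omega> in M. g (env_path s \<omega>) \<le> g (env_path 0 \<omega>)"
      using super F_all[OF s] F_all[of 0, simplified]
    proof eventually_elim
      case (elim \<omega>)
      have sup: "W r a \<omega> + W (r + a) b \<omega> \<le> W r (a + b) \<omega>" if "r \<ge> 0" "a \<ge> 0" "b \<ge> 0" for r a b
        using elim(1) that by blast
      \<comment> \<open>Only integer times are represented by \<open>F\<close>. Rounding the shift
        up to an integer \<open>k\<close> places the time interval of \<open>W s n\<close> inside
        that of \<open>W 0 (n + k)\<close>.\<close>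
      define k where "k = nat \<lceil>s\<rceil>"
      have k: "s \<le> real k" unfolding k_def by linarith
      have "F n (env_path s \<omega>) \<le> F (n + k) (env_path 0 \<omega>)" for n
      proof -
        have "F n (env_path s \<omega>) = W s (real n) \<omega>" using elim(2) by simp
        also have "\<dots> \<le> W 0 s \<omega> + W (0 + s) (real n) \<omega>" by (simp add: add_increasing)
        also have "\<dots> \<le> W 0 (s + real n) \<omega>" using s by (intro sup) auto
        also have "\<dots> \<le> W 0 (s + real n) \<omega> + W (0 + (s + real n)) (real k - s) \<omega>" by (simp add: add_increasing2)
        also have "\<dots> \<le> W 0 (s + real n + (real k - s)) \<omega>" using s k by (intro sup) auto
        also have "s + real n + (real k - s) = real (n + k)" by simp
        also have "W 0 (real (n + k)) \<omega> = F (n + k) (env_path 0 \<omega>)" using elim(3) by blast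
        finally show ?thesis .
      qed
      then show ?case unfolding g_def by (rule limsup_divide_le_shift)
    qed
  qed (auto simp: c_def[symmetric] l)
  have "AE \<omega> in M. liminf (\<lambda>n. F n (env_path 0 \<omega>) / of_nat n) = limsup (\<lambda>n. F n (env_path 0 \<omega>) / of_nat n)"
    by (rule AE_path[OF _ king(1)]) simp
  with g_const F_all[of 0, simplified]
  have "AE \<omega> in M. (\<lambda>n. W 0 (real n) \<omega> / of_nat n) \<longlonglongrightarrow> ennreal l"
  proof eventually_elim
    case (elim \<omega>)
    then have "(\<lambda>n. F n (env_path 0 \<omega>) / of_nat n) \<longlonglongrightarrow> c"
      by (intro Liminf_eq_Limsup) (auto simp: g_def)
    then show ?case using elim l by simp
  qed
  moreover have "(\<integral>\<^sup>+\<omega>. W 0 (real n) \<omega> \<partial>M) \<le> of_nat n * ennreal l" if "n > 0" for n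
  proof -
    have "(\<integral>\<^sup>+f. liminf (\<lambda>n. F n f / of_nat n) \<partial>env_law M \<xi>) = c"
      unfolding c_def g_def using king(1) by (intro nn_integral_cong_AE)
    then show ?thesis using king(2)[OF that] l by (simp add: int_F)
  qed
  ultimately show ?thesis using l(2) by blast
qed

text \<open>Measurability and mean bounds are available at integer times only; every other time is
  controlled by its two integer neighbours, both almost surely and in mean.\<close>

theorem superadditive_limit:
  fixes W :: "real \<Rightarrow> real \<Rightarrow> 'w \<Rightarrow> ennreal" and C :: real
  assumes super: "AE \<omega> in M. \<forall>s\<ge>0. \<forall>a\<ge>0. \<forall>b\<ge>0. W s a \<omega> + W (s + a) b \<omega> \<le> W s (a + b) \<omega>"
    and factor: "\<And>n::nat. is_factor (\<lambda>s. W s (real n))"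
    and W_meas[measurable]: "\<And>n::nat. W 0 (real n) \<in> borel_measurable M"
    and C: "\<And>n::nat. (\<integral>\<^sup>+\<omega>. W 0 (real n) \<omega> \<partial>M) \<le> ennreal C * of_nat n"
  shows "\<exists>l. (AE \<omega> in M. (\<forall>t\<ge>0. W 0 t \<omega> < \<infinity>) \<and> ((\<lambda>t. enn2real (W 0 t \<omega>) / t) \<longlongrightarrow> l) at_top) \<and>
    ((\<lambda>t. \<integral>\<^sup>+\<omega>. ennreal \<bar>enn2real (W 0 t \<omega>) / t - l\<bar> \<partial>M) \<longlongrightarrow> 0) at_top"
proof -
  obtain l where l: "l \<ge> 0" and lim: "AE \<omega> in M. (\<lambda>n. W 0 (real n) \<omega> / of_nat n) \<longlonglongrightarrow> ennreal l"
    and int: "\<And>n. n > 0 \<Longrightarrow> (\<integral>\<^sup>+\<omega>. W 0 (real n) \<omega> \<partial>M) \<le> of_nat n * ennreal l"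
    using superadditive_limit_discrete[OF super factor C] by blast
  have "AE \<omega> in M. W 0 (real n) \<omega> \<noteq> \<infinity>" for n
  proof (rule nn_integral_noteq_infinite)
    have "ennreal C * of_nat n < \<top>" by (simp add: ennreal_mult_less_top of_nat_less_top)
    with C[of n] show "(\<integral>\<^sup>+\<omega>. W 0 (real n) \<omega> \<partial>M) \<noteq> \<infinity>"
      by (metis infinity_ennreal_def leD)
  qed simp
  then have fin: "AE \<omega> in M. \<forall>n::nat. W 0 (real n) \<omega> \<noteq> \<infinity>"
    unfolding AE_all_countable by blast
  have mono: "W 0 s \<omega> \<le> W 0 t \<omega>"
    if "\<forall>s\<ge>0. \<forall>a\<ge>0. \<forall>b\<ge>0. W s a \<omega> + W (s + a) b \<omega> \<le> W s (a + b) \<omega>" "0 \<le> s" "s \<le> t" for s t \<omega>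
  proof -
    have "W 0 s \<omega> \<le> W 0 s \<omega> + W (0 + s) (t - s) \<omega>" by (simp add: add_increasing2)
    also have "\<dots> \<le> W 0 (s + (t - s)) \<omega>" using that by (metis diff_ge_0_iff_ge order.refl)
    finally show ?thesis by simp
  qed
  have fin_t: "AE \<omega> in M. \<forall>t\<ge>0. W 0 t \<omega> < \<infinity>"
    using super fin
  proof eventually_elim
    case (elim \<omega>)
    show ?case
    proof (intro allI impI)
      fix t :: real assume "t \<ge> 0"
      then have "W 0 t \<omega> \<le> W 0 (real (nat \<lceil>t\<rceil>)) \<omega>" by (intro mono[OF elim(1)]) linarith+
      also have "\<dots> < \<infinity>" using elim(2) by (simp add: less_top)
      finally show "W 0 t \<omega> < \<infinity>" .
    qed
  qed
  define D where "D n \<omega> = \<bar>enn2real (W 0 (real n) \<omega>) / real n - l\<bar>" for n \<omega>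
  have [measurable]: "D n \<in> borel_measurable M" for n unfolding D_def by measurable
  have lim_real: "AE \<omega> in M. (\<lambda>n. enn2real (W 0 (real n) \<omega>) / real n) \<longlonglongrightarrow> l"
    using lim fin
  proof eventually_elim
    case (elim \<omega>)
    have "(\<lambda>n. enn2real (W 0 (real n) \<omega> / of_nat n)) \<longlonglongrightarrow> l"
      by (rule tendsto_enn2real[OF elim(1) l])
    moreover have "enn2real (W 0 (real n) \<omega> / of_nat n) = enn2real (W 0 (real n) \<omega>) / real n" for n
    proof (cases "n = 0")
      case False
      then show ?thesis using elim(2)[rule_format, of n]
        by (cases "W 0 (real n) \<omega>") (auto simp: ennreal_of_nat_eq_real_of_nat divide_ennreal)
    next
      \<comment> \<open>At \<open>n = 0\<close> both sides are 0: the quotient in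
        \<open>ennreal\<close> is 0 or infinite, and \<open>enn2real\<close> sends both to
        0.\<close>
      case True
      then show ?thesis by (cases "W 0 (real n) \<omega> = 0") (auto simp: ennreal_divide_zero)
    qed
    ultimately show ?case using l by simp
  qed
  have D_lim: "AE \<omega> in M. (\<lambda>n. D n \<omega>) \<longlonglongrightarrow> 0"
    using lim_real unfolding D_def by eventually_elim (intro tendsto_rabs_zero LIM_zero)
  have D_int: "(\<lambda>n. \<integral>\<^sup>+\<omega>. ennreal (D n \<omega>) \<partial>M) \<longlonglongrightarrow> 0"
    unfolding D_def
  proof (rule nn_integral_abs_diff_tendsto_0[OF _ _ l lim_real])
    \<comment> \<open>Kingman's bound of the means by \<open>n * l\<close> is exactly the one-sided
      bound that Scheffe's argument needs.\<close>
    show "eventually (\<lambda>n. (\<integral>\<^sup>+\<omega>. ennreal (enn2real (W 0 (real n) \<omega>) / real n) \<partial>M) \<le> ennreal l) sequentially"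
      using eventually_gt_at_top[of 0]
    proof eventually_elim
      case (elim n)
      have "(\<integral>\<^sup>+\<omega>. ennreal (enn2real (W 0 (real n) \<omega>) / real n) \<partial>M) \<le> (\<integral>\<^sup>+\<omega>. W 0 (real n) \<omega> / of_nat n \<partial>M)"
      proof (rule nn_integral_mono)
        fix \<omega>
        show "ennreal (enn2real (W 0 (real n) \<omega>) / real n) \<le> W 0 (real n) \<omega> / of_nat n"
          using elim by (cases "W 0 (real n) \<omega>") (auto simp: ennreal_of_nat_eq_real_of_nat divide_ennreal)
      qed
      also have "\<dots> = (\<integral>\<^sup>+\<omega>. W 0 (real n) \<omega> \<partial>M) / of_nat n" by (rule nn_integral_divide) simp
      also have "\<dots> \<le> ennreal l * of_nat n / of_nat n"
        using int[OF elim] by (intro divide_right_mono_ennreal) (simp add: mult.commute)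
      also have "\<dots> = ennreal l" using elim by (intro mult_divide_eq_ennreal) auto
      finally show ?case .
    qed
  qed auto
  let ?k = "\<lambda>t::real. nat \<lfloor>t\<rfloor>"
  have bound: "AE \<omega> in M. \<forall>t\<ge>1. \<bar>enn2real (W 0 t \<omega>) / t - l\<bar> \<le> D (?k t) \<omega> + 2 * D (Suc (?k t)) \<omega> + l / real (?k t)"
    using super fin_t
  proof eventually_elim
    case (elim \<omega>)
    have "enn2real (W 0 s \<omega>) \<le> enn2real (W 0 t \<omega>)" if "0 \<le> s" "s \<le> t" for s t
      using elim(2)[rule_format, of t] that by (intro enn2real_mono mono[OF elim(1)]) auto
    then show ?case unfolding D_def using l by (intro allI impI abs_diff_le_integer_times)
  qed
  have l_lim: "((\<lambda>t. l / real (?k t)) \<longlongrightarrow> 0) at_top"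
    by (rule filterlim_compose[OF lim_const_over_n filterlim_nat_floor])
  have "AE \<omega> in M. ((\<lambda>t. enn2real (W 0 t \<omega>) / t) \<longlongrightarrow> l) at_top"
    using bound D_lim
  proof eventually_elim
    case (elim \<omega>)
    have 1: "((\<lambda>t. D (?k t) \<omega>) \<longlongrightarrow> 0) at_top"
      by (rule filterlim_compose[OF elim(2) filterlim_nat_floor])
    have 2: "((\<lambda>t. D (Suc (?k t)) \<omega>) \<longlongrightarrow> 0) at_top"
      by (rule filterlim_compose[OF LIMSEQ_Suc[OF elim(2)] filterlim_nat_floor])
    have "((\<lambda>t. D (?k t) \<omega> + 2 * D (Suc (?k t)) \<omega> + l / real (?k t)) \<longlongrightarrow> 0 + 2 * 0 + 0) at_top"
      by (intro tendsto_intros 1 2 l_lim)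
    then have 3: "((\<lambda>t. D (?k t) \<omega> + 2 * D (Suc (?k t)) \<omega> + l / real (?k t)) \<longlongrightarrow> 0) at_top" by simp
    have "eventually (\<lambda>t. norm (enn2real (W 0 t \<omega>) / t - l) \<le> D (?k t) \<omega> + 2 * D (Suc (?k t)) \<omega> + l / real (?k t)) at_top"
      using eventually_ge_at_top[of 1] by eventually_elim (use elim(1) in simp)
    from this 3 have "((\<lambda>t. enn2real (W 0 t \<omega>) / t - l) \<longlongrightarrow> 0) at_top"
      by (rule Lim_null_comparison)
    then show ?case by (rule LIM_zero_cancel)
  qed
  moreover have "((\<lambda>t. \<integral>\<^sup>+\<omega>. ennreal \<bar>enn2real (W 0 t \<omega>) / t - l\<bar> \<partial>M) \<longlongrightarrow> 0) at_top"
  proof (rule tendsto_sandwich[OF _ _ tendsto_const])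
    let ?E = "\<lambda>n. \<integral>\<^sup>+\<omega>. ennreal (D n \<omega>) \<partial>M"
    have 1: "((\<lambda>t. ?E (?k t)) \<longlongrightarrow> 0) at_top"
      by (rule filterlim_compose[OF D_int filterlim_nat_floor])
    have 2: "((\<lambda>t. ?E (Suc (?k t))) \<longlongrightarrow> 0) at_top"
      by (rule filterlim_compose[OF LIMSEQ_Suc[OF D_int] filterlim_nat_floor])
    have "((\<lambda>t. ?E (?k t) + 2 * ?E (Suc (?k t)) + ennreal (l / real (?k t))) \<longlongrightarrow> 0 + 2 * 0 + ennreal 0) at_top"
      by (intro tendsto_add tendsto_mult_ennreal tendsto_const tendsto_ennrealI 1 2 l_lim) auto
    then show "((\<lambda>t. ?E (?k t) + 2 * ?E (Suc (?k t)) + ennreal (l / real (?k t))) \<longlongrightarrow> 0) at_top" by simp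
    show "eventually (\<lambda>t. (\<integral>\<^sup>+\<omega>. ennreal \<bar>enn2real (W 0 t \<omega>) / t - l\<bar> \<partial>M)
        \<le> ?E (?k t) + 2 * ?E (Suc (?k t)) + ennreal (l / real (?k t))) at_top"
      using eventually_ge_at_top[of 1]
    proof eventually_elim
      case (elim t)
      have "(\<integral>\<^sup>+\<omega>. ennreal \<bar>enn2real (W 0 t \<omega>) / t - l\<bar> \<partial>M)
          \<le> (\<integral>\<^sup>+\<omega>. ennreal (D (?k t) \<omega>) + 2 * ennreal (D (Suc (?k t)) \<omega>) + ennreal (l / real (?k t)) \<partial>M)"
      \<comment> \<open>For non-integer \<open>t\<close> the left integrand is not known to be
        measurable here; monotonicity of \<open>nn_integral\<close> holds all the same.\<close>
      proof (rule nn_integral_mono_AE)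
        show "AE \<omega> in M. ennreal \<bar>enn2real (W 0 t \<omega>) / t - l\<bar>
            \<le> ennreal (D (?k t) \<omega>) + 2 * ennreal (D (Suc (?k t)) \<omega>) + ennreal (l / real (?k t))"
          using bound
        proof eventually_elim
          case (elim \<omega>)
          have nn: "D n \<omega> \<ge> 0" for n by (simp add: D_def)
          have "ennreal (D (?k t) \<omega>) + 2 * ennreal (D (Suc (?k t)) \<omega>) + ennreal (l / real (?k t))
              = ennreal (D (?k t) \<omega> + 2 * D (Suc (?k t)) \<omega> + l / real (?k t))"
            using nn l by (simp add: ennreal_plus ennreal_mult)
          then show ?case using elim \<open>t \<ge> 1\<close> by (simp only:) (intro ennreal_leI, blast)
        qed
      qed
      also have "\<dots> = ?E (?k t) + 2 * ?E (Suc (?k t)) + ennreal (l / real (?k t))"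
        by (simp add: nn_integral_add nn_integral_cmult emeasure_space_1)
      finally show ?case .
    qed
  qed simp
  ultimately show ?thesis using fin_t by (intro exI[of _ l] conjI) auto
qed

end

section \<open>The Markov property of the walk\<close>

definition jump_law :: "(real \<times> (int ^ 'd)) measure" where
  "jump_law = density lborel (\<lambda>r. ennreal (exponential_density 1 r))
     \<Otimes>\<^sub>M measure_pmf (pmf_of_set unit_steps)"

lemma walk_space_eq: "walk_space = PiM UNIV (\<lambda>_. jump_law)"
  by (simp add: walk_space_def jump_law_def)

abbreviation exp_law :: "real measure" where
  "exp_law \<equiv> density lborel (\<lambda>r. ennreal (exponential_density 1 r))"

interpretation exp_law: prob_space exp_law
  by (rule prob_space_exponential_density) simp

lemma prob_space_jump_law: "prob_space jump_law"
proof -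
  interpret pair_prob_space exp_law "measure_pmf (pmf_of_set unit_steps)" ..
  show ?thesis unfolding jump_law_def by unfold_locales
qed

interpretation jump_law: prob_space jump_law
  by (rule prob_space_jump_law)

interpretation jumps: sequence_space jump_law
  by unfold_locales

interpretation walk_space: prob_space walk_space
  unfolding walk_space_eq by unfold_locales

lemma measurable_fst_jump_law[measurable]: "fst \<in> borel_measurable jump_law"
  unfolding jump_law_def by (rule measurable_compose[OF measurable_fst]) simp

lemma measurable_snd_jump_law[measurable]: "snd \<in> measurable jump_law (count_space UNIV)"
  unfolding jump_law_def by (rule measurable_compose[OF measurable_snd]) simp

lemma measurable_jump[measurable]: "(\<lambda>w. w j) \<in> measurable walk_space jump_law"
  unfolding walk_space_eq by (rule measurable_component_singleton) simp

lemma nn_integral_exp_law: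
  assumes [measurable]: "g \<in> borel_measurable borel"
  shows "(\<integral>\<^sup>+\<tau>. g \<tau> \<partial>exp_law) = (\<integral>\<^sup>+\<tau>. ennreal (exp (- \<tau>)) * indicator {0..} \<tau> * g \<tau> \<partial>lborel)"
  by (subst nn_integral_density)
     (auto intro!: nn_integral_cong simp: exponential_density_def indicator_def)

lemma exp_law_memoryless:
  assumes [measurable]: "g \<in> borel_measurable borel" and c: "c \<ge> 0"
  shows "(\<integral>\<^sup>+\<tau>. indicator {c<..} \<tau> * g \<tau> \<partial>exp_law) = ennreal (exp (- c)) * (\<integral>\<^sup>+\<tau>. g (c + \<tau>) \<partial>exp_law)"
proof -
  have "(\<integral>\<^sup>+\<tau>. indicator {c<..} \<tau> * g \<tau> \<partial>exp_law)
      = (\<integral>\<^sup>+\<tau>. ennreal (exp (- \<tau>)) * indicator {0..} \<tau> * (indicator {c<..} \<tau> * g \<tau>) \<partial>lborel)"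
    by (rule nn_integral_exp_law) simp
  also have "\<dots> = (\<integral>\<^sup>+\<tau>. ennreal (exp (- (c + \<tau>))) * indicator {0..} (c + \<tau>) * (indicator {c<..} (c + \<tau>) * g (c + \<tau>)) \<partial>lborel)"
    by (subst nn_integral_real_affine[where c=1 and t=c]) auto
  also have "\<dots> = (\<integral>\<^sup>+\<tau>. ennreal (exp (- c)) * (ennreal (exp (- \<tau>)) * indicator {0..} \<tau> * g (c + \<tau>)) \<partial>lborel)"
  proof (rule nn_integral_cong_AE)
    \<comment> \<open>After the substitution the two indicators disagree only at
      \<open>\<tau> = 0\<close>, where one interval is open and the other closed.\<close>
    have "AE \<tau> in lborel. \<tau> \<noteq> (0::real)" by (rule AE_lborel_singleton)
    then show "AE \<tau> in lborel. ennreal (exp (- (c + \<tau>))) * indicator {0..} (c + \<tau>) * (indicator {c<..} (c + \<tau>) * g (c + \<tau>))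
        = ennreal (exp (- c)) * (ennreal (exp (- \<tau>)) * indicator {0..} \<tau> * g (c + \<tau>))"
    proof eventually_elim
      case (elim \<tau>)
      have "ennreal (exp (- (c + \<tau>))) = ennreal (exp (- c)) * ennreal (exp (- \<tau>))"
        by (simp add: ennreal_mult[symmetric] exp_add[symmetric])
      then show ?case using c elim by (auto simp: indicator_def mult.assoc)
    qed
  qed
  also have "\<dots> = ennreal (exp (- c)) * (\<integral>\<^sup>+\<tau>. ennreal (exp (- \<tau>)) * indicator {0..} \<tau> * g (c + \<tau>) \<partial>lborel)"
    by (rule nn_integral_cmult) measurable
  also have "(\<integral>\<^sup>+\<tau>. ennreal (exp (- \<tau>)) * indicator {0..} \<tau> * g (c + \<tau>) \<partial>lborel) = (\<integral>\<^sup>+\<tau>. g (c + \<tau>) \<partial>exp_law)"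
    by (rule nn_integral_exp_law[symmetric]) measurable
  finally show ?thesis .
qed

lemma exp_law_tail: "c \<ge> 0 \<Longrightarrow> (\<integral>\<^sup>+\<tau>. indicator {c<..} \<tau> \<partial>exp_law) = ennreal (exp (- c))"
  using exp_law_memoryless[of "\<lambda>_. 1" c] exp_law.emeasure_space_1 by simp

lemma jump_law_tail:
  assumes c: "c \<ge> 0"
  shows "(\<integral>\<^sup>+j. indicator {c<..} (fst j) \<partial>(jump_law :: (real \<times> (int ^ 'd)) measure)) = ennreal (exp (- c))"
  unfolding jump_law_def exp_law_tail[OF c, symmetric]
  by (subst measure_pmf.nn_integral_fst[symmetric]) (auto simp: measure_pmf.emeasure_space_1)

text \<open>Only the holding time is conditioned, so the step stays independent of its remainder.
  The tail probability is left as an integral, which lets \<open>nn_integral_glue\<close> turn it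
  back into an event.\<close>

lemma jump_law_memoryless:
  fixes h :: "real \<times> (int ^ 'd) \<Rightarrow> ennreal"
  assumes h[measurable]: "h \<in> borel_measurable jump_law" and c: "c \<ge> 0"
  shows "(\<integral>\<^sup>+j. indicator {c<..} (fst j) * h j \<partial>jump_law)
    = (\<integral>\<^sup>+j. indicator {c<..} (fst j) \<partial>(jump_law :: (real \<times> (int ^ 'd)) measure)) * (\<integral>\<^sup>+j. h (c + fst j, snd j) \<partial>jump_law)"
proof -
  let ?E = "measure_pmf (pmf_of_set (unit_steps :: (int ^ 'd) set))"
  have h'[measurable]: "h \<in> borel_measurable (exp_law \<Otimes>\<^sub>M ?E)" using h by (simp add: jump_law_def)
  have sets_eq[measurable_cong]: "sets (exp_law \<Otimes>\<^sub>M ?E) = sets (borel \<Otimes>\<^sub>M count_space UNIV)"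
    by (intro sets_pair_measure_cong) auto
  have h''[measurable]: "h \<in> borel_measurable (borel \<Otimes>\<^sub>M count_space UNIV)"
    using h' by (simp add: measurable_cong_sets[OF sets_eq refl])
  define g where "g \<tau> = (\<integral>\<^sup>+e. h (\<tau>, e) \<partial>?E)" for \<tau>
  have [measurable]: "g \<in> borel_measurable borel" unfolding g_def by measurable
  have "(\<integral>\<^sup>+j. indicator {c<..} (fst j) * h j \<partial>jump_law)
      = (\<integral>\<^sup>+\<tau>. (\<integral>\<^sup>+e. indicator {c<..} \<tau> * h (\<tau>, e) \<partial>?E) \<partial>exp_law)"
    unfolding jump_law_def by (subst measure_pmf.nn_integral_fst[symmetric]) auto
  also have "\<dots> = (\<integral>\<^sup>+\<tau>. indicator {c<..} \<tau> * g \<tau> \<partial>exp_law)"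
    unfolding g_def by (intro nn_integral_cong nn_integral_cmult) measurable
  also have "\<dots> = ennreal (exp (- c)) * (\<integral>\<^sup>+\<tau>. g (c + \<tau>) \<partial>exp_law)"
    by (rule exp_law_memoryless[OF _ c]) simp
  also have "(\<integral>\<^sup>+\<tau>. g (c + \<tau>) \<partial>exp_law) = (\<integral>\<^sup>+j. h (c + fst j, snd j) \<partial>jump_law)"
    unfolding g_def jump_law_def by (subst measure_pmf.nn_integral_fst[symmetric]) auto
  finally show ?thesis unfolding jump_law_tail[OF c] .
qed

text \<open>Times are measured by the unit rate clock; physical time \<open>s\<close> corresponds to
  clock time \<open>2 * CARD('d) * \<kappa> * s\<close>.\<close>

definition jump_time :: "(nat \<Rightarrow> real \<times> (int ^ 'd)) \<Rightarrow> nat \<Rightarrow> real" where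
  "jump_time w n = (\<Sum>j<n. fst (w j))"

lemma jump_time_0[simp]: "jump_time w 0 = 0"
  and jump_time_Suc: "jump_time w (Suc n) = jump_time w n + fst (w n)"
  by (simp_all add: jump_time_def)

lemma measurable_jump_time[measurable]: "(\<lambda>w. jump_time w n) \<in> borel_measurable walk_space"
  unfolding jump_time_def by measurable

lemma nn_integral_walk_space_split:
  fixes f :: "(nat \<Rightarrow> real \<times> (int ^ 'd)) \<Rightarrow> ennreal"
  assumes f[measurable]: "f \<in> borel_measurable walk_space"
  shows "(\<integral>\<^sup>+w. f w \<partial>walk_space) = (\<integral>\<^sup>+j. (\<integral>\<^sup>+v. f (case_nat j v) \<partial>walk_space) \<partial>jump_law)"
proof -
  interpret P: pair_sigma_finite jump_law "walk_space :: (nat \<Rightarrow> real \<times> (int ^ 'd)) measure" ..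
  have meas[measurable]: "(\<lambda>(j, v). case_nat j v) \<in> measurable (jump_law \<Otimes>\<^sub>M walk_space) walk_space"
    unfolding walk_space_eq by measurable
  have "(\<integral>\<^sup>+w. f w \<partial>walk_space) = (\<integral>\<^sup>+w. f w \<partial>distr (jump_law \<Otimes>\<^sub>M walk_space) walk_space (\<lambda>(j, v). case_nat j v))"
    by (simp only: walk_space_eq jumps.PiM_iter)
  also have "\<dots> = (\<integral>\<^sup>+(j, v). f (case_nat j v) \<partial>(jump_law \<Otimes>\<^sub>M walk_space))"
    by (subst nn_integral_distr) (auto simp: split_beta')
  also have "\<dots> = (\<integral>\<^sup>+j. (\<integral>\<^sup>+v. f (case_nat j v) \<partial>walk_space) \<partial>jump_law)"
    by (subst walk_space.nn_integral_fst[symmetric]) auto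
  finally show ?thesis .
qed

lemma nn_integral_walk_space_comb:
  fixes f :: "(nat \<Rightarrow> real \<times> (int ^ 'd)) \<Rightarrow> ennreal"
  assumes f[measurable]: "f \<in> borel_measurable walk_space"
  shows "(\<integral>\<^sup>+w. f w \<partial>walk_space) = (\<integral>\<^sup>+w. (\<integral>\<^sup>+v. f (comb_seq n w v) \<partial>walk_space) \<partial>walk_space)"
proof -
  interpret P: pair_sigma_finite "walk_space :: (nat \<Rightarrow> real \<times> (int ^ 'd)) measure" walk_space ..
  have meas[measurable]: "(\<lambda>(w, v). comb_seq n w v) \<in> measurable (walk_space \<Otimes>\<^sub>M walk_space) walk_space"
    unfolding walk_space_eq by (rule measurable_comb_seq)
  have "(\<integral>\<^sup>+w. f w \<partial>walk_space) = (\<integral>\<^sup>+w. f w \<partial>distr (walk_space \<Otimes>\<^sub>M walk_space) walk_space (\<lambda>(w, v). comb_seq n w v))"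
    by (simp only: walk_space_eq jumps.PiM_comb_seq)
  also have "\<dots> = (\<integral>\<^sup>+(w, v). f (comb_seq n w v) \<partial>(walk_space \<Otimes>\<^sub>M walk_space))"
    by (subst nn_integral_distr) (auto simp: split_beta')
  also have "\<dots> = (\<integral>\<^sup>+w. (\<integral>\<^sup>+v. f (comb_seq n w v) \<partial>walk_space) \<partial>walk_space)"
    by (subst walk_space.nn_integral_fst[symmetric]) auto
  finally show ?thesis .
qed

text \<open>\<open>glue A n w v\<close> follows \<open>w\<close> up to time \<open>A\<close>, by which \<open>n\<close> jumps have occurred, and is
  restarted as \<open>v\<close> at time \<open>A\<close>.\<close>

definition glue :: "real \<Rightarrow> nat \<Rightarrow> (nat \<Rightarrow> real \<times> (int ^ 'd)) \<Rightarrow> (nat \<Rightarrow> real \<times> (int ^ 'd)) \<Rightarrow> (nat \<Rightarrow> real \<times> (int ^ 'd))" where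
  "glue A n w v = comb_seq n w (case_nat (A - jump_time w n + fst (v 0), snd (v 0)) (\<lambda>j. v (Suc j)))"

text \<open>On nonexplosive samples this is the event of exactly \<open>n\<close> jumps by clock
  time \<open>A\<close>. Stated through two jump times it is measurable at once and involves no
  cardinality.\<close>

definition in_jump_interval :: "real \<Rightarrow> nat \<Rightarrow> (nat \<Rightarrow> real \<times> (int ^ 'd)) \<Rightarrow> bool" where
  "in_jump_interval A n w \<longleftrightarrow> jump_time w n \<le> A \<and> A < jump_time w (Suc n)"

lemma measurable_in_jump_interval[measurable]: "Measurable.pred walk_space (in_jump_interval A n)"
  unfolding in_jump_interval_def[abs_def] pred_def by measurable

lemma measurable_Pair_jump_law:
  assumes "f \<in> borel_measurable N" "g \<in> measurable N (count_space UNIV)"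
  shows "(\<lambda>x. (f x, g x)) \<in> measurable N jump_law"
  using assms unfolding jump_law_def by (intro measurable_Pair) auto

lemma measurable_walk_spaceI:
  assumes "\<And>j. (\<lambda>x. f x j) \<in> measurable N jump_law"
  shows "f \<in> measurable N walk_space"
  unfolding walk_space_eq using assms by (intro measurable_PiM_single') (auto intro: measurable_space[OF assms])

lemma glue_apply: "glue A n w v j = (if j < n then w j
    else if j = n then (A - jump_time w n + fst (v 0), snd (v 0)) else v (j - n))"
  by (auto simp: glue_def comb_seq_def split: nat.split)

lemma measurable_glue[measurable]:
  "(\<lambda>x. glue A n (fst x) (snd x)) \<in> measurable (walk_space \<Otimes>\<^sub>M walk_space) walk_space"
  by (rule measurable_walk_spaceI, unfold glue_apply)
     (intro measurable_If measurable_Pair_jump_law, measurable)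

lemma jump_time_comb_seq: "m \<le> n \<Longrightarrow> jump_time (comb_seq n w v) m = jump_time w m"
  unfolding jump_time_def by (intro sum.cong) (auto simp: comb_seq_less)

text \<open>The Markov property at clock time \<open>A\<close>, on the event of \<open>n\<close>
  jumps so far. Given the first \<open>n\<close> pairs, with the last jump not after
  \<open>A\<close>, the event says that the next holding time exceeds
  \<open>A - jump_time w n\<close>. By memorylessness its remainder is a fresh exponential time, so
  the future may be replaced by an independent sample \<open>v\<close>.\<close>

lemma nn_integral_glue:
  fixes H :: "(nat \<Rightarrow> real \<times> (int ^ 'd)) \<Rightarrow> ennreal"
  assumes H[measurable]: "H \<in> borel_measurable walk_space"
  shows "(\<integral>\<^sup>+w. (if in_jump_interval A n w then H w else 0) \<partial>walk_space)
    = (\<integral>\<^sup>+w. (\<integral>\<^sup>+v. (if in_jump_interval A n w then H (glue A n w v) else 0) \<partial>walk_space) \<partial>walk_space)"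
proof -
  interpret P: pair_sigma_finite "walk_space :: (nat \<Rightarrow> real \<times> (int ^ 'd)) measure" walk_space ..
  have comb_meas[measurable]: "(\<lambda>(w, v). comb_seq n w v) \<in> measurable (walk_space \<Otimes>\<^sub>M walk_space) walk_space"
    unfolding walk_space_eq by (rule measurable_comb_seq)
  have case_meas[measurable]: "(\<lambda>(j, v). case_nat j v) \<in> measurable (jump_law \<Otimes>\<^sub>M walk_space) walk_space"
    unfolding walk_space_eq by measurable
  have ind: "in_jump_interval A n (comb_seq n w (case_nat j v)) \<longleftrightarrow> jump_time w n \<le> A \<and> A - jump_time w n < fst j" for w j v
    by (auto simp: in_jump_interval_def jump_time_Suc jump_time_comb_seq comb_seq_def)
  let ?Q = "\<lambda>w. (\<integral>\<^sup>+j. indicator {A - jump_time w n<..} (fst j) \<partial>(jump_law :: (real \<times> (int ^ 'd)) measure))"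
  define h where "h w j = (\<integral>\<^sup>+v. H (comb_seq n w (case_nat j v)) \<partial>walk_space)" for w j
  have comb_meas2[measurable]: "(\<lambda>j. comb_seq n w (case_nat (fst j) (snd j))) \<in> measurable (jump_law \<Otimes>\<^sub>M walk_space) walk_space"
    if "w \<in> space walk_space" for w
    using that by measurable
  have h_meas: "h w \<in> borel_measurable jump_law" if [measurable]: "w \<in> space walk_space" for w
    unfolding h_def using that
    by (intro walk_space.borel_measurable_nn_integral) (simp add: case_prod_beta)
  have "(\<integral>\<^sup>+w. (if in_jump_interval A n w then H w else 0) \<partial>walk_space)
     = (\<integral>\<^sup>+w. (\<integral>\<^sup>+v. (if in_jump_interval A n (comb_seq n w v) then H (comb_seq n w v) else 0) \<partial>walk_space) \<partial>walk_space)"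
    by (rule nn_integral_walk_space_comb) measurable
  also have "\<dots> = (\<integral>\<^sup>+w. (if jump_time w n \<le> A then ?Q w * (\<integral>\<^sup>+j. h w (A - jump_time w n + fst j, snd j) \<partial>jump_law) else 0) \<partial>walk_space)"
  proof (rule nn_integral_cong)
    fix w :: "nat \<Rightarrow> real \<times> (int ^ 'd)" assume w[measurable]: "w \<in> space walk_space"
    have "(\<integral>\<^sup>+v. (if in_jump_interval A n (comb_seq n w v) then H (comb_seq n w v) else 0) \<partial>walk_space)
      = (\<integral>\<^sup>+j. (\<integral>\<^sup>+v. (if jump_time w n \<le> A \<and> A - jump_time w n < fst j then H (comb_seq n w (case_nat j v)) else 0) \<partial>walk_space) \<partial>jump_law)"
      by (subst nn_integral_walk_space_split) (simp_all add: ind)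
    also have "\<dots> = (if jump_time w n \<le> A then \<integral>\<^sup>+j. indicator {A - jump_time w n<..} (fst j) * h w j \<partial>jump_law else 0)"
      unfolding h_def by (auto intro!: nn_integral_cong simp: indicator_def)
    also have "\<dots> = (if jump_time w n \<le> A then ?Q w * (\<integral>\<^sup>+j. h w (A - jump_time w n + fst j, snd j) \<partial>jump_law) else 0)"
      using jump_law_memoryless[OF h_meas[OF w], of "A - jump_time w n"] by simp
    finally show "(\<integral>\<^sup>+v. (if in_jump_interval A n (comb_seq n w v) then H (comb_seq n w v) else 0) \<partial>walk_space) = \<dots>" .
  qed
  \<comment> \<open>Here \<open>v\<close> serves only to express the tail probability as an event
    again: by \<open>glue_comb\<close> the glued path is built from the first \<open>n\<close> pairs
    of \<open>w\<close> and from \<open>v'\<close>.\<close>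
  also have "\<dots> = (\<integral>\<^sup>+w. (\<integral>\<^sup>+v. (\<integral>\<^sup>+v'. (if in_jump_interval A n (comb_seq n w v) then H (glue A n (comb_seq n w v) v') else 0) \<partial>walk_space) \<partial>walk_space) \<partial>walk_space)"
  proof (rule nn_integral_cong)
    fix w :: "nat \<Rightarrow> real \<times> (int ^ 'd)" assume w[measurable]: "w \<in> space walk_space"
    have glue_comb: "glue A n (comb_seq n w v) v' = glue A n w v'" for v v'
      by (auto simp: glue_def jump_time_comb_seq comb_seq_def fun_eq_iff)
    have glue_w: "(\<lambda>v'. H (glue A n w v')) \<in> borel_measurable walk_space"
      using measurable_compose[OF measurable_Pair1'[OF w] measurable_compose[OF measurable_glue H]] by simp
    have "(\<integral>\<^sup>+v'. H (glue A n w v') \<partial>walk_space) = (\<integral>\<^sup>+j. h w (A - jump_time w n + fst j, snd j) \<partial>jump_law)"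
      by (subst nn_integral_walk_space_split[OF glue_w]) (simp add: h_def glue_def)
    moreover have "(\<integral>\<^sup>+v. (if in_jump_interval A n (comb_seq n w v) then c else 0) \<partial>walk_space)
        = (if jump_time w n \<le> A then ?Q w * c else 0)" for c
    proof -
      have "(\<integral>\<^sup>+v. (if in_jump_interval A n (comb_seq n w v) then c else 0) \<partial>walk_space)
        = (\<integral>\<^sup>+j. (\<integral>\<^sup>+v. (if jump_time w n \<le> A \<and> A - jump_time w n < fst j then c else 0) \<partial>(walk_space :: (nat \<Rightarrow> real \<times> (int ^ 'd)) measure)) \<partial>(jump_law :: (real \<times> (int ^ 'd)) measure))"
        by (subst nn_integral_walk_space_split) (simp_all add: ind)
      also have "\<dots> = (if jump_time w n \<le> A then \<integral>\<^sup>+j. indicator {A - jump_time w n<..} (fst j) * c \<partial>(jump_law :: (real \<times> (int ^ 'd)) measure) else 0)"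
        by (auto intro!: nn_integral_cong simp: indicator_def walk_space.emeasure_space_1)
      also have "\<dots> = (if jump_time w n \<le> A then ?Q w * c else 0)"
        by (simp add: nn_integral_multc)
      finally show ?thesis .
    qed
    moreover have "(\<integral>\<^sup>+v'. (if in_jump_interval A n (comb_seq n w v) then H (glue A n (comb_seq n w v) v') else 0) \<partial>walk_space)
      = (if in_jump_interval A n (comb_seq n w v) then \<integral>\<^sup>+v'. H (glue A n w v') \<partial>walk_space else 0)" for v
      by (simp add: glue_comb)
    ultimately show "(if jump_time w n \<le> A then ?Q w * (\<integral>\<^sup>+j. h w (A - jump_time w n + fst j, snd j) \<partial>jump_law) else 0)
      = (\<integral>\<^sup>+v. (\<integral>\<^sup>+v'. (if in_jump_interval A n (comb_seq n w v) then H (glue A n (comb_seq n w v) v') else 0) \<partial>walk_space) \<partial>walk_space)"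
      by simp
  qed
  also have "\<dots> = (\<integral>\<^sup>+w. (\<integral>\<^sup>+v'. (if in_jump_interval A n w then H (glue A n w v') else 0) \<partial>walk_space) \<partial>walk_space)"
    by (rule nn_integral_walk_space_comb[symmetric]) measurable
  finally show ?thesis .
qed

text \<open>On these samples the jumps up to any time form a finite initial segment of the indices,
  so \<open>num_jumps\<close> is the true count and not the default cardinality 0 of an infinite
  set.\<close>

definition nonexplosive :: "(nat \<Rightarrow> real \<times> (int ^ 'd)) \<Rightarrow> bool" where
  "nonexplosive w \<longleftrightarrow> (\<forall>j. 0 < fst (w j)) \<and> (\<forall>c. \<exists>n. c < jump_time w n)"

lemma AE_jump_law_pos: "AE j in (jump_law :: (real \<times> (int ^ 'd)) measure). 0 < fst j"
proof -
  have "emeasure jump_law {j \<in> space (jump_law :: (real \<times> (int ^ 'd)) measure). 0 < fst j}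
      = (\<integral>\<^sup>+j. indicator {j \<in> space (jump_law :: (real \<times> (int ^ 'd)) measure). 0 < fst j} j \<partial>jump_law)"
    by (rule nn_integral_indicator[symmetric]) measurable
  also have "\<dots> = (\<integral>\<^sup>+j. indicator {0<..} (fst j) \<partial>(jump_law :: (real \<times> (int ^ 'd)) measure))"
    by (intro nn_integral_cong) (auto simp: indicator_def)
  also have "\<dots> = 1" using jump_law_tail[of 0] by simp
  finally have "jump_law.prob {j \<in> space (jump_law :: (real \<times> (int ^ 'd)) measure). 0 < fst j} = 1"
    by (simp add: measure_def)
  then show ?thesis by (subst (asm) jump_law.prob_Collect_eq_1) auto
qed

text \<open>The product of the two exponentials is half the exponential density of rate 2, which has
  total mass 1.\<close>

lemma nn_integral_exp_minus_jump_law: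
  "(\<integral>\<^sup>+j. ennreal (exp (- fst j)) \<partial>(jump_law :: (real \<times> (int ^ 'd)) measure)) = ennreal (1 / 2)"
proof -
  interpret E2: prob_space "density lborel (\<lambda>r. ennreal (exponential_density 2 r))"
    by (rule prob_space_exponential_density) simp
  have "(\<integral>\<^sup>+j. ennreal (exp (- fst j)) \<partial>(jump_law :: (real \<times> (int ^ 'd)) measure)) = (\<integral>\<^sup>+\<tau>. ennreal (exp (- \<tau>)) \<partial>exp_law)"
    unfolding jump_law_def by (subst measure_pmf.nn_integral_fst[symmetric]) (auto simp: measure_pmf.emeasure_space_1)
  also have "\<dots> = (\<integral>\<^sup>+\<tau>. ennreal (exp (- \<tau>)) * indicator {0..} \<tau> * ennreal (exp (- \<tau>)) \<partial>lborel)"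
    by (rule nn_integral_exp_law) simp
  also have "\<dots> = (\<integral>\<^sup>+\<tau>. ennreal (1 / 2) * ennreal (exponential_density 2 \<tau>) \<partial>lborel)"
  proof (rule nn_integral_cong)
    fix \<tau> :: real
    have "exp (- \<tau>) * exp (- \<tau>) = exp (- \<tau> * 2)" by (simp add: exp_add[symmetric])
    then show "ennreal (exp (- \<tau>)) * indicator {0..} \<tau> * ennreal (exp (- \<tau>)) = ennreal (1 / 2) * ennreal (exponential_density 2 \<tau>)"
      by (auto simp: exponential_density_def indicator_def simp del: ennreal_half simp flip: ennreal_mult)
  qed
  also have "\<dots> = ennreal (1 / 2) * (\<integral>\<^sup>+\<tau>. ennreal (exponential_density 2 \<tau>) \<partial>lborel)"
    by (rule nn_integral_cmult) simp
  also have "(\<integral>\<^sup>+\<tau>. ennreal (exponential_density 2 \<tau>) \<partial>lborel) = 1"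
    using E2.emeasure_space_1 by (simp add: emeasure_density)
  finally show ?thesis by simp
qed

lemma jump_time_case_nat: "jump_time (case_nat j v) (Suc n) = fst j + jump_time v n"
  unfolding jump_time_def by (subst sum.lessThan_Suc_shift) simp

lemma nn_integral_exp_minus_jump_time:
  "(\<integral>\<^sup>+w. ennreal (exp (- jump_time w n)) \<partial>(walk_space :: (nat \<Rightarrow> real \<times> (int ^ 'd)) measure)) = ennreal (1 / 2) ^ n"
proof (induction n)
  case 0
  show ?case by (simp add: walk_space.emeasure_space_1)
next
  case (Suc n)
  have "(\<integral>\<^sup>+w. ennreal (exp (- jump_time w (Suc n))) \<partial>(walk_space :: (nat \<Rightarrow> real \<times> (int ^ 'd)) measure))
    = (\<integral>\<^sup>+j. (\<integral>\<^sup>+v. ennreal (exp (- fst j)) * ennreal (exp (- jump_time v n)) \<partial>(walk_space :: (nat \<Rightarrow> real \<times> (int ^ 'd)) measure)) \<partial>(jump_law :: (real \<times> (int ^ 'd)) measure))"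
    by (subst nn_integral_walk_space_split) (simp_all add: jump_time_case_nat exp_add[symmetric] flip: ennreal_mult)
  also have "\<dots> = (\<integral>\<^sup>+j. ennreal (exp (- fst j)) * ennreal (1 / 2) ^ n \<partial>(jump_law :: (real \<times> (int ^ 'd)) measure))"
    by (subst nn_integral_cmult) (simp_all add: Suc del: ennreal_half)
  also have "\<dots> = ennreal (1 / 2) * ennreal (1 / 2) ^ n"
    by (subst nn_integral_multc) (simp_all add: nn_integral_exp_minus_jump_law del: ennreal_half)
  finally show ?case by simp
qed

text \<open>The means of \<open>exp (- jump_time w n)\<close> decay like \<open>(1 / 2) ^ n\<close>,
  so the infimum over \<open>n\<close> has mean 0 and vanishes almost surely. Hence the jump times
  are unbounded.\<close>

lemma AE_nonexplosive: "AE w in walk_space. nonexplosive (w :: nat \<Rightarrow> real \<times> (int ^ 'd))"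
proof -
  have pos: "AE w in walk_space. \<forall>j. 0 < fst ((w :: nat \<Rightarrow> real \<times> (int ^ 'd)) j)"
    unfolding AE_all_countable walk_space_eq
    by (intro allI AE_PiM_component AE_jump_law_pos prob_space_jump_law) auto
  let ?I = "\<integral>\<^sup>+w. (INF n. ennreal (exp (- jump_time w n))) \<partial>(walk_space :: (nat \<Rightarrow> real \<times> (int ^ 'd)) measure)"
  have "?I \<le> ennreal ((1 / 2) ^ n)" for n
  proof -
    have "?I \<le> (\<integral>\<^sup>+w. ennreal (exp (- jump_time w n)) \<partial>(walk_space :: (nat \<Rightarrow> real \<times> (int ^ 'd)) measure))"
      by (intro nn_integral_mono INF_lower) simp
    then show ?thesis by (simp add: nn_integral_exp_minus_jump_time ennreal_power del: ennreal_half)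
  qed
  moreover have "(\<lambda>n. ennreal ((1 / 2) ^ n)) \<longlonglongrightarrow> ennreal 0"
    by (intro tendsto_ennrealI LIMSEQ_realpow_zero) auto
  ultimately have "?I \<le> 0"
    by (intro tendsto_lowerbound[of _ 0 sequentially]) auto
  then have "AE w in walk_space. (INF n. ennreal (exp (- jump_time (w :: nat \<Rightarrow> real \<times> (int ^ 'd)) n))) = 0"
    by (subst (asm) le_zero_eq, subst (asm) nn_integral_0_iff_AE) auto
  with pos show ?thesis
  proof eventually_elim
    case (elim w)
    have "\<exists>n. c < jump_time w n" for c
    proof -
      have "(INF n. ennreal (exp (- jump_time w n))) < ennreal (exp (- c))"
        unfolding elim(2) by simp
      then obtain n where "ennreal (exp (- jump_time w n)) < ennreal (exp (- c))"
        unfolding INF_less_iff by auto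
      then show ?thesis by (auto simp: ennreal_less_iff)
    qed
    with elim show ?case by (simp add: nonexplosive_def)
  qed
qed

lemma jump_time_mono:
  assumes "\<And>j. 0 < fst (w j)" "m \<le> n"
  shows "jump_time w m \<le> jump_time w n"
  unfolding jump_time_def using assms by (intro sum_mono2) (auto intro: less_imp_le)

lemma in_jump_interval_unique:
  assumes pos: "\<And>j. 0 < fst (w j)" and m: "in_jump_interval c m w"
  shows "jump_time w (Suc i) \<le> c \<longleftrightarrow> i < m"
proof
  assume "jump_time w (Suc i) \<le> c"
  then have "\<not> jump_time w (Suc m) \<le> jump_time w (Suc i)" using m by (auto simp: in_jump_interval_def)
  then show "i < m" using jump_time_mono[of w "Suc m" "Suc i"] pos by (meson Suc_le_mono not_less)
next
  assume "i < m"
  then have "jump_time w (Suc i) \<le> jump_time w m" by (intro jump_time_mono pos) simp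
  then show "jump_time w (Suc i) \<le> c" using m by (auto simp: in_jump_interval_def)
qed

lemma num_jumps_eq:
  fixes w :: "nat \<Rightarrow> real \<times> (int ^ 'd)"
  assumes "\<And>j. 0 < fst (w j)" and "in_jump_interval (2 * real CARD('d) * \<kappa> * s) n w"
  shows "num_jumps \<kappa> w s = n"
proof -
  have "{m. (\<Sum>j\<le>m. fst (w j)) \<le> 2 * real CARD('d) * \<kappa> * s} = {..<n}"
    using in_jump_interval_unique[OF assms] by (auto simp: jump_time_def lessThan_Suc_atMost)
  then show ?thesis by (simp add: num_jumps_def)
qed

lemma nonexplosive_interval:
  assumes w: "nonexplosive w" and c: "c \<ge> 0"
  shows "\<exists>n. in_jump_interval c n w"
proof -
  have ex: "\<exists>n. c < jump_time w n" using w by (simp add: nonexplosive_def)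
  define n where "n = (LEAST n. c < jump_time w n)"
  have *: "c < jump_time w n" unfolding n_def by (rule LeastI_ex[OF ex])
  have "n \<noteq> 0"
  proof
    assume "n = 0"
    with * c show False by simp
  qed
  then obtain m where m: "n = Suc m" by (cases n) auto
  have "m < (LEAST n. c < jump_time w n)" using m unfolding n_def by simp
  then have "\<not> c < jump_time w m" by (rule not_less_Least)
  then have "in_jump_interval c m w" using * m by (simp add: in_jump_interval_def)
  then show ?thesis by blast
qed

lemma in_jump_interval_iff:
  fixes w :: "nat \<Rightarrow> real \<times> (int ^ 'd)"
  assumes w: "nonexplosive w" and "\<kappa> \<ge> 0" "s \<ge> 0"
  shows "in_jump_interval (2 * real CARD('d) * \<kappa> * s) n w \<longleftrightarrow> num_jumps \<kappa> w s = n"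
proof -
  obtain m where m: "in_jump_interval (2 * real CARD('d) * \<kappa> * s) m w"
    using nonexplosive_interval[OF w, of "2 * real CARD('d) * \<kappa> * s"] assms by auto
  have pos: "0 < fst (w j)" for j using w by (simp add: nonexplosive_def)
  show ?thesis
  proof
    assume "num_jumps \<kappa> w s = n"
    with num_jumps_eq[OF pos m] m show "in_jump_interval (2 * real CARD('d) * \<kappa> * s) n w" by simp
  qed (rule num_jumps_eq[OF pos])
qed

lemma num_jumps_mono:
  fixes w :: "nat \<Rightarrow> real \<times> (int ^ 'd)"
  assumes w: "nonexplosive w" and "\<kappa> \<ge> 0" "0 \<le> r" "r \<le> s"
  shows "num_jumps \<kappa> w r \<le> num_jumps \<kappa> w s"
proof -
  let ?m = "num_jumps \<kappa> w r" and ?n = "num_jumps \<kappa> w s"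
  have r: "in_jump_interval (2 * real CARD('d) * \<kappa> * r) ?m w"
    and s: "in_jump_interval (2 * real CARD('d) * \<kappa> * s) ?n w"
    using assms by (simp_all add: in_jump_interval_iff)
  have pos: "0 < fst (w j)" for j using w by (simp add: nonexplosive_def)
  have "2 * real CARD('d) * \<kappa> * r \<le> 2 * real CARD('d) * \<kappa> * s" using assms by (intro mult_left_mono) auto
  then have le: "jump_time w ?m \<le> 2 * real CARD('d) * \<kappa> * s"
    using r unfolding in_jump_interval_def by linarith
  show ?thesis
  proof (rule ccontr)
    assume "\<not> ?thesis"
    then have "jump_time w (Suc ?n) \<le> jump_time w ?m" by (intro jump_time_mono pos) simp
    with le have "jump_time w (Suc ?n) \<le> 2 * real CARD('d) * \<kappa> * s" by (rule order.trans[rotated])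
    then show False using in_jump_interval_unique[OF pos s, of ?n] by simp
  qed
qed

lemma jump_time_glue_le: "m \<le> n \<Longrightarrow> jump_time (glue A n w v) m = jump_time w m"
  by (simp add: glue_def jump_time_comb_seq)

text \<open>The index begins at \<open>n + 1\<close> because the pair at index \<open>n\<close> is
  the first one that involves \<open>v\<close>; at index \<open>n\<close> itself the value is
  \<open>jump_time w n\<close> and not \<open>A\<close>.\<close>

lemma jump_time_glue_add: "jump_time (glue A n w v) (n + Suc m) = A + jump_time v (Suc m)"
proof (induction m)
  case 0
  have "fst (glue A n w v n) = A - jump_time w n + fst (v 0)" by (subst glue_apply) simp
  then show ?case by (simp add: jump_time_Suc jump_time_glue_le)
next
  case (Suc m)
  have *: "glue A n w v (n + Suc m) = v (Suc m)" by (subst glue_apply) simp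
  have "jump_time (glue A n w v) (n + Suc (Suc m))
      = jump_time (glue A n w v) (n + Suc m) + fst (glue A n w v (n + Suc m))"
    by (simp only: add_Suc_right jump_time_Suc)
  also have "\<dots> = A + jump_time v (Suc m) + fst (v (Suc m))" by (simp only: Suc *)
  finally show ?case by (simp only: jump_time_Suc[of v "Suc m"] add.assoc)
qed

lemma nonexplosive_glue:
  assumes w: "nonexplosive w" and v: "nonexplosive v" and n: "in_jump_interval A n w"
  shows "nonexplosive (glue A n w v)"
  unfolding nonexplosive_def
proof (intro conjI allI)
  fix j show "0 < fst (glue A n w v j)"
    using w v n by (auto simp: glue_apply nonexplosive_def in_jump_interval_def intro: add_nonneg_pos)
next
  fix c
  obtain m where m: "max 0 (c - A) < jump_time v m" using v unfolding nonexplosive_def by blast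
  then obtain m' where "m = Suc m'" by (cases m) auto
  then have "c < jump_time (glue A n w v) (n + Suc m')" unfolding jump_time_glue_add using m by simp
  then show "\<exists>n'. c < jump_time (glue A n w v) n'" by blast
qed

text \<open>Up to time \<open>a\<close> at most \<open>n\<close> jumps occur, all taken from
  \<open>w\<close>; the next jump of the glued path falls strictly after \<open>a\<close>, because
  the holding times of \<open>v\<close> are positive.\<close>

lemma walk_glue_before:
  fixes w v :: "nat \<Rightarrow> real \<times> (int ^ 'd)"
  assumes w: "nonexplosive w" and v: "nonexplosive v" and \<kappa>: "\<kappa> \<ge> 0" and r: "0 \<le> r" "r \<le> a"
    and n: "in_jump_interval (2 * real CARD('d) * \<kappa> * a) n w"
  shows "walk \<kappa> (glue (2 * real CARD('d) * \<kappa> * a) n w v) r = walk \<kappa> w r"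
proof -
  let ?A = "2 * real CARD('d) * \<kappa> * a" and ?c = "2 * real CARD('d) * \<kappa> * r"
  let ?z = "glue ?A n w v"
  have z: "nonexplosive ?z" by (rule nonexplosive_glue[OF w v n])
  have c: "?c \<le> ?A" using \<kappa> r by (intro mult_left_mono) auto
  define m where "m = num_jumps \<kappa> w r"
  have m: "in_jump_interval ?c m w" using w \<kappa> r by (simp add: in_jump_interval_iff m_def)
  have mn: "m \<le> n"
    using num_jumps_mono[OF w \<kappa> r] in_jump_interval_iff[OF w \<kappa>, of a n] n r by (simp add: m_def)
  have "?c < jump_time ?z (Suc m)"
  proof (cases "m = n")
    case True
    have "0 < fst (v 0)" using v by (simp add: nonexplosive_def)
    then have "?A < jump_time ?z (n + Suc 0)" unfolding jump_time_glue_add by (simp add: jump_time_Suc)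
    then have "?A < jump_time ?z (Suc m)" unfolding True by simp
    with c show ?thesis by (rule le_less_trans)
  next
    case False
    then have "jump_time ?z (Suc m) = jump_time w (Suc m)" using mn by (intro jump_time_glue_le) simp
    with m show ?thesis by (simp add: in_jump_interval_def)
  qed
  then have "in_jump_interval ?c m ?z"
    using m mn by (simp add: in_jump_interval_def jump_time_glue_le)
  then have "num_jumps \<kappa> ?z r = m" using z \<kappa> r by (simp add: in_jump_interval_iff)
  then show ?thesis unfolding walk_def m_def[symmetric]
    using mn by (intro sum.cong) (auto simp: glue_apply)
qed

lemma walk_glue_after:
  fixes w v :: "nat \<Rightarrow> real \<times> (int ^ 'd)"
  assumes w: "nonexplosive w" and v: "nonexplosive v" and \<kappa>: "\<kappa> \<ge> 0" and r: "0 \<le> r" and a: "0 \<le> a"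
    and n: "in_jump_interval (2 * real CARD('d) * \<kappa> * a) n w"
  shows "walk \<kappa> (glue (2 * real CARD('d) * \<kappa> * a) n w v) (a + r) = walk \<kappa> w a + walk \<kappa> v r"
proof -
  let ?A = "2 * real CARD('d) * \<kappa> * a" and ?c = "2 * real CARD('d) * \<kappa> * r"
  let ?z = "glue ?A n w v"
  have z: "nonexplosive ?z" by (rule nonexplosive_glue[OF w v n])
  have c: "2 * real CARD('d) * \<kappa> * (a + r) = ?A + ?c" by (simp add: algebra_simps)
  have c0: "0 \<le> ?c" using \<kappa> r by simp
  define m where "m = num_jumps \<kappa> v r"
  have m: "in_jump_interval ?c m v" using v \<kappa> r by (simp add: in_jump_interval_iff m_def)
  have "jump_time ?z (n + m) \<le> ?A + ?c"
  proof (cases m)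
    \<comment> \<open>Without a jump of \<open>v\<close> the last jump belongs to \<open>w\<close>,
      a case outside the reach of \<open>jump_time_glue_add\<close>.\<close>
    case 0
    then have "jump_time ?z (n + m) = jump_time w n" by (simp add: jump_time_glue_le)
    moreover have "jump_time w n \<le> ?A" using n unfolding in_jump_interval_def by blast
    ultimately show ?thesis using c0 by linarith
  next
    case (Suc m')
    then show ?thesis using m unfolding Suc jump_time_glue_add by (simp add: in_jump_interval_def)
  qed
  moreover have "?A + ?c < jump_time ?z (n + Suc m)"
    unfolding jump_time_glue_add using m by (simp add: in_jump_interval_def)
  ultimately have "num_jumps \<kappa> ?z (a + r) = n + m"
    using in_jump_interval_iff[OF z \<kappa>, of "a + r" "n + m"] a r unfolding c by (simp add: in_jump_interval_def)
  moreover have "num_jumps \<kappa> w a = n" using n w \<kappa> a by (simp add: in_jump_interval_iff)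
  moreover have "(\<Sum>i<n + m. snd (?z i)) = (\<Sum>i<n. snd (w i)) + (\<Sum>i<m. snd (v i))"
  proof -
    have "(\<Sum>i<n + m. f i) = (\<Sum>i<n. f i) + (\<Sum>i<m. f (n + i))" for f :: "nat \<Rightarrow> int ^ 'd"
      by (induction m) (auto simp: add.assoc)
    moreover have "snd (?z (n + i)) = snd (v i)" for i by (subst glue_apply) auto
    moreover have "(\<Sum>i<n. snd (?z i)) = (\<Sum>i<n. snd (w i))"
      by (intro sum.cong) (auto simp: glue_apply)
    ultimately show ?thesis by simp
  qed
  ultimately show ?thesis by (simp add: walk_def m_def)
qed

lemma walk_no_jump:
  fixes w :: "nat \<Rightarrow> real \<times> (int ^ 'd)"
  assumes w: "nonexplosive w" and \<kappa>: "\<kappa> \<ge> 0" and r: "0 \<le> r" "r \<le> t"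
    and jump: "2 * real CARD('d) * \<kappa> * t < fst (w 0)"
  shows "walk \<kappa> w r = 0"
proof -
  have "2 * real CARD('d) * \<kappa> * r \<le> 2 * real CARD('d) * \<kappa> * t" using \<kappa> r by (intro mult_left_mono) auto
  with jump have "2 * real CARD('d) * \<kappa> * r < jump_time w (Suc 0)"
    unfolding jump_time_Suc jump_time_0 by linarith
  then have "in_jump_interval (2 * real CARD('d) * \<kappa> * r) 0 w"
    using \<kappa> r by (simp add: in_jump_interval_def)
  then have "num_jumps \<kappa> w r = 0" using w \<kappa> r by (simp add: in_jump_interval_iff)
  then show ?thesis by (simp add: walk_def)
qed

lemma measurable_add_count_space:
  fixes f g :: "'a \<Rightarrow> 'b::{countable, plus}"
  assumes f: "f \<in> measurable N (count_space UNIV)" and g: "g \<in> measurable N (count_space UNIV)"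
  shows "(\<lambda>x. f x + g x) \<in> measurable N (count_space UNIV)"
proof (rule measurable_compose_countable[OF _ f])
  show "(\<lambda>x. i + g x) \<in> measurable N (count_space UNIV)" for i
    by (rule measurable_compose[OF g]) simp
qed

lemma measurable_walk[measurable]:
  "(\<lambda>x. walk \<kappa> (fst x) (snd x)) \<in> measurable (walk_space \<Otimes>\<^sub>M borel) (count_space (UNIV :: (int ^ 'd) set))"
proof -
  let ?M = "(walk_space :: (nat \<Rightarrow> real \<times> (int ^ 'd)) measure) \<Otimes>\<^sub>M (borel :: real measure)"
  have num: "(\<lambda>x. num_jumps \<kappa> (fst x) (snd x)) \<in> measurable ?M (count_space UNIV)"
    unfolding num_jumps_def
  proof (rule measurable_card)
    fix n
    show "{x \<in> space ?M. n \<in> {n. (\<Sum>j\<le>n. fst (fst x j)) \<le> 2 * real CARD('d) * \<kappa> * snd x}} \<in> sets ?M"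
      unfolding mem_Collect_eq by measurable
  qed
  have sums: "(\<lambda>x. \<Sum>i<n. snd (fst x i)) \<in> measurable ?M (count_space UNIV)" for n
  proof (induction n)
    case (Suc n)
    have "(\<lambda>x. (\<Sum>i<n. snd (fst x i)) + snd (fst x n)) \<in> measurable ?M (count_space UNIV)"
      by (rule measurable_add_count_space[OF Suc]) measurable
    then show ?case by simp
  qed simp
  show ?thesis
    unfolding walk_def by (rule measurable_compose_countable[OF sums num])
qed

lemma measurable_walk_time[measurable]:
  "(\<lambda>w. walk \<kappa> w t) \<in> measurable walk_space (count_space (UNIV :: (int ^ 'd) set))"
proof -
  have "(\<lambda>w. (w, t)) \<in> measurable walk_space (walk_space \<Otimes>\<^sub>M borel)" by simp
  from measurable_compose[OF this measurable_walk] show ?thesis by simp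
qed

section \<open>The Feynman-Kac functional\<close>

lemma set_integral_lborel_split:
  fixes f :: "real \<Rightarrow> real"
  assumes int: "set_integrable lborel {0..a + b} f" and ab: "a \<ge> 0" "b \<ge> 0"
  shows "(LBINT r:{0..a + b}. f r) = (LBINT r:{0..a}. f r) + (LBINT r:{0..b}. f (a + r))"
proof -
  let ?g = "\<lambda>r. indicator {0..a + b} r *\<^sub>R f r"
  have g: "integrable lborel ?g" using int by (simp add: set_integrable_def)
  \<comment> \<open>The left piece is half-open to make the union disjoint; the endpoint is restored
    below as a null set.\<close>
  have "{0..a + b} = {0..<a} \<union> {a..a + b}" using ab by auto
  then have "(LBINT r:{0..a + b}. f r) = (LBINT r:{0..<a}. f r) + (LBINT r:{a..a + b}. f r)"
    using int ab by (simp, intro set_integral_Un) (auto intro: set_integrable_subset)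
  also have "(LBINT r:{0..<a}. f r) = (LBINT r:{0..<a}. ?g r)"
    using ab by (intro set_lebesgue_integral_cong) auto
  also have "\<dots> = (LBINT r:{0..a}. ?g r)"
  proof (rule set_integral_null_delta[OF g])
    have "sym_diff {0..<a} {0..a} \<subseteq> {a}" by auto
    then show "sym_diff {0..<a} {0..a} \<in> null_sets lborel"
      by (intro finite_imp_null_set_lborel) (rule finite_subset, auto)
  qed auto
  also have "\<dots> = (LBINT r:{0..a}. f r)"
    using ab by (intro set_lebesgue_integral_cong) auto
  also have "(LBINT r:{a..a + b}. f r) = (LBINT r. indicator {a..a + b} (a + 1 * r) *\<^sub>R f (a + 1 * r))"
    unfolding set_lebesgue_integral_def by (subst lborel_integral_real_affine[where c=1 and t=a]) auto
  also have "\<dots> = (LBINT r:{0..b}. f (a + r))"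
    unfolding set_lebesgue_integral_def by (intro Bochner_Integration.integral_cong) (auto simp: indicator_def)
  finally show ?thesis .
qed

text \<open>The environment is frozen to a deterministic \<open>e\<close>. The parameter
  \<open>s\<close> is the environment time at which the walk starts, so restarting the walk later
  only changes \<open>s\<close>.\<close>

definition energy :: "(int ^ 'd \<Rightarrow> real \<Rightarrow> real) \<Rightarrow> real \<Rightarrow> (nat \<Rightarrow> real \<times> (int ^ 'd)) \<Rightarrow> real \<Rightarrow> real \<Rightarrow> real" where
  "energy e \<kappa> w s t = (LBINT r:{0..t}. e (walk \<kappa> w r) (s + r))"

definition feynman_kac :: "(int ^ 'd \<Rightarrow> real \<Rightarrow> real) \<Rightarrow> real \<Rightarrow> real \<Rightarrow> real \<Rightarrow> real \<Rightarrow> ennreal" where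
  "feynman_kac e \<kappa> \<gamma> s t =
    (\<integral>\<^sup>+w. ennreal (exp (\<gamma> * energy e \<kappa> w s t)) * (if walk \<kappa> w t = 0 then 1 else 0) \<partial>walk_space)"

locale potential =
  fixes e :: "int ^ 'd \<Rightarrow> real \<Rightarrow> real"
  assumes e_measurable: "\<And>x. e x \<in> borel_measurable borel"
    and e_integrable: "\<And>x t. t \<ge> 0 \<Longrightarrow> set_integrable lborel {0..t} (e x)"
begin

lemma e_integrable_shift:
  assumes "s \<ge> 0" "t \<ge> 0"
  shows "set_integrable lborel {0..t} (\<lambda>r. e x (s + r))"
proof -
  have "set_integrable lborel {s..s + t} (e x)"
    using assms by (intro set_integrable_subset[OF e_integrable[of "s + t" x]]) auto
  then have "integrable lborel (\<lambda>r. indicator {s..s + t} (s + 1 * r) *\<^sub>R e x (s + 1 * r))"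
    unfolding set_integrable_def by (rule lborel_integrable_real_affine) simp
  moreover have "indicator {s..s + t} (s + 1 * r) = (indicator {0..t} r :: real)" for r
    by (auto simp: indicator_def)
  ultimately show ?thesis by (simp add: set_integrable_def)
qed

lemma e_walk_measurable:
  "(\<lambda>x. e (walk \<kappa> (fst x) (snd x)) (s + snd x)) \<in> borel_measurable (walk_space \<Otimes>\<^sub>M borel)"
proof (rule measurable_compose_countable[OF _ measurable_walk])
  show "(\<lambda>x. e y (s + snd x)) \<in> borel_measurable (walk_space \<Otimes>\<^sub>M borel)" for y
    by (rule measurable_compose[OF _ e_measurable]) simp
qed

lemma energy_measurable[measurable]: "(\<lambda>w. energy e \<kappa> w s t) \<in> borel_measurable walk_space"
  unfolding energy_def set_lebesgue_integral_def
proof (rule lborel.borel_measurable_lebesgue_integral)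
  have [measurable]: "(\<lambda>x. e (walk \<kappa> (fst x) (snd x)) (s + snd x)) \<in> borel_measurable (walk_space \<Otimes>\<^sub>M lborel)"
    using e_walk_measurable by (simp add: measurable_cong_sets[OF sets_pair_measure_cong[OF refl sets_lborel] refl])
  show "(\<lambda>(w, r). indicator {0..t} r *\<^sub>R e (walk \<kappa> w r) (s + r)) \<in> borel_measurable (walk_space \<Otimes>\<^sub>M lborel)"
    unfolding split_beta' by measurable
qed

text \<open>Up to time \<open>t\<close> the walk stays in the finite set \<open>X\<close>, so the
  integrand is dominated by a finite sum of integrable functions.\<close>

lemma e_walk_integrable:
  assumes w: "nonexplosive w" and \<kappa>: "\<kappa> \<ge> 0" and "s \<ge> 0" "t \<ge> 0"
  shows "set_integrable lborel {0..t} (\<lambda>r. e (walk \<kappa> w r) (s + r))"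
proof -
  define X where "X = (\<lambda>m. \<Sum>i<m. snd (w i)) ` {..num_jumps \<kappa> w t}"
  have X: "walk \<kappa> w r \<in> X" if "0 \<le> r" "r \<le> t" for r
    using num_jumps_mono[OF w \<kappa> that] by (auto simp: X_def walk_def)
  have [simp]: "finite X" by (simp add: X_def)
  have "integrable lborel (\<lambda>r. \<Sum>x\<in>X. norm (indicator {0..t} r *\<^sub>R e x (s + r)))"
    using e_integrable_shift[of s t] assms by (intro Bochner_Integration.integrable_sum integrable_norm) (auto simp: set_integrable_def)
  then show ?thesis unfolding set_integrable_def
  proof (rule Bochner_Integration.integrable_bound)
    have "(\<lambda>r. walk \<kappa> w r) \<in> measurable borel (count_space (UNIV :: (int ^ 'd) set))"
    proof (cases "w \<in> space (walk_space :: (nat \<Rightarrow> real \<times> (int ^ 'd)) measure)")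
      case True
      then show ?thesis using measurable_compose[OF measurable_Pair1'[OF True] measurable_walk] by simp
    next
      \<comment> \<open>This case is void, since the sample space is the whole type.\<close>
      case False
      then show ?thesis by (simp add: walk_space_eq space_PiM jump_law_def space_pair_measure)
    qed
    then have "(\<lambda>r. e (walk \<kappa> w r) (s + r)) \<in> borel_measurable borel"
      by (rule measurable_compose_countable[rotated]) (rule measurable_compose[OF _ e_measurable], simp)
    then show "(\<lambda>r. indicator {0..t} r *\<^sub>R e (walk \<kappa> w r) (s + r)) \<in> borel_measurable lborel"
      by simp
    show "AE r in lborel. norm (indicator {0..t} r *\<^sub>R e (walk \<kappa> w r) (s + r))
        \<le> norm (\<Sum>x\<in>X. norm (indicator {0..t} r *\<^sub>R e x (s + r)))"
    proof (rule AE_I2)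
      fix r
      show "norm (indicator {0..t} r *\<^sub>R e (walk \<kappa> w r) (s + r)) \<le> norm (\<Sum>x\<in>X. norm (indicator {0..t} r *\<^sub>R e x (s + r)))"
      proof (cases "r \<in> {0..t}")
        case True
        then have "norm (indicator {0..t} r *\<^sub>R e (walk \<kappa> w r) (s + r)) \<le> (\<Sum>x\<in>X. norm (indicator {0..t} r *\<^sub>R e x (s + r)))"
          by (intro member_le_sum X) auto
        then show ?thesis by simp
      qed (simp add: sum_nonneg)
    qed
  qed
qed

text \<open>The return to the origin at time \<open>a\<close> removes the offset
  \<open>walk \<kappa> w a\<close>, so the second stretch of the glued path sees the potential along
  \<open>v\<close> itself.\<close>

lemma energy_glue:
  assumes w: "nonexplosive w" and v: "nonexplosive v" and \<kappa>: "\<kappa> \<ge> 0" and s: "s \<ge> 0" "a \<ge> 0" "b \<ge> 0"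
    and n: "in_jump_interval (2 * real CARD('d) * \<kappa> * a) n w" and ret: "walk \<kappa> w a = 0"
  shows "energy e \<kappa> (glue (2 * real CARD('d) * \<kappa> * a) n w v) s (a + b) = energy e \<kappa> w s a + energy e \<kappa> v (s + a) b"
proof -
  let ?z = "glue (2 * real CARD('d) * \<kappa> * a) n w v"
  have z: "nonexplosive ?z" by (rule nonexplosive_glue[OF w v n])
  have "energy e \<kappa> ?z s (a + b) = (LBINT r:{0..a}. e (walk \<kappa> ?z r) (s + r)) + (LBINT r:{0..b}. e (walk \<kappa> ?z (a + r)) (s + (a + r)))"
    unfolding energy_def using s by (intro set_integral_lborel_split e_walk_integrable[OF z \<kappa>]) auto
  also have "(LBINT r:{0..a}. e (walk \<kappa> ?z r) (s + r)) = energy e \<kappa> w s a"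
    unfolding energy_def by (intro set_lebesgue_integral_cong) (auto simp: walk_glue_before[OF w v \<kappa> _ _ n])
  also have "(LBINT r:{0..b}. e (walk \<kappa> ?z (a + r)) (s + (a + r))) = energy e \<kappa> v (s + a) b"
    unfolding energy_def using ret
    by (intro set_lebesgue_integral_cong) (auto simp: walk_glue_after[OF w v \<kappa> _ s(2) n] add.assoc)
  finally show ?thesis .
qed

text \<open>Of the walks at the origin at time \<open>a + b\<close> only those also there at time
  \<open>a\<close> are kept; on these the exponential weights multiply. The Markov property is
  available for each number \<open>n\<close> of jumps by time \<open>a\<close>, so the integrals are
  split over \<open>n\<close> and summed again.\<close>

lemma feynman_kac_mult_le:
  assumes \<kappa>: "\<kappa> \<ge> 0" and s: "s \<ge> 0" "a \<ge> 0" "b \<ge> 0"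
  shows "feynman_kac e \<kappa> \<gamma> s a * feynman_kac e \<kappa> \<gamma> (s + a) b \<le> feynman_kac e \<kappa> \<gamma> s (a + b)"
proof -
  define f where "f w s t = ennreal (exp (\<gamma> * energy e \<kappa> w s t)) * (if walk \<kappa> w t = 0 then 1 else 0)" for w s t
  have f_meas[measurable]: "(\<lambda>w. f w s t) \<in> borel_measurable walk_space" for s t
    unfolding f_def by measurable
  have FK: "feynman_kac e \<kappa> \<gamma> s t = (\<integral>\<^sup>+w. f w s t \<partial>walk_space)" for s t
    by (simp add: feynman_kac_def f_def)
  let ?A = "2 * real CARD('d) * \<kappa> * a"
  let ?E = "\<lambda>n w. in_jump_interval ?A n (w :: nat \<Rightarrow> real \<times> (int ^ 'd))"
  have partition: "(\<Sum>n. if ?E n w then c else 0) = c" if "nonexplosive w" for w and c :: ennreal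
  proof -
    have "(\<Sum>n. if ?E n w then c else 0) = (\<Sum>n. if n = num_jumps \<kappa> w a then c else 0)"
      using in_jump_interval_iff[OF that \<kappa> s(2)] by (intro suminf_cong) auto
    also have "\<dots> = c" by (rule sums_unique[symmetric, OF sums_single[of "num_jumps \<kappa> w a" "\<lambda>_. c"]])
    finally show ?thesis .
  qed
  have glue_le: "(\<integral>\<^sup>+w. (if ?E n w then f w s a else 0) \<partial>walk_space) * (\<integral>\<^sup>+v. f v (s + a) b \<partial>walk_space)
      \<le> (\<integral>\<^sup>+w. (if ?E n w then f w s (a + b) else 0) \<partial>walk_space)" for n
  proof -
    have "(\<integral>\<^sup>+w. (if ?E n w then f w s a else 0) \<partial>walk_space) * (\<integral>\<^sup>+v. f v (s + a) b \<partial>walk_space)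
        = (\<integral>\<^sup>+w. (\<integral>\<^sup>+v. (if ?E n w then f w s a else 0) * f v (s + a) b \<partial>walk_space) \<partial>walk_space)"
      by (simp add: nn_integral_cmult nn_integral_multc)
    also have "\<dots> \<le> (\<integral>\<^sup>+w. (\<integral>\<^sup>+v. (if ?E n w then f (glue ?A n w v) s (a + b) else 0) \<partial>walk_space) \<partial>walk_space)"
    proof (rule nn_integral_mono_AE)
      show "AE w in walk_space. (\<integral>\<^sup>+v. (if ?E n w then f w s a else 0) * f v (s + a) b \<partial>walk_space)
          \<le> (\<integral>\<^sup>+v. (if ?E n w then f (glue ?A n w v) s (a + b) else 0) \<partial>walk_space)"
        using AE_nonexplosive
      proof eventually_elim
        case w: (elim w)
        show ?case
        proof (rule nn_integral_mono_AE)
          show "AE v in walk_space. (if ?E n w then f w s a else 0) * f v (s + a) b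
              \<le> (if ?E n w then f (glue ?A n w v) s (a + b) else 0)"
            using AE_nonexplosive
          proof eventually_elim
            case v: (elim v)
            show ?case
            proof (cases "?E n w \<and> walk \<kappa> w a = 0 \<and> walk \<kappa> v b = 0")
              case True
              then have "energy e \<kappa> (glue ?A n w v) s (a + b) = energy e \<kappa> w s a + energy e \<kappa> v (s + a) b"
                by (intro energy_glue[OF w v \<kappa> s]) auto
              moreover have "walk \<kappa> (glue ?A n w v) (a + b) = 0"
                using True s by (subst walk_glue_after[OF w v \<kappa>]) auto
              ultimately show ?thesis using True
                by (simp add: f_def distrib_left exp_add ennreal_mult)
            qed (auto simp: f_def)
          qed
        qed
      qed
    qed
    also have "\<dots> = (\<integral>\<^sup>+w. (if ?E n w then f w s (a + b) else 0) \<partial>walk_space)"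
      by (rule nn_integral_glue[symmetric]) measurable
    finally show ?thesis .
  qed
  have sum: "(\<integral>\<^sup>+w. f w s t \<partial>walk_space) = (\<Sum>n. \<integral>\<^sup>+w. (if ?E n w then f w s t else 0) \<partial>walk_space)" for s t
  proof -
    have "(\<integral>\<^sup>+w. f w s t \<partial>walk_space) = (\<integral>\<^sup>+w. (\<Sum>n. if ?E n w then f w s t else 0) \<partial>walk_space)"
      using AE_nonexplosive by (intro nn_integral_cong_AE) (auto elim!: eventually_mono simp: partition)
    also have "\<dots> = (\<Sum>n. \<integral>\<^sup>+w. (if ?E n w then f w s t else 0) \<partial>walk_space)"
      by (rule nn_integral_suminf) measurable
    finally show ?thesis .
  qed
  have "feynman_kac e \<kappa> \<gamma> s a * feynman_kac e \<kappa> \<gamma> (s + a) b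
      = (\<Sum>n. (\<integral>\<^sup>+w. (if ?E n w then f w s a else 0) \<partial>walk_space) * (\<integral>\<^sup>+v. f v (s + a) b \<partial>walk_space))"
    unfolding FK sum[of s a] by simp
  also have "\<dots> \<le> (\<Sum>n. \<integral>\<^sup>+w. (if ?E n w then f w s (a + b) else 0) \<partial>walk_space)"
    by (intro suminf_le glue_le) auto
  also have "\<dots> = feynman_kac e \<kappa> \<gamma> s (a + b)" unfolding FK sum[of s "a + b"] ..
  finally show ?thesis .
qed

text \<open>Only the event that the first holding time exceeds the clock time of \<open>t\<close> is
  kept. The walk then stays at the origin, and the tail of the exponential law gives the first term
  of the exponent.\<close>

lemma feynman_kac_ge:
  assumes \<kappa>: "\<kappa> \<ge> 0" and s: "s \<ge> 0" "t \<ge> 0"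
  shows "ennreal (exp (- (2 * real CARD('d) * \<kappa> * t) + \<gamma> * (LBINT r:{0..t}. e 0 (s + r)))) \<le> feynman_kac e \<kappa> \<gamma> s t"
proof -
  let ?A = "2 * real CARD('d) * \<kappa> * t" and ?I = "LBINT r:{0..t}. e 0 (s + r)"
  have A: "?A \<ge> 0" using \<kappa> s by simp
  have "ennreal (exp (- ?A + \<gamma> * ?I)) = ennreal (exp (\<gamma> * ?I)) * ennreal (exp (- ?A))"
    by (subst ennreal_mult[symmetric]) (simp_all only: exp_ge_zero exp_add mult.commute[of "exp (\<gamma> * ?I)"])
  also have "ennreal (exp (- ?A)) = (\<integral>\<^sup>+w. indicator {?A<..} (fst (w 0)) \<partial>(walk_space :: (nat \<Rightarrow> real \<times> (int ^ 'd)) measure))"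
    by (subst nn_integral_walk_space_split) (simp_all add: jump_law_tail[OF A] walk_space.emeasure_space_1)
  also have "ennreal (exp (\<gamma> * ?I)) * \<dots>
      = (\<integral>\<^sup>+w. ennreal (exp (\<gamma> * ?I)) * indicator {?A<..} (fst (w 0)) \<partial>(walk_space :: (nat \<Rightarrow> real \<times> (int ^ 'd)) measure))"
    by (rule nn_integral_cmult[symmetric]) measurable
  also have "\<dots> \<le> feynman_kac e \<kappa> \<gamma> s t"
    unfolding feynman_kac_def
  proof (rule nn_integral_mono_AE)
    show "AE w in walk_space. ennreal (exp (\<gamma> * ?I)) * indicator {?A<..} (fst (w 0))
        \<le> ennreal (exp (\<gamma> * energy e \<kappa> w s t)) * (if walk \<kappa> w t = 0 then 1 else 0)"
      using AE_nonexplosive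
    proof eventually_elim
      case (elim w)
      show ?case
      proof (cases "?A < fst (w 0)")
        case True
        have 0: "walk \<kappa> w r = 0" if "0 \<le> r" "r \<le> t" for r
          by (rule walk_no_jump[OF elim \<kappa> that True])
        then have "energy e \<kappa> w s t = ?I" unfolding energy_def by (intro set_lebesgue_integral_cong) auto
        with 0[of t] s True show ?thesis by simp
      qed simp
    qed
  qed
  finally show ?thesis .
qed

end

section \<open>Functionals of the environment\<close>

lemma ln_ennreal_measurable[measurable]: "ln_ennreal \<in> borel_measurable borel"
  unfolding ln_ennreal_def[abs_def] by measurable

lemma ln_ennreal_ennreal: "r > 0 \<Longrightarrow> ln_ennreal (ennreal r) = ereal (ln r)"
  by (simp add: ln_ennreal_def)

lemma ln_ennreal_top[simp]: "ln_ennreal \<top> = \<infinity>"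
  by (simp add: ln_ennreal_def)

text \<open>Arguments that are at least 1 have nonnegative logarithms, so \<open>e2ennreal\<close>
  truncates nothing. An infinite \<open>c\<close> is trivial; otherwise all three numbers are
  finite.\<close>

lemma e2ennreal_ln_ennreal_superadditive:
  assumes "1 \<le> a" "1 \<le> b" "a * b \<le> c"
  shows "e2ennreal (ln_ennreal a) + e2ennreal (ln_ennreal b) \<le> e2ennreal (ln_ennreal c)"
proof (cases "c = \<top>")
  case True
  then show ?thesis by simp
next
  case False
  then have "a * b \<noteq> \<top>" using assms(3) by (auto simp: top_unique)
  then have "a \<noteq> \<top>" "b \<noteq> \<top>" using assms(1,2) by (auto simp: ennreal_mult_eq_top_iff)
  then obtain r s t where rst: "a = ennreal r" "b = ennreal s" "c = ennreal t" "r \<ge> 0" "s \<ge> 0" "t \<ge> 0"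
    using False by (cases a; cases b; cases c) auto
  with assms have "1 \<le> r" "1 \<le> s" by (auto simp flip: ennreal_1)
  have "ennreal (r * s) \<le> ennreal t" using assms rst by (simp add: ennreal_mult)
  then have "r * s \<le> t" using rst by (subst (asm) ennreal_le_iff) auto
  moreover have "0 < r * s" using \<open>1 \<le> r\<close> \<open>1 \<le> s\<close> by simp
  ultimately have "ln (r * s) \<le> ln t" by (intro ln_mono) auto
  then have "ennreal (ln r + ln s) \<le> ennreal (ln t)"
    using \<open>1 \<le> r\<close> \<open>1 \<le> s\<close> by (intro ennreal_leI) (simp add: ln_mult)
  moreover have "t > 0" using \<open>0 < r * s\<close> \<open>r * s \<le> t\<close> by linarith
  ultimately show ?thesis
    using \<open>1 \<le> r\<close> \<open>1 \<le> s\<close> rst by (simp add: ln_ennreal_ennreal e2ennreal_ereal ennreal_plus)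
qed

section \<open>Time integrals of the field along a deterministic path\<close>

context stationary_field
begin

definition field_at :: "'w \<Rightarrow> int ^ 'd \<Rightarrow> real \<Rightarrow> real" where
  "field_at \<omega> x t = \<xi> x (max 0 t) \<omega>"

lemma measurable_field_at:
  assumes "f \<in> measurable N M" "g \<in> measurable N (count_space UNIV)" "h \<in> borel_measurable N"
  shows "(\<lambda>n. field_at (f n) (g n) (h n)) \<in> borel_measurable N"
  unfolding field_at_def by (rule measurable_field_compose[OF assms])

lemma is_factor_field_at: "r \<ge> 0 \<Longrightarrow> is_factor (\<lambda>s \<omega>. field_at \<omega> x (s + r))"
  by (rule is_factor_cong_AE[OF is_factor_field[of r x]]) (auto simp: field_at_def max_absorb2)

text \<open>The cases \<open>c = 1\<close> and \<open>c = -1\<close> give the positive and the negative part of the field.\<close>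

definition part_integral :: "real \<Rightarrow> (real \<Rightarrow> int ^ 'd) \<Rightarrow> real \<Rightarrow> real \<Rightarrow> 'w \<Rightarrow> ennreal" where
  "part_integral c y s t \<omega> = (\<integral>\<^sup>+r. indicator {0..t} r * ennreal (c * field_at \<omega> (y r) (s + r)) \<partial>lborel)"

lemma measurable_part_integrand:
  assumes y[measurable]: "y \<in> measurable borel (count_space UNIV)"
  shows "(\<lambda>(\<omega>, r). indicator {0..t} r * ennreal (c * field_at \<omega> (y r) (s + r))) \<in> borel_measurable (M \<Otimes>\<^sub>M lborel)"
proof -
  have [measurable]: "(\<lambda>x. field_at (fst x) (y (snd x)) (s + snd x)) \<in> borel_measurable (M \<Otimes>\<^sub>M lborel)"
    by (rule measurable_field_at) measurable
  show ?thesis unfolding split_beta' by measurable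
qed

lemma measurable_part_integral:
  assumes "y \<in> measurable borel (count_space UNIV)"
  shows "part_integral c y s t \<in> borel_measurable M"
  unfolding part_integral_def[abs_def]
  by (rule lborel.borel_measurable_nn_integral) (rule measurable_part_integrand[OF assms])

text \<open>At each fixed time the integrand is a factor; Lebesgue measure restricted to
  \<open>{0..t}\<close> is the finite measure that \<open>is_factor_nn_integral\<close> asks
  for.\<close>

lemma is_factor_part_integral:
  assumes y: "y \<in> measurable borel (count_space UNIV)"
  shows "is_factor (\<lambda>s. part_integral c y s t)"
proof (rule is_factor_cong_AE)
  define \<mu> where "\<mu> = density lborel (indicator {0..t} :: real \<Rightarrow> ennreal)"
  have \<mu>: "finite_measure \<mu>"
    by (intro finite_measureI) (cases "0 \<le> t"; simp add: \<mu>_def emeasure_density)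
  have meas: "(\<lambda>(r, \<omega>). ennreal (c * field_at \<omega> (y r) (s + r))) \<in> borel_measurable (\<mu> \<Otimes>\<^sub>M M)" for s
  proof -
    have [measurable_cong]: "sets \<mu> = sets borel" by (simp add: \<mu>_def)
    note [measurable] = y
    have [measurable]: "(\<lambda>x. field_at (snd x) (y (fst x)) (s + fst x)) \<in> borel_measurable (\<mu> \<Otimes>\<^sub>M M)"
      by (rule measurable_field_at) measurable
    show ?thesis unfolding split_beta' by measurable
  qed
  show "is_factor (\<lambda>s \<omega>. \<integral>\<^sup>+r. ennreal (c * field_at \<omega> (y r) (s + r)) \<partial>\<mu>)"
  proof (rule is_factor_nn_integral[OF \<mu> meas])
    have "AE r in lborel. indicator {0..t} r \<noteq> (0 :: ennreal) \<longrightarrow> is_factor (\<lambda>s \<omega>. ennreal (c * field_at \<omega> (y r) (s + r)))"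
    proof (rule AE_I2, rule impI)
      fix r assume "indicator {0..t} r \<noteq> (0 :: ennreal)"
      then have "r \<ge> 0" by (auto simp: indicator_def split: if_splits)
      then show "is_factor (\<lambda>s \<omega>. ennreal (c * field_at \<omega> (y r) (s + r)))"
        by (intro is_factor_compose[OF is_factor_field_at, of r "\<lambda>z. ennreal (c * z)"]) auto
    qed
    then show "AE r in \<mu>. is_factor (\<lambda>s \<omega>. ennreal (c * field_at \<omega> (y r) (s + r)))"
      unfolding \<mu>_def by (subst AE_density) (auto elim!: eventually_mono)
  qed
  show "AE \<omega> in M. part_integral c y s t \<omega> = (\<integral>\<^sup>+r. ennreal (c * field_at \<omega> (y r) (s + r)) \<partial>\<mu>)" for s
  proof (rule AE_I2)
    fix \<omega> assume "\<omega> \<in> space M"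
    then have "(\<lambda>r. field_at \<omega> (y r) (s + r)) \<in> borel_measurable borel"
      using y by (intro measurable_field_at) auto
    then show "part_integral c y s t \<omega> = (\<integral>\<^sup>+r. ennreal (c * field_at \<omega> (y r) (s + r)) \<partial>\<mu>)"
      unfolding part_integral_def \<mu>_def by (subst nn_integral_density) auto
  qed
qed

lemma set_integral_eq_part_integral:
  assumes "set_integrable lborel {0..t} (\<lambda>r. field_at \<omega> (y r) (s + r))"
  shows "(LBINT r:{0..t}. field_at \<omega> (y r) (s + r))
    = enn2real (part_integral 1 y s t \<omega>) - enn2real (part_integral (-1) y s t \<omega>)"
proof -
  have "ennreal (indicator {0..t} r *\<^sub>R z) = indicator {0..t} r * ennreal (1 * z)"
    "ennreal (- (indicator {0..t} r *\<^sub>R z)) = indicator {0..t} r * ennreal (- 1 * z)" for r z :: real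
    by (auto simp: indicator_def)
  then show ?thesis
    using assms unfolding set_integrable_def set_lebesgue_integral_def part_integral_def
    by (subst real_lebesgue_integral_def) auto
qed

lemma is_factor_set_integral:
  assumes y: "y \<in> measurable borel (count_space UNIV)"
    and int: "AE \<omega> in M. \<forall>s\<ge>0. set_integrable lborel {0..t} (\<lambda>r. field_at \<omega> (y r) (s + r))"
  shows "is_factor (\<lambda>s \<omega>. LBINT r:{0..t}. field_at \<omega> (y r) (s + r))"
proof (rule is_factor_cong_AE)
  show "is_factor (\<lambda>s \<omega>. (\<lambda>(p, q). enn2real p - enn2real q) (part_integral 1 y s t \<omega>, part_integral (-1) y s t \<omega>))"
    by (rule is_factor_compose[OF is_factor_Pair[OF is_factor_part_integral[OF y] is_factor_part_integral[OF y]]])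
       (simp add: split_beta' borel_prod[symmetric])
  fix s :: real assume s: "s \<ge> 0"
  show "AE \<omega> in M. (LBINT r:{0..t}. field_at \<omega> (y r) (s + r))
      = (\<lambda>(p, q). enn2real p - enn2real q) (part_integral 1 y s t \<omega>, part_integral (-1) y s t \<omega>)"
    using int by eventually_elim (simp add: set_integral_eq_part_integral s)
qed

text \<open>Equality holds, as the two intervals share a single point; the inequality is the form
  that \<open>superadditive_limit\<close> takes.\<close>

lemma part_integral_superadditive:
  assumes \<omega>: "\<omega> \<in> space M" and s: "s \<ge> 0" "a \<ge> 0" "b \<ge> 0"
  shows "part_integral c (\<lambda>_. x) s a \<omega> + part_integral c (\<lambda>_. x) (s + a) b \<omega> \<le> part_integral c (\<lambda>_. x) s (a + b) \<omega>"
proof -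
  have g[measurable]: "(\<lambda>r. field_at \<omega> x (q + r)) \<in> borel_measurable borel" for q
    using \<omega> by (intro measurable_field_at) auto
  have "part_integral c (\<lambda>_. x) s (a + b) \<omega>
      = (\<integral>\<^sup>+r. indicator {0..a} r * ennreal (c * field_at \<omega> x (s + r)) + indicator {a..a + b} r * ennreal (c * field_at \<omega> x (s + r)) \<partial>lborel)"
    unfolding part_integral_def
  proof (rule nn_integral_cong_AE)
    have "AE r in lborel. r \<noteq> a" by (rule AE_lborel_singleton)
    then show "AE r in lborel. indicator {0..a + b} r * ennreal (c * field_at \<omega> x (s + r))
        = indicator {0..a} r * ennreal (c * field_at \<omega> x (s + r)) + indicator {a..a + b} r * ennreal (c * field_at \<omega> x (s + r))"
      by eventually_elim (use s in \<open>auto simp: indicator_def\<close>)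
  qed
  also have "\<dots> = part_integral c (\<lambda>_. x) s a \<omega> + (\<integral>\<^sup>+r. indicator {a..a + b} r * ennreal (c * field_at \<omega> x (s + r)) \<partial>lborel)"
    unfolding part_integral_def by (rule nn_integral_add) measurable
  also have "(\<integral>\<^sup>+r. indicator {a..a + b} r * ennreal (c * field_at \<omega> x (s + r)) \<partial>lborel)
      = (\<integral>\<^sup>+r. indicator {a..a + b} (a + 1 * r) * ennreal (c * field_at \<omega> x (s + (a + 1 * r))) \<partial>lborel)"
    by (subst nn_integral_real_affine[where c=1 and t=a]) auto
  also have "\<dots> = part_integral c (\<lambda>_. x) (s + a) b \<omega>"
    unfolding part_integral_def by (intro nn_integral_cong) (auto simp: indicator_def add.assoc)
  finally show ?thesis by simp
qed

text \<open>Tonelli and stationarity: each instant contributes at most the first absolute moment at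
  time 0.\<close>

lemma nn_integral_part_integral_le:
  assumes c: "\<bar>c\<bar> \<le> 1" and t: "t \<ge> 0"
  shows "(\<integral>\<^sup>+\<omega>. part_integral c (\<lambda>_. x) 0 t \<omega> \<partial>M) \<le> (\<integral>\<^sup>+\<omega>. ennreal \<bar>\<xi> x 0 \<omega>\<bar> \<partial>M) * ennreal t"
proof -
  interpret pair_sigma_finite lborel M ..
  let ?m = "\<integral>\<^sup>+\<omega>. ennreal \<bar>\<xi> x 0 \<omega>\<bar> \<partial>M"
  have meas: "(\<lambda>(r, \<omega>). indicator {0..t} r * ennreal (c * field_at \<omega> x (0 + r))) \<in> borel_measurable (lborel \<Otimes>\<^sub>M M)"
    using measurable_pair_swap[OF measurable_part_integrand[of "\<lambda>_. x" t c 0]] by simp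
  have comp: "(\<lambda>f. ennreal \<bar>f (x, 0)\<bar>) \<in> borel_measurable (env_space :: ((int ^ 'd) \<times> real \<Rightarrow> real) measure)"
  proof -
    have "(\<lambda>f. f (x, 0)) \<in> borel_measurable (env_space :: ((int ^ 'd) \<times> real \<Rightarrow> real) measure)"
      unfolding env_space_def by (rule measurable_component_singleton) simp
    then show ?thesis by simp
  qed
  have stat: "(\<integral>\<^sup>+\<omega>. ennreal \<bar>\<xi> x r \<omega>\<bar> \<partial>M) = ?m" if "r \<ge> 0" for r
    using nn_integral_path[OF that comp] nn_integral_path[OF order.refl comp] by (simp add: env_path_def)
  have "(\<integral>\<^sup>+\<omega>. part_integral c (\<lambda>_. x) 0 t \<omega> \<partial>M)
      = (\<integral>\<^sup>+r. (\<integral>\<^sup>+\<omega>. indicator {0..t} r * ennreal (c * field_at \<omega> x (0 + r)) \<partial>M) \<partial>lborel)"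
    unfolding part_integral_def by (rule Fubini'[OF meas])
  also have "\<dots> \<le> (\<integral>\<^sup>+r. indicator {0..t} r * ?m \<partial>lborel)"
  proof (rule nn_integral_mono)
    fix r :: real
    show "(\<integral>\<^sup>+\<omega>. indicator {0..t} r * ennreal (c * field_at \<omega> x (0 + r)) \<partial>M) \<le> indicator {0..t} r * ?m"
    proof (cases "r \<in> {0..t}")
      case True
      have "c * z \<le> \<bar>z\<bar>" for z
        using mult_right_mono[OF c, of "\<bar>z\<bar>"] by (metis abs_ge_zero abs_le_D1 abs_mult mult_1)
      then have "(\<integral>\<^sup>+\<omega>. ennreal (c * field_at \<omega> x (0 + r)) \<partial>M) \<le> (\<integral>\<^sup>+\<omega>. ennreal \<bar>\<xi> x r \<omega>\<bar> \<partial>M)"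
        using True by (intro nn_integral_mono ennreal_leI) (simp add: field_at_def max_absorb2)
      then show ?thesis using True stat[of r] by simp
    qed simp
  qed
  also have "\<dots> = ?m * ennreal t" using t by (simp add: nn_integral_multc mult.commute)
  finally show ?thesis .
qed

end

section \<open>The logarithm of the solution at the origin\<close>

locale pam_environment = ergodic_field M \<xi>
  for M :: "'w measure" and \<xi> :: "int ^ 'd \<Rightarrow> real \<Rightarrow> 'w \<Rightarrow> real" +
  fixes \<kappa> \<gamma> c :: real
  assumes locally_integrable: "AE \<omega> in M. \<forall>x. \<forall>t\<ge>0. set_integrable lborel {0..t} (\<lambda>s. \<xi> x s \<omega>)"
    and integrable_field: "integrable M (\<xi> 0 0)"
    and \<kappa>_nonneg: "\<kappa> \<ge> 0" and \<gamma>_nonneg: "\<gamma> \<ge> 0"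
    and growth: "\<And>t. t \<ge> 0 \<Longrightarrow>
      ereal_expectation M (\<lambda>\<omega>. ln_ennreal (pam_solution \<kappa> \<gamma> \<xi> 0 t \<omega>)) \<le> ereal (c * t)"
begin

lemma AE_potential: "AE \<omega> in M. \<omega> \<in> space M \<and> potential (field_at \<omega>)"
  using locally_integrable AE_space
proof eventually_elim
  case (elim \<omega>)
  have "potential (field_at \<omega>)"
  proof
    show "field_at \<omega> x \<in> borel_measurable borel" for x
      using elim by (intro measurable_field_at) auto
    show "set_integrable lborel {0..t} (field_at \<omega> x)" if "t \<ge> 0" for x t
    proof -
      have "set_integrable lborel {0..t} (\<lambda>s. \<xi> x s \<omega>)" using elim that by blast
      also have "?this \<longleftrightarrow> set_integrable lborel {0..t} (field_at \<omega> x)"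
        by (rule set_integrable_cong) (auto simp: field_at_def max_absorb2)
      finally show ?thesis .
    qed
  qed
  with elim show ?case by blast
qed

definition U :: "real \<Rightarrow> real \<Rightarrow> 'w \<Rightarrow> ennreal" where
  "U s t \<omega> = feynman_kac (field_at \<omega>) \<kappa> \<gamma> s t"

lemma pam_solution_eq: "pam_solution \<kappa> \<gamma> \<xi> 0 t \<omega> = U 0 t \<omega>"
proof -
  have "(LBINT r:{0..t}. \<xi> (walk \<kappa> w r) r \<omega>) = (LBINT r:{0..t}. field_at \<omega> (walk \<kappa> w r) (0 + r))" for w
    by (intro set_lebesgue_integral_cong) (auto simp: field_at_def max_absorb2)
  then show ?thesis by (simp add: pam_solution_def U_def feynman_kac_def energy_def)
qed

lemma energy_jointly_measurable:
  "(\<lambda>x. energy (field_at (snd x)) \<kappa> (fst x) s t) \<in> borel_measurable (walk_space \<Otimes>\<^sub>M M)"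
  unfolding energy_def set_lebesgue_integral_def
proof (rule lborel.borel_measurable_lebesgue_integral)
  have w: "(\<lambda>x. walk \<kappa> (fst (fst x)) (snd x))
      \<in> measurable ((walk_space \<Otimes>\<^sub>M M) \<Otimes>\<^sub>M lborel) (count_space (UNIV :: (int ^ 'd) set))"
  proof -
    have "(\<lambda>x. (fst (fst x), snd x)) \<in> measurable ((walk_space \<Otimes>\<^sub>M M) \<Otimes>\<^sub>M lborel) (walk_space \<Otimes>\<^sub>M borel)"
      by measurable
    from measurable_compose[OF this measurable_walk] show ?thesis by simp
  qed
  have [measurable]: "(\<lambda>x. field_at (snd (fst x)) (walk \<kappa> (fst (fst x)) (snd x)) (s + snd x))
      \<in> borel_measurable ((walk_space \<Otimes>\<^sub>M M) \<Otimes>\<^sub>M lborel)"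
    by (rule measurable_field_at[OF _ w]) measurable
  show "(\<lambda>(x, r). indicator {0..t} r *\<^sub>R field_at (snd x) (walk \<kappa> (fst x) r) (s + r))
      \<in> borel_measurable ((walk_space \<Otimes>\<^sub>M M) \<Otimes>\<^sub>M lborel)"
    unfolding split_beta' by measurable
qed

lemma feynman_kac_integrand_measurable:
  "(\<lambda>(w, \<omega>). ennreal (exp (\<gamma> * energy (field_at \<omega>) \<kappa> w s t)) * (if walk \<kappa> w t = 0 then 1 else 0))
    \<in> borel_measurable (walk_space \<Otimes>\<^sub>M M)"
proof -
  note [measurable] = energy_jointly_measurable
  show ?thesis unfolding split_beta' by measurable
qed

lemma U_measurable[measurable]: "U s t \<in> borel_measurable M"
  unfolding U_def[abs_def] feynman_kac_def
  using measurable_pair_swap[OF feynman_kac_integrand_measurable[of s t]]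
  by (intro walk_space.borel_measurable_nn_integral) simp

text \<open>For a fixed nonexplosive walk the energy is a time integral along a deterministic path,
  hence a factor; the expectation over the walk is one more integral of factors.\<close>

lemma is_factor_U:
  assumes t: "t \<ge> 0"
  shows "is_factor (\<lambda>s. U s t)"
  unfolding U_def[abs_def] feynman_kac_def
proof (rule is_factor_nn_integral[OF walk_space.finite_measure_axioms feynman_kac_integrand_measurable])
  show "AE w in walk_space. is_factor (\<lambda>s \<omega>. ennreal (exp (\<gamma> * energy (field_at \<omega>) \<kappa> w s t)) * (if walk \<kappa> w t = 0 then 1 else 0))"
    using AE_nonexplosive AE_space
  proof eventually_elim
    case (elim w)
    have y: "(\<lambda>r. walk \<kappa> w r) \<in> measurable borel (count_space (UNIV :: (int ^ 'd) set))"
      using measurable_compose[OF measurable_Pair1'[OF elim(2)] measurable_walk] by simp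
    have "is_factor (\<lambda>s \<omega>. energy (field_at \<omega>) \<kappa> w s t)"
      unfolding energy_def
    proof (rule is_factor_set_integral[OF y])
      show "AE \<omega> in M. \<forall>s\<ge>0. set_integrable lborel {0..t} (\<lambda>r. field_at \<omega> (walk \<kappa> w r) (s + r))"
        using AE_potential
      proof eventually_elim
        case (elim \<omega>)
        then interpret potential "field_at \<omega>" by blast
        show ?case using e_walk_integrable[OF \<open>nonexplosive w\<close> \<kappa>_nonneg _ t] by blast
      qed
    qed
    then show ?case
      by (rule is_factor_compose[of _ "\<lambda>z. ennreal (exp (\<gamma> * z)) * (if walk \<kappa> w t = 0 then 1 else 0)"]) simp
  qed
qed

text \<open>\<open>log_min s t\<close> is the lower bound for \<open>log U s t\<close> coming from the walks that do not jump;
  subtracting it leaves a nonnegative superadditive process.\<close>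

definition log_min :: "real \<Rightarrow> real \<Rightarrow> 'w \<Rightarrow> real" where
  "log_min s t \<omega> = - (2 * real CARD('d) * \<kappa> * t) + \<gamma> * (LBINT r:{0..t}. field_at \<omega> 0 (s + r))"

text \<open>Dividing inside the logarithm avoids infinite differences when \<open>U\<close> is
  infinite. For almost every sample the argument is at least 1 by \<open>log_min_le\<close>, so
  \<open>e2ennreal\<close> does not truncate.\<close>

definition excess :: "real \<Rightarrow> real \<Rightarrow> 'w \<Rightarrow> ennreal" where
  "excess s t \<omega> = e2ennreal (ln_ennreal (U s t \<omega> * ennreal (exp (- log_min s t \<omega>))))"

lemma measurable_field_integral: "(\<lambda>\<omega>. LBINT r:{0..t}. field_at \<omega> 0 (s + r)) \<in> borel_measurable M"
  unfolding set_lebesgue_integral_def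
proof (rule lborel.borel_measurable_lebesgue_integral)
  have [measurable]: "(\<lambda>x. field_at (fst x) 0 (s + snd x)) \<in> borel_measurable (M \<Otimes>\<^sub>M lborel)"
    by (rule measurable_field_at) measurable
  show "(\<lambda>(\<omega>, r). indicator {0..t} r *\<^sub>R field_at \<omega> 0 (s + r)) \<in> borel_measurable (M \<Otimes>\<^sub>M lborel)"
    unfolding split_beta' by measurable
qed

lemma log_min_measurable[measurable]: "log_min s t \<in> borel_measurable M"
  unfolding log_min_def[abs_def] using measurable_field_integral by measurable

lemma excess_measurable[measurable]: "excess s t \<in> borel_measurable M"
  unfolding excess_def[abs_def] by measurable

lemma log_min_add:
  assumes "potential (field_at \<omega>)" "s \<ge> 0" "a \<ge> 0" "b \<ge> 0"
  shows "log_min s (a + b) \<omega> = log_min s a \<omega> + log_min (s + a) b \<omega>"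
proof -
  interpret potential "field_at \<omega>" by fact
  have "(LBINT r:{0..a + b}. field_at \<omega> 0 (s + r))
      = (LBINT r:{0..a}. field_at \<omega> 0 (s + r)) + (LBINT r:{0..b}. field_at \<omega> 0 (s + (a + r)))"
    using assms by (intro set_integral_lborel_split e_integrable_shift) auto
  then show ?thesis by (simp add: log_min_def algebra_simps)
qed

lemma log_min_le:
  assumes "potential (field_at \<omega>)" "s \<ge> 0" "t \<ge> 0"
  shows "1 \<le> U s t \<omega> * ennreal (exp (- log_min s t \<omega>))"
proof -
  interpret potential "field_at \<omega>" by fact
  have "ennreal (exp (log_min s t \<omega>)) \<le> U s t \<omega>"
    unfolding U_def log_min_def using assms by (intro feynman_kac_ge \<kappa>_nonneg)
  then have "ennreal (exp (log_min s t \<omega>)) * ennreal (exp (- log_min s t \<omega>)) \<le> U s t \<omega> * ennreal (exp (- log_min s t \<omega>))"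
    by (intro mult_right_mono) auto
  then show ?thesis by (simp add: exp_minus flip: ennreal_mult)
qed

lemma excess_superadditive:
  assumes pot: "potential (field_at \<omega>)" and s: "s \<ge> 0" "a \<ge> 0" "b \<ge> 0"
  shows "excess s a \<omega> + excess (s + a) b \<omega> \<le> excess s (a + b) \<omega>"
  unfolding excess_def
proof (rule e2ennreal_ln_ennreal_superadditive)
  interpret potential "field_at \<omega>" by fact
  show "1 \<le> U s a \<omega> * ennreal (exp (- log_min s a \<omega>))" "1 \<le> U (s + a) b \<omega> * ennreal (exp (- log_min (s + a) b \<omega>))"
    using s by (auto intro!: log_min_le[OF pot])
  have "exp (- log_min s (a + b) \<omega>) = exp (- log_min s a \<omega>) * exp (- log_min (s + a) b \<omega>)"
    using log_min_add[OF pot s] by (simp add: exp_add[symmetric])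
  then have "U s a \<omega> * ennreal (exp (- log_min s a \<omega>)) * (U (s + a) b \<omega> * ennreal (exp (- log_min (s + a) b \<omega>)))
      = (U s a \<omega> * U (s + a) b \<omega>) * ennreal (exp (- log_min s (a + b) \<omega>))"
    by (simp add: ennreal_mult mult_ac)
  also have "\<dots> \<le> U s (a + b) \<omega> * ennreal (exp (- log_min s (a + b) \<omega>))"
    unfolding U_def by (intro mult_right_mono feynman_kac_mult_le \<kappa>_nonneg s) auto
  finally show "U s a \<omega> * ennreal (exp (- log_min s a \<omega>)) * (U (s + a) b \<omega> * ennreal (exp (- log_min (s + a) b \<omega>)))
      \<le> U s (a + b) \<omega> * ennreal (exp (- log_min s (a + b) \<omega>))" .
qed

lemma is_factor_excess:
  assumes t: "t \<ge> 0"
  shows "is_factor (\<lambda>s. excess s t)"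
proof -
  have "is_factor (\<lambda>s \<omega>. LBINT r:{0..t}. field_at \<omega> 0 (s + r))"
  proof (rule is_factor_set_integral)
    show "AE \<omega> in M. \<forall>s\<ge>0. set_integrable lborel {0..t} (\<lambda>r. field_at \<omega> 0 (s + r))"
      using AE_potential by eventually_elim (use potential.e_integrable_shift t in blast)
  qed simp
  from is_factor_compose[OF is_factor_Pair[OF is_factor_U[OF t] this],
      of "\<lambda>x. e2ennreal (ln_ennreal (fst x * ennreal (exp (- (- (2 * real CARD('d) * \<kappa> * t) + \<gamma> * snd x)))))"]
  show ?thesis by (simp add: excess_def[abs_def] log_min_def borel_prod[symmetric])
qed

text \<open>The identity \<open>excess = log u - log_min\<close> is written without subtraction since \<open>log u\<close> may be infinite.\<close>

lemma excess_balance: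
  assumes "potential (field_at \<omega>)" "t \<ge> 0"
  shows "excess 0 t \<omega> + ennreal (log_min 0 t \<omega>) + e2ennreal (- ln_ennreal (U 0 t \<omega>))
    = e2ennreal (ln_ennreal (U 0 t \<omega>)) + ennreal (- log_min 0 t \<omega>)"
    and "e2ennreal (- ln_ennreal (U 0 t \<omega>)) \<le> ennreal (- log_min 0 t \<omega>)"
    and "U 0 t \<omega> < \<infinity> \<Longrightarrow> ln_ennreal (U 0 t \<omega>) = ereal (enn2real (excess 0 t \<omega>) + log_min 0 t \<omega>)"
    and "U 0 t \<omega> = \<infinity> \<Longrightarrow> excess 0 t \<omega> = \<infinity>"
proof -
  define b where "b = log_min 0 t \<omega>"
  have ge: "1 \<le> U 0 t \<omega> * ennreal (exp (- b))"
    using log_min_le[OF assms(1) _ assms(2), of 0] by (simp add: b_def)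
  have *: "excess 0 t \<omega> + ennreal b + e2ennreal (- ln_ennreal (U 0 t \<omega>)) = e2ennreal (ln_ennreal (U 0 t \<omega>)) + ennreal (- b)
      \<and> e2ennreal (- ln_ennreal (U 0 t \<omega>)) \<le> ennreal (- b)
      \<and> (U 0 t \<omega> < \<infinity> \<longrightarrow> ln_ennreal (U 0 t \<omega>) = ereal (enn2real (excess 0 t \<omega>) + b))
      \<and> (U 0 t \<omega> = \<infinity> \<longrightarrow> excess 0 t \<omega> = \<infinity>)"
  proof (cases "U 0 t \<omega>")
    case top
    have "ennreal (exp (- b)) \<noteq> 0" by simp
    then have "excess 0 t \<omega> = \<top>"
      unfolding excess_def b_def[symmetric] top by (simp add: ennreal_top_mult)
    then show ?thesis by (simp add: top e2ennreal_neg)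
  next
    case (real r)
    have "ennreal 1 \<le> ennreal (r * exp (- b))" using ge real by (simp add: ennreal_mult)
    then have r1: "1 \<le> r * exp (- b)" using real by (subst (asm) ennreal_le_iff) auto
    then have r: "r > 0" using real(1) by (cases "r = 0") auto
    have ln: "ln (r * exp (- b)) = ln r - b" using r by (simp add: ln_mult)
    have b: "b \<le> ln r" using ln_ge_zero[OF r1] ln by simp
    have "excess 0 t \<omega> = e2ennreal (ln_ennreal (ennreal (r * exp (- b))))"
      unfolding excess_def b_def[symmetric] using real r by (simp add: ennreal_mult)
    also have "\<dots> = ennreal (ln r - b)" using r ln by (subst ln_ennreal_ennreal) (auto simp: e2ennreal_ereal)
    finally have ex: "excess 0 t \<omega> = ennreal (ln r - b)" .
    have lnU: "ln_ennreal (U 0 t \<omega>) = ereal (ln r)" using real r by (simp add: ln_ennreal_ennreal)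
    \<comment> \<open>Both sides say that \<open>ln r\<close> is the sum of \<open>ln r - b\<close>
      and \<open>b\<close>, with negative parts moved across; the case split decides which parts
      vanish.\<close>
    have "ennreal (ln r - b) + ennreal b + ennreal (- ln r) = ennreal (ln r) + ennreal (- b)"
      using b by (cases "b \<ge> 0"; cases "ln r \<ge> 0") (auto simp: ennreal_neg simp flip: ennreal_plus)
    moreover have "ennreal (- ln r) \<le> ennreal (- b)" using b by (intro ennreal_leI) simp
    ultimately show ?thesis using b ex lnU real by (simp add: e2ennreal_ereal)
  qed
  then show "excess 0 t \<omega> + ennreal (log_min 0 t \<omega>) + e2ennreal (- ln_ennreal (U 0 t \<omega>))
      = e2ennreal (ln_ennreal (U 0 t \<omega>)) + ennreal (- log_min 0 t \<omega>)"
    and "e2ennreal (- ln_ennreal (U 0 t \<omega>)) \<le> ennreal (- log_min 0 t \<omega>)"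
    and "U 0 t \<omega> < \<infinity> \<Longrightarrow> ln_ennreal (U 0 t \<omega>) = ereal (enn2real (excess 0 t \<omega>) + log_min 0 t \<omega>)"
    and "U 0 t \<omega> = \<infinity> \<Longrightarrow> excess 0 t \<omega> = \<infinity>"
    unfolding b_def by blast+
qed

definition first_moment :: real where
  "first_moment = enn2real (\<integral>\<^sup>+\<omega>. ennreal \<bar>\<xi> 0 0 \<omega>\<bar> \<partial>M)"

lemma first_moment: "(\<integral>\<^sup>+\<omega>. ennreal \<bar>\<xi> 0 0 \<omega>\<bar> \<partial>M) = ennreal first_moment" "first_moment \<ge> 0"
proof -
  have "(\<integral>\<^sup>+\<omega>. ennreal \<bar>\<xi> 0 0 \<omega>\<bar> \<partial>M) < \<infinity>"
    using integrable_field by (simp add: integrable_iff_bounded)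
  then show "(\<integral>\<^sup>+\<omega>. ennreal \<bar>\<xi> 0 0 \<omega>\<bar> \<partial>M) = ennreal first_moment"
    by (simp add: first_moment_def)
qed (simp add: first_moment_def)

lemma nn_integral_part_integral_origin:
  assumes "\<bar>q\<bar> \<le> 1" "t \<ge> 0"
  shows "(\<integral>\<^sup>+\<omega>. part_integral q (\<lambda>_. 0) 0 t \<omega> \<partial>M) \<le> ennreal (first_moment * t)"
  using nn_integral_part_integral_le[OF assms, of 0] first_moment assms by (simp add: ennreal_mult)

lemma field_integral_eq:
  assumes "potential (field_at \<omega>)" "s \<ge> 0" "t \<ge> 0"
  shows "(LBINT r:{0..t}. field_at \<omega> 0 (s + r))
    = enn2real (part_integral 1 (\<lambda>_. 0) s t \<omega>) - enn2real (part_integral (-1) (\<lambda>_. 0) s t \<omega>)"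
  using assms by (intro set_integral_eq_part_integral potential.e_integrable_shift)

text \<open>Dropping the positive part of the field only enlarges \<open>- log_min\<close>; what
  remains is the deterministic cost of not jumping and the mean of the negative part.\<close>

lemma nn_integral_neg_log_min_le:
  assumes t: "t \<ge> 0"
  shows "(\<integral>\<^sup>+\<omega>. ennreal (- log_min 0 t \<omega>) \<partial>M) \<le> ennreal ((2 * real CARD('d) * \<kappa> + \<gamma> * first_moment) * t)"
proof -
  let ?a = "2 * real CARD('d) * \<kappa> * t" and ?N = "part_integral (-1) (\<lambda>_. 0) 0 t"
  have a: "?a \<ge> 0" using \<kappa>_nonneg t by simp
  have N[measurable]: "?N \<in> borel_measurable M" by (rule measurable_part_integral) simp
  have "(\<integral>\<^sup>+\<omega>. ennreal (- log_min 0 t \<omega>) \<partial>M) \<le> (\<integral>\<^sup>+\<omega>. ennreal ?a + ennreal \<gamma> * ?N \<omega> \<partial>M)"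
  proof (rule nn_integral_mono_AE)
    show "AE \<omega> in M. ennreal (- log_min 0 t \<omega>) \<le> ennreal ?a + ennreal \<gamma> * ?N \<omega>"
      using AE_potential
    proof eventually_elim
      case (elim \<omega>)
      have I: "(LBINT r:{0..t}. field_at \<omega> 0 (0 + r)) = enn2real (part_integral 1 (\<lambda>_. 0) 0 t \<omega>) - enn2real (?N \<omega>)"
        using elim t by (intro field_integral_eq) auto
      have "- log_min 0 t \<omega> = ?a + \<gamma> * (enn2real (?N \<omega>) - enn2real (part_integral 1 (\<lambda>_. 0) 0 t \<omega>))"
        unfolding log_min_def I by (simp add: algebra_simps)
      also have "\<dots> \<le> ?a + \<gamma> * enn2real (?N \<omega>)"
        using \<gamma>_nonneg by (intro add_left_mono mult_left_mono) auto
      finally have "ennreal (- log_min 0 t \<omega>) \<le> ennreal (?a + \<gamma> * enn2real (?N \<omega>))" by (rule ennreal_leI)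
      also have "\<dots> = ennreal ?a + ennreal \<gamma> * ennreal (enn2real (?N \<omega>))"
        using a \<gamma>_nonneg by (simp add: ennreal_plus ennreal_mult)
      also have "\<dots> \<le> ennreal ?a + ennreal \<gamma> * ?N \<omega>"
        by (intro add_left_mono mult_left_mono) (cases "?N \<omega>"; simp)+
      finally show ?case .
    qed
  qed
  also have "\<dots> = ennreal ?a + ennreal \<gamma> * (\<integral>\<^sup>+\<omega>. ?N \<omega> \<partial>M)"
    by (simp add: nn_integral_add nn_integral_cmult emeasure_space_1)
  also have "\<dots> \<le> ennreal ?a + ennreal \<gamma> * ennreal (first_moment * t)"
    by (intro add_left_mono mult_left_mono nn_integral_part_integral_origin t) auto
  also have "\<dots> = ennreal (?a + \<gamma> * (first_moment * t))"
    using a \<gamma>_nonneg first_moment t by (simp add: ennreal_plus ennreal_mult)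
  also have "?a + \<gamma> * (first_moment * t) = (2 * real CARD('d) * \<kappa> + \<gamma> * first_moment) * t"
    by (simp add: algebra_simps)
  finally show ?thesis .
qed

text \<open>Assumption (B) bounds the positive part of the logarithm only relative to its negative
  part. The latter is at most the negative part of \<open>log_min\<close>, whose mean is finite, so
  it can be cancelled from the balance. The absolute value of \<open>c\<close> keeps the rate
  nonnegative.\<close>

lemma nn_integral_excess_le:
  assumes t: "t \<ge> 0"
  shows "(\<integral>\<^sup>+\<omega>. excess 0 t \<omega> \<partial>M) \<le> ennreal ((\<bar>c\<bar> + 2 * real CARD('d) * \<kappa> + \<gamma> * first_moment) * t)"
proof -
  let ?p = "\<integral>\<^sup>+\<omega>. e2ennreal (ln_ennreal (U 0 t \<omega>)) \<partial>M"
  let ?q = "\<integral>\<^sup>+\<omega>. e2ennreal (- ln_ennreal (U 0 t \<omega>)) \<partial>M"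
  let ?n = "\<integral>\<^sup>+\<omega>. ennreal (- log_min 0 t \<omega>) \<partial>M"
  let ?C = "(2 * real CARD('d) * \<kappa> + \<gamma> * first_moment) * t"
  have n: "?n \<le> ennreal ?C" by (rule nn_integral_neg_log_min_le[OF t])
  have "?q \<le> ?n"
  proof (rule nn_integral_mono_AE)
    show "AE \<omega> in M. e2ennreal (- ln_ennreal (U 0 t \<omega>)) \<le> ennreal (- log_min 0 t \<omega>)"
      using AE_potential by eventually_elim (intro excess_balance(2) t, blast)
  qed
  then have q: "?q < \<top>" using n by (metis ennreal_less_top order.strict_trans1)
  have p: "?p \<le> ennreal (\<bar>c\<bar> * t) + ?q"
  proof -
    have "enn2ereal ?p - enn2ereal ?q \<le> ereal (c * t)"
      using growth[OF t] by (simp add: ereal_expectation_def pam_solution_eq)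
    also have "\<dots> \<le> ereal (\<bar>c\<bar> * t)" using t by (simp add: mult_right_mono)
    finally have le: "enn2ereal ?p - enn2ereal ?q \<le> ereal (\<bar>c\<bar> * t)" .
    obtain q' where q': "?q = ennreal q'" "q' \<ge> 0" using q by (cases ?q) auto
    show ?thesis
    proof (cases ?p)
      case top
      then show ?thesis using le q' by (simp add: enn2ereal_ennreal)
    next
      case (real p')
      then have "p' - q' \<le> \<bar>c\<bar> * t" using le q' by (simp add: enn2ereal_ennreal)
      then have "ennreal p' \<le> ennreal (\<bar>c\<bar> * t + q')" by (intro ennreal_leI) simp
      then show ?thesis using real q' t by (simp add: ennreal_plus)
    qed
  qed
  \<comment> \<open>The nonnegative mean of the positive part of \<open>log_min\<close> is added for
    free; this completes the left side of \<open>excess_balance\<close>.\<close>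
  have "(\<integral>\<^sup>+\<omega>. excess 0 t \<omega> \<partial>M) + ?q \<le> (\<integral>\<^sup>+\<omega>. excess 0 t \<omega> + ennreal (log_min 0 t \<omega>) + e2ennreal (- ln_ennreal (U 0 t \<omega>)) \<partial>M)"
    by (simp add: nn_integral_add add_right_mono add_increasing2)
  also have "\<dots> = (\<integral>\<^sup>+\<omega>. e2ennreal (ln_ennreal (U 0 t \<omega>)) + ennreal (- log_min 0 t \<omega>) \<partial>M)"
  proof (rule nn_integral_cong_AE)
    show "AE \<omega> in M. excess 0 t \<omega> + ennreal (log_min 0 t \<omega>) + e2ennreal (- ln_ennreal (U 0 t \<omega>))
        = e2ennreal (ln_ennreal (U 0 t \<omega>)) + ennreal (- log_min 0 t \<omega>)"
      using AE_potential by eventually_elim (intro excess_balance(1) t, blast)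
  qed
  also have "\<dots> = ?p + ?n" by (rule nn_integral_add) measurable
  also have "\<dots> \<le> ennreal (\<bar>c\<bar> * t) + ?q + ennreal ?C" by (intro add_mono p n)
  finally have "?q + (\<integral>\<^sup>+\<omega>. excess 0 t \<omega> \<partial>M) \<le> ?q + (ennreal (\<bar>c\<bar> * t) + ennreal ?C)"
    by (simp add: add_ac)
  \<comment> \<open>Cancelling \<open>?q\<close> is legitimate because it is finite.\<close>
  then have "(\<integral>\<^sup>+\<omega>. excess 0 t \<omega> \<partial>M) \<le> ennreal (\<bar>c\<bar> * t) + ennreal ?C"
    using q by (auto simp: ennreal_add_left_cancel_le)
  also have "\<dots> = ennreal (\<bar>c\<bar> * t + ?C)"
    using t \<kappa>_nonneg \<gamma>_nonneg first_moment by (intro ennreal_plus[symmetric]) auto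
  also have "\<bar>c\<bar> * t + ?C = (\<bar>c\<bar> + 2 * real CARD('d) * \<kappa> + \<gamma> * first_moment) * t"
    by (simp add: algebra_simps)
  finally show ?thesis .
qed

lemma excess_limit:
  "\<exists>l. (AE \<omega> in M. (\<forall>t\<ge>0. excess 0 t \<omega> < \<infinity>) \<and> ((\<lambda>t. enn2real (excess 0 t \<omega>) / t) \<longlongrightarrow> l) at_top) \<and>
    ((\<lambda>t. \<integral>\<^sup>+\<omega>. ennreal \<bar>enn2real (excess 0 t \<omega>) / t - l\<bar> \<partial>M) \<longlongrightarrow> 0) at_top"
proof (rule superadditive_limit[where C="\<bar>c\<bar> + 2 * real CARD('d) * \<kappa> + \<gamma> * first_moment"])
  show "AE \<omega> in M. \<forall>s\<ge>0. \<forall>a\<ge>0. \<forall>b\<ge>0. excess s a \<omega> + excess (s + a) b \<omega> \<le> excess s (a + b) \<omega>"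
    using AE_potential by eventually_elim (blast intro: excess_superadditive)
  fix n :: nat
  show "is_factor (\<lambda>s. excess s (real n))" by (rule is_factor_excess) simp
  show "(\<integral>\<^sup>+\<omega>. excess 0 (real n) \<omega> \<partial>M) \<le> ennreal (\<bar>c\<bar> + 2 * real CARD('d) * \<kappa> + \<gamma> * first_moment) * of_nat n"
    using nn_integral_excess_le[of "real n"] \<kappa>_nonneg \<gamma>_nonneg first_moment(2)
    by (simp add: ennreal_mult ennreal_of_nat_eq_real_of_nat)
qed simp

text \<open>For \<open>q = 1\<close> and \<open>q = -1\<close> this plays the role of the ergodic
  theorem for the field at the origin. The two signs are treated apart because
  \<open>superadditive_limit\<close> takes nonnegative functionals.\<close>

lemma part_integral_limit:
  assumes q: "\<bar>q\<bar> \<le> 1"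
  shows "\<exists>l. (AE \<omega> in M. (\<forall>t\<ge>0. part_integral q (\<lambda>_. 0) 0 t \<omega> < \<infinity>) \<and>
      ((\<lambda>t. enn2real (part_integral q (\<lambda>_. 0) 0 t \<omega>) / t) \<longlongrightarrow> l) at_top) \<and>
    ((\<lambda>t. \<integral>\<^sup>+\<omega>. ennreal \<bar>enn2real (part_integral q (\<lambda>_. 0) 0 t \<omega>) / t - l\<bar> \<partial>M) \<longlongrightarrow> 0) at_top"
proof (rule superadditive_limit[where C=first_moment])
  show "AE \<omega> in M. \<forall>s\<ge>0. \<forall>a\<ge>0. \<forall>b\<ge>0. part_integral q (\<lambda>_. 0) s a \<omega> + part_integral q (\<lambda>_. 0) (s + a) b \<omega> \<le> part_integral q (\<lambda>_. 0) s (a + b) \<omega>"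
    by (intro AE_I2) (blast intro: part_integral_superadditive)
  fix n :: nat
  show "is_factor (\<lambda>s. part_integral q (\<lambda>_. 0) s (real n))" by (rule is_factor_part_integral) simp
  show "(\<integral>\<^sup>+\<omega>. part_integral q (\<lambda>_. 0) 0 (real n) \<omega> \<partial>M) \<le> ennreal first_moment * of_nat n"
    using nn_integral_part_integral_origin[OF q, of "real n"] first_moment(2)
    by (simp add: ennreal_mult ennreal_of_nat_eq_real_of_nat)
  show "part_integral q (\<lambda>_. 0) 0 (real n) \<in> borel_measurable M"
    by (rule measurable_part_integral) simp
qed

theorem log_solution_limit:
  "\<exists>\<Lambda>::real.
      (AE \<omega> in M. ((\<lambda>t. ln_ennreal (U 0 t \<omega>) / ereal t) \<longlongrightarrow> ereal \<Lambda>) at_top) \<and>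
      ((\<lambda>t. \<integral>\<^sup>+ \<omega>. e2ennreal \<bar>ln_ennreal (U 0 t \<omega>) / ereal t - ereal \<Lambda>\<bar> \<partial>M) \<longlongrightarrow> 0) at_top"
proof -
  let ?P = "part_integral 1 (\<lambda>_. 0) 0" and ?N = "part_integral (-1) (\<lambda>_. 0) 0"
  obtain l where l: "AE \<omega> in M. (\<forall>t\<ge>0. excess 0 t \<omega> < \<infinity>) \<and> ((\<lambda>t. enn2real (excess 0 t \<omega>) / t) \<longlongrightarrow> l) at_top"
    "((\<lambda>t. \<integral>\<^sup>+\<omega>. ennreal \<bar>enn2real (excess 0 t \<omega>) / t - l\<bar> \<partial>M) \<longlongrightarrow> 0) at_top"
    using excess_limit by blast
  obtain p where p: "AE \<omega> in M. (\<forall>t\<ge>0. ?P t \<omega> < \<infinity>) \<and> ((\<lambda>t. enn2real (?P t \<omega>) / t) \<longlongrightarrow> p) at_top"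
    "((\<lambda>t. \<integral>\<^sup>+\<omega>. ennreal \<bar>enn2real (?P t \<omega>) / t - p\<bar> \<partial>M) \<longlongrightarrow> 0) at_top"
    using part_integral_limit[of 1] by auto
  obtain n where n: "AE \<omega> in M. (\<forall>t\<ge>0. ?N t \<omega> < \<infinity>) \<and> ((\<lambda>t. enn2real (?N t \<omega>) / t) \<longlongrightarrow> n) at_top"
    "((\<lambda>t. \<integral>\<^sup>+\<omega>. ennreal \<bar>enn2real (?N t \<omega>) / t - n\<bar> \<partial>M) \<longlongrightarrow> 0) at_top"
    using part_integral_limit[of "-1"] by auto
  have [measurable]: "?P t \<in> borel_measurable M" "?N t \<in> borel_measurable M" for t
    by (simp_all add: measurable_part_integral)
  \<comment> \<open>The negative drift is the cost of never jumping, and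
    \<open>\<gamma> * (p - n)\<close> is the growth due to the field at the origin; together they
    are the rate of \<open>log_min\<close>, to which \<open>l\<close> adds that of the
    excess.\<close>
  define \<Lambda> where "\<Lambda> = l - 2 * real CARD('d) * \<kappa> + \<gamma> * (p - n)"
  define L where "L t \<omega> = enn2real (excess 0 t \<omega>) / t - 2 * real CARD('d) * \<kappa> + \<gamma> * (enn2real (?P t \<omega>) / t - enn2real (?N t \<omega>) / t)" for t \<omega>
  have log_eq: "AE \<omega> in M. \<forall>t>0. ln_ennreal (U 0 t \<omega>) / ereal t = ereal (L t \<omega>)"
    using AE_potential l(1)
  proof eventually_elim
    case (elim \<omega>)
    show ?case
    proof (intro allI impI)
      fix t :: real assume t: "t > 0"
      \<comment> \<open>Finiteness of the excess, off one null set for all \<open>t\<close>, is what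
        excludes an infinite solution.\<close>
      then have "excess 0 t \<omega> \<noteq> \<infinity>" using elim by (metis less_irrefl less_imp_le)
      then have "U 0 t \<omega> \<noteq> \<infinity>" using elim t by (meson excess_balance(4) less_imp_le)
      then have eq: "ln_ennreal (U 0 t \<omega>) = ereal (enn2real (excess 0 t \<omega>) + log_min 0 t \<omega>)"
        using elim t by (intro excess_balance(3)) (auto simp: top.not_eq_extremum)
      have I: "(LBINT r:{0..t}. field_at \<omega> 0 (0 + r)) = enn2real (?P t \<omega>) - enn2real (?N t \<omega>)"
        using elim t by (intro field_integral_eq) auto
      have "(enn2real (excess 0 t \<omega>) + log_min 0 t \<omega>) / t = L t \<omega>"
        unfolding log_min_def I L_def using t by (simp add: field_simps)
      then show "ln_ennreal (U 0 t \<omega>) / ereal t = ereal (L t \<omega>)" unfolding eq using t by simp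
    qed
  qed
  have "AE \<omega> in M. ((\<lambda>t. ln_ennreal (U 0 t \<omega>) / ereal t) \<longlongrightarrow> ereal \<Lambda>) at_top"
    using log_eq l(1) p(1) n(1)
  proof eventually_elim
    case (elim \<omega>)
    have "((\<lambda>t. L t \<omega>) \<longlongrightarrow> \<Lambda>) at_top"
      unfolding L_def \<Lambda>_def using elim by (intro tendsto_intros) auto
    then have "((\<lambda>t. ereal (L t \<omega>)) \<longlongrightarrow> ereal \<Lambda>) at_top" by (rule tendsto_ereal)
    moreover have "eventually (\<lambda>t. ereal (L t \<omega>) = ln_ennreal (U 0 t \<omega>) / ereal t) at_top"
      using eventually_gt_at_top[of 0] by eventually_elim (use elim(1) in simp)
    ultimately show ?case by (rule Lim_transform_eventually)
  qed
  moreover have "((\<lambda>t. \<integral>\<^sup>+ \<omega>. e2ennreal \<bar>ln_ennreal (U 0 t \<omega>) / ereal t - ereal \<Lambda>\<bar> \<partial>M) \<longlongrightarrow> 0) at_top"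
  proof (rule tendsto_sandwich[OF _ _ tendsto_const])
    let ?X = "\<lambda>t. \<integral>\<^sup>+\<omega>. ennreal \<bar>enn2real (excess 0 t \<omega>) / t - l\<bar> \<partial>M"
    let ?Y = "\<lambda>t. \<integral>\<^sup>+\<omega>. ennreal \<bar>enn2real (?P t \<omega>) / t - p\<bar> \<partial>M"
    let ?Z = "\<lambda>t. \<integral>\<^sup>+\<omega>. ennreal \<bar>enn2real (?N t \<omega>) / t - n\<bar> \<partial>M"
    have "((\<lambda>t. ?X t + ennreal \<gamma> * (?Y t + ?Z t)) \<longlongrightarrow> 0 + ennreal \<gamma> * (0 + 0)) at_top"
      by (intro tendsto_add tendsto_mult_ennreal tendsto_const l p n) auto
    then show "((\<lambda>t. ?X t + ennreal \<gamma> * (?Y t + ?Z t)) \<longlongrightarrow> 0) at_top" by simp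
    show "eventually (\<lambda>t. (\<integral>\<^sup>+ \<omega>. e2ennreal \<bar>ln_ennreal (U 0 t \<omega>) / ereal t - ereal \<Lambda>\<bar> \<partial>M) \<le> ?X t + ennreal \<gamma> * (?Y t + ?Z t)) at_top"
      using eventually_gt_at_top[of 0]
    proof eventually_elim
      case (elim t)
      have "(\<integral>\<^sup>+ \<omega>. e2ennreal \<bar>ln_ennreal (U 0 t \<omega>) / ereal t - ereal \<Lambda>\<bar> \<partial>M)
        \<le> (\<integral>\<^sup>+ \<omega>. ennreal \<bar>enn2real (excess 0 t \<omega>) / t - l\<bar> + ennreal \<gamma> * (ennreal \<bar>enn2real (?P t \<omega>) / t - p\<bar> + ennreal \<bar>enn2real (?N t \<omega>) / t - n\<bar>) \<partial>M)"
      proof (rule nn_integral_mono_AE)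
        show "AE \<omega> in M. e2ennreal \<bar>ln_ennreal (U 0 t \<omega>) / ereal t - ereal \<Lambda>\<bar>
          \<le> ennreal \<bar>enn2real (excess 0 t \<omega>) / t - l\<bar> + ennreal \<gamma> * (ennreal \<bar>enn2real (?P t \<omega>) / t - p\<bar> + ennreal \<bar>enn2real (?N t \<omega>) / t - n\<bar>)"
          using log_eq
        proof eventually_elim
          case (elim \<omega>)
          let ?x = "enn2real (excess 0 t \<omega>) / t - l"
          let ?y = "enn2real (?P t \<omega>) / t - p"
          let ?z = "enn2real (?N t \<omega>) / t - n"
          have "L t \<omega> - \<Lambda> = ?x + \<gamma> * (?y - ?z)" by (simp add: L_def \<Lambda>_def algebra_simps)
          also have "\<bar>\<dots>\<bar> \<le> \<bar>?x\<bar> + \<bar>\<gamma> * (?y - ?z)\<bar>" by (rule abs_triangle_ineq)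
          also have "\<bar>\<gamma> * (?y - ?z)\<bar> \<le> \<gamma> * (\<bar>?y\<bar> + \<bar>?z\<bar>)"
            using \<gamma>_nonneg by (simp add: abs_mult abs_triangle_ineq4 mult_left_mono)
          finally have "ennreal \<bar>L t \<omega> - \<Lambda>\<bar> \<le> ennreal (\<bar>?x\<bar> + \<gamma> * (\<bar>?y\<bar> + \<bar>?z\<bar>))"
            by (intro ennreal_leI) simp
          also have "\<dots> = ennreal \<bar>?x\<bar> + ennreal \<gamma> * (ennreal \<bar>?y\<bar> + ennreal \<bar>?z\<bar>)"
            using \<gamma>_nonneg by (simp add: ennreal_plus ennreal_mult)
          finally show ?case using elim \<open>t > 0\<close> by (simp add: e2ennreal_ereal)
        qed
      qed
      also have "\<dots> = ?X t + ennreal \<gamma> * (?Y t + ?Z t)"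
        by (simp add: nn_integral_add nn_integral_cmult)
      finally show ?case .
    qed
  qed simp
  ultimately show ?thesis by blast
qed

end

theorem theorem1p1:
  fixes M :: "'w measure"
    and \<xi> :: "int ^ 'd \<Rightarrow> real \<Rightarrow> 'w \<Rightarrow> real"
    and \<kappa> \<gamma> :: real
    and u :: "int ^ 'd \<Rightarrow> real \<Rightarrow> 'w \<Rightarrow> ennreal"
  assumes "prob_space M"
    and "regular_environment M \<xi>"
    and "assumption_A M \<xi>"
    and "assumption_B M \<xi>"
    and "\<kappa> \<ge> 0"
    and "\<gamma> > 0"
    and "u = pam_solution \<kappa> \<gamma> \<xi>"
  shows "\<exists>\<Lambda>\<^sub>0::real.
      (AE \<omega> in M. ((\<lambda>t. ln_ennreal (u 0 t \<omega>) / ereal t) \<longlongrightarrow> ereal \<Lambda>\<^sub>0) at_top) \<and>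
      ((\<lambda>t. \<integral>\<^sup>+ \<omega>. e2ennreal \<bar>ln_ennreal (u 0 t \<omega>) / ereal t - ereal \<Lambda>\<^sub>0\<bar> \<partial>M) \<longlongrightarrow> 0) at_top"
proof -
  interpret prob_space M by fact
  have "0 \<le> \<gamma>" using assms(6) by simp
  then obtain c where c: "\<And>t. t \<ge> 0 \<Longrightarrow>
      ereal_expectation M (\<lambda>\<omega>. ln_ennreal (pam_solution \<kappa> \<gamma> \<xi> 0 t \<omega>)) \<le> ereal (c * t)"
    using assms(4,5) unfolding assumption_B_def by blast
  interpret pam_environment M \<xi> \<kappa> \<gamma> c
    using assms(2,3,5) \<open>0 \<le> \<gamma>\<close> c
    by unfold_locales (auto simp: regular_environment_def assumption_A_def)
  show ?thesis unfolding assms(7) pam_solution_eq by (rule log_solution_limit)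
qed

end
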